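(* For $\gamma>0$, the coverage probability $C(\gamma)$ is given by $$C(\gamma)= \int_{0}^{\infty} \Big(\sum_{i \in \mathcal{C}} \mathbb{E}_{\mathcal{S}}\{ L(r,i,\mathcal{S})A(r,i,\mathcal{S})\}\, f_{R_i}(r) + \sum_{i \in \{Lu,Nu\}} L_c(r,i)A_c(r,i)\, \mathcal{P}_i(r)\, \mathbb{E}_{\mathcal{S}}\{f_{r_{cu}|\mathcal{S}}(r) \} \Big)\, dr,$$ where the expectations over the placement strategy $\mathcal{S}$ are $$\mathbb{E}_{\mathcal{S}}\{ L(r,i,\mathcal{S})A(r,i,\mathcal{S})\}=L(r,i,r_c\leq R^* )A(r,i,r_c \leq R^* ) \left(1-e^{-\lambda_{LBD} \pi {R^*}^2}\right) + \int_{R^*}^{\infty} L(r,i,r_c>R^* )A(r,i,r_c>R^* ) f_{R_c}(r_c)\,d r_c,$$ $$\mathbb{E}_{\mathcal{S}}\{f_{r_{cu}|\mathcal{S}}(r) \}= \int_{R^*}^{\infty} f_{r_{cu}|r_c>R^*} (r) f_{R_c}(r_c)\, dr_c + \left(1- e^{-\lambda_{LBD} \pi {R^*}^2}\right)f_{r_{cu}|r_c\leq R^*} (r),$$ and $$L(r,i,\mathcal{S})=\sum_{k=0}^{m_i-1} (-1)^k \frac{s_r^k}{k!} \frac{d^k}{ds^k} \mathcal{L}_{I+\sigma^2}(s,i,r,\mathcal{S})\Big|_{s=s_r},\qquad L_c(r,i)=\sum_{k=0}^{m_i-1} (-1)^k \frac{s_r^k}{k!} \frac{d^k}{ds^k}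 \mathcal{L}_{I+\sigma^2}^c(s,i,r)\Big|_{s=s_r},$$ with $$s_r=\frac{\gamma\, m_i\, (h_i^2+r^2)^{\alpha_i/2}}{ \rho_i \eta_i}.$$
   Context: The reference user is at the origin of $\mathbb{R}^2$; all distances are horizontal. Let $\mathcal{C}=\{Lu,Nu,Lb,Nb\}$ (line-of-sight (LOS) UAV, non-LOS (NLOS) UAV, LOS terrestrial base station (TBS), NLOS TBS). For $j\in\mathcal{C}$ the positive parameters are: transmit power $\rho_j$ ($\rho_{Lu}=\rho_{Nu}$, $\rho_{Lb}=\rho_{Nb}$), additional path loss $\eta_j$, path loss exponent $\alpha_j$, height $h_j$ ($h_{Lu}=h_{Nu}=h$, $h_{Lb}=h_{Nb}=h_b$), and Nakagami fading parameter $m_j$ (a positive integer). $\sigma^2$ is the noise power. LOS probabilities: $\mathcal{P}_{i}(r)=-a\exp(-b\arctan(h_i/r))+c$ for $i\in\{Lu,Lb\}$, $\mathcal{P}_{Nu}=1-\mathcal{P}_{Lu}$, $\mathcal{P}_{Nb}=1-\mathcal{P}_{Lb}$, with environment constants $a,b,c$. Central UAV and placement strategy: the reference user is uniformly distributed in a disc of radius $r_{max}$ (its cluster). Laser beam directors (LBDs) form a homogeneous Poisson point process (PPP) of density $\lambda_{LBD}$; $r_c$ is the distance from the cluster center to its nearest LBD, with density $f_{R_c}(r_c)=2\pi\lambda_{LBD}r_c e^{-\pi\lambda_{LBD}r_c^2}$, and $R^*>0$ is a fixed critical charging distance. One UAV, the central UAV, is dedicated to this cluster. If $r_c\le R^*$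 (strategy $\mathcal{S}=``r_c\le R^*"$) it is placed above the cluster center; if $r_c>R^*$ (strategy $\mathcal{S}=``r_c>R^*"$) it is placed on the segment joining the cluster center and its nearest LBD, at distance $R^*$ from that LBD. In this second case, quantities conditioned on $\mathcal{S}$ are conditioned on the value of $r_c$ and so depend on $r_c$. $r_{cu}$ is the distance from the reference user to the central UAV and $f_{r_{cu}|\mathcal{S}}$ its density conditioned on $\mathcal{S}$; in particular $f_{r_{cu}|r_c\le R^*}(r)=\frac{2r}{r_{max}^2}\mathbf{1}(0\le r\le r_{max})$. The central UAV at distance $x$ is of type $Lu$ with probability $\mathcal{P}_{Lu}(x)$ and of type $Nu$ with probability $\mathcal{P}_{Nu}(x)$. The other UAVs are modelled as a homogeneous PPP $\Phi_u$ of density $\lambda_u$, and the TBSs as an independent homogeneous PPP $\Phi_b$ of density $\lambda_b$, both independent of the central UAV. Thinning by the LOS probabilities splits these into independent PPPs $\Phi_{Lu},\Phi_{Nu},\Phi_{Lb},\Phi_{Nb}$ with densities $\lambda_i(r)=\lambda_u\mathcal{P}_i(r)$ for $i\in\{Lu,Nu\}$ and $\lambda_i(r)=\lambda_b\mathcal{P}_i(r)$ for $i\in\{Lb,Nb\}$. The density of the distance $R_i$ from the reference user to the nearest point of $\Phi_i$ is $f_{R_i}(r)=2\pi\lambda_i(r)\,r\exp\left(-2\pi\int_0^r\lambda_i(x)x\,dx\right)$. The instantaneous power received from a node of type $j$ at distance $x$ is $\mathcal{R}_j(x)=\rho_j\eta_j(x^2+h_j^2)^{-\alpha_j/2}G_j$,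 where $G_j$ is Gamma distributed with shape $m_j$ and mean $1$, independent across nodes (Nakagami-$m$ fading; Rayleigh fading, used for TBSs, is $m_j=1$). The average received power is $\overline{\mathcal{R}}_j(x)=\rho_j\eta_j(x^2+h_j^2)^{-\alpha_j/2}$. The user connects to the node (central UAV, other UAV or TBS) providing the largest average received power. Association probabilities: $A_c(r,i)$, $i\in\{Lu,Nu\}$, is the probability that the user connects to the central UAV given that it is at distance $r$ with channel type $i$. $A(r,i,\mathcal{S})$, $i\in\mathcal{C}$, is the probability, conditioned on $\mathcal{S}$, that the user connects to the nearest point of $\Phi_i$ given that this point is at distance $r$. Interference: when the user is connected to the central UAV, $I$ is the sum of the instantaneous powers received from all points of $\Phi_j$, $j\in\mathcal{C}$. When it is connected to the nearest point of $\Phi_i$, the paper takes $I=I_c+\sum_{j\in\mathcal{C}\setminus\{i\}}I_j$, where $I_c$ is the power received from the central UAV, $I_j$ the total power received from $\Phi_j$, and the interference from $\Phi_i$ is taken to be $0$. $\mathcal{L}^c_{I+\sigma^2}(s,i,r)=\mathbb{E}[e^{-s(I+\sigma^2)}]$ conditioned on the user being connected to the central UAV at distance $r$ with channel type $i$; $\mathcal{L}_{I+\sigma^2}(s,i,r,\mathcal{S})=\mathbb{E}[e^{-s(I+\sigma^2)}]$ conditioned on $\mathcal{S}$ and on the user being connected to the nearest point of $\Phi_i$ at distance $r$. The coverage probability is $C(\gamma)=\mathbb{P}\left(\frac{S}{I+\sigma^2}\ge\gamma\right)$, where $S$ is the instantaneous power received from the serving node. *)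

theory Defs
  imports "HOL-Probability.Probability"
begin

section \<open>Poisson point processes\<close>

text \<open>A point process is given by an enumeration \<open>X 0, X 1, \<dots>\<close> of its points. The order of
  the enumeration is irrelevant for the counts. A homogeneous process of positive density on the
  plane has almost surely infinitely many points, so indexing by all naturals loses nothing.\<close>

definition point_count :: "(nat \<Rightarrow> 'w \<Rightarrow> 'b) \<Rightarrow> 'b set \<Rightarrow> 'w \<Rightarrow> nat" where
  "point_count X B \<omega> = card {n. X n \<omega> \<in> B}"

definition homogeneous_ppp ::
    "'w measure \<Rightarrow> real \<Rightarrow> (nat \<Rightarrow> 'w \<Rightarrow> 'b::euclidean_space) \<Rightarrow> bool" where
  "homogeneous_ppp M l X \<longleftrightarrow>
     (\<forall>n. X n \<in> borel_measurable M) \<and>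
     (\<forall>B\<in>sets borel. bounded B \<longrightarrow>
        (AE \<omega> in M. finite {n. X n \<omega> \<in> B}) \<and>
        (\<forall>k. measure M {\<omega>\<in>space M. point_count X B \<omega> = k} =
             (l * measure lborel B) ^ k / fact k * exp (- (l * measure lborel B)))) \<and>
     (\<forall>(B :: nat \<Rightarrow> 'b set) N.
        (\<forall>i<N. B i \<in> sets borel \<and> bounded (B i)) \<and> disjoint_family_on B {..<N} \<longrightarrow>
        prob_space.indep_vars M (\<lambda>_. count_space UNIV) (\<lambda>i. point_count X (B i)) {..<N})"


section \<open>Conditioning on the value of a random variable\<close>

text \<open>Conditional probabilities and conditional laws given an event \<open>D\<close> and a value \<open>X = x\<close>
  are versions: they are determined up to a null set of the law of \<open>X\<close> on \<open>D\<close>. Normalising both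
  sides by the probability of \<open>D\<close> would not change the defining equations.

  \<open>is_cond_prob M D N X E q\<close> means \<open>q x = \<P>(E | D, X = x)\<close>.\<close>

definition is_cond_prob ::
    "'w measure \<Rightarrow> ('w \<Rightarrow> bool) \<Rightarrow> 'x measure \<Rightarrow> ('w \<Rightarrow> 'x) \<Rightarrow> ('w \<Rightarrow> bool) \<Rightarrow> ('x \<Rightarrow> real) \<Rightarrow> bool"
  where
  "is_cond_prob M D N X E q \<longleftrightarrow>
     q \<in> borel_measurable N \<and> (\<forall>x\<in>space N. 0 \<le> q x \<and> q x \<le> 1) \<and>
     (\<forall>B\<in>sets N. measure M {\<omega>\<in>space M. D \<omega> \<and> X \<omega> \<in> B \<and> E \<omega>} =
        (LINT \<omega>|M. indicator {\<omega>. D \<omega> \<and> X \<omega> \<in> B} \<omega> * q (X \<omega>)))"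

text \<open>\<open>K x\<close> is the law of \<open>Y\<close> given \<open>D\<close> and \<open>X = x\<close> (a regular conditional distribution).\<close>

definition is_cond_law ::
    "'w measure \<Rightarrow> ('w \<Rightarrow> bool) \<Rightarrow> 'x measure \<Rightarrow> ('w \<Rightarrow> 'x) \<Rightarrow>
     'y measure \<Rightarrow> ('w \<Rightarrow> 'y) \<Rightarrow> ('x \<Rightarrow> 'y measure) \<Rightarrow> bool"
  where
  "is_cond_law M D N X N' Y K \<longleftrightarrow>
     K \<in> N \<rightarrow>\<^sub>M prob_algebra N' \<and>
     (\<forall>B\<in>sets N. \<forall>E\<in>sets N'. measure M {\<omega>\<in>space M. D \<omega> \<and> X \<omega> \<in> B \<and> Y \<omega> \<in> E} =
        (LINT \<omega>|M. indicator {\<omega>. D \<omega> \<and> X \<omega> \<in> B} \<omega> * measure (K (X \<omega>)) E))"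

text \<open>\<open>g x\<close> is the Lebesgue density of \<open>Y\<close> given \<open>D\<close> and \<open>X = x\<close>.\<close>

definition is_cond_density ::
    "'w measure \<Rightarrow> ('w \<Rightarrow> bool) \<Rightarrow> 'x measure \<Rightarrow> ('w \<Rightarrow> 'x) \<Rightarrow> ('w \<Rightarrow> real) \<Rightarrow> ('x \<Rightarrow> real \<Rightarrow> real) \<Rightarrow> bool"
  where
  "is_cond_density M D N X Y g \<longleftrightarrow>
     (\<lambda>(x, y). g x y) \<in> borel_measurable (N \<Otimes>\<^sub>M borel) \<and> (\<forall>x\<in>space N. \<forall>y. 0 \<le> g x y) \<and>
     (\<forall>B\<in>sets N. \<forall>E\<in>sets borel. emeasure M {\<omega>\<in>space M. D \<omega> \<and> X \<omega> \<in> B \<and> Y \<omega> \<in> E} =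
        (\<integral>\<^sup>+\<omega>. indicator {\<omega>. D \<omega> \<and> X \<omega> \<in> B} \<omega> *
               (\<integral>\<^sup>+y. indicator E y * ennreal (g (X \<omega>) y) \<partial>lborel) \<partial>M))"


section \<open>Parameters of the network\<close>

datatype channel = Lu | Nu | Lb | Nb

datatype tier = UAV | TBS

instance tier :: countable by countable_datatype

lemma UNIV_channel: "UNIV = {Lu, Nu, Lb, Nb}"
  using channel.exhaust by auto

instance channel :: finite
  by standard (simp add: UNIV_channel)

fun tier_of :: "channel \<Rightarrow> tier" where
  "tier_of Lu = UAV" | "tier_of Nu = UAV" | "tier_of Lb = TBS" | "tier_of Nb = TBS"

fun los :: "tier \<Rightarrow> channel" where
  "los UAV = Lu" | "los TBS = Lb"

fun nlos :: "tier \<Rightarrow> channel" where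
  "nlos UAV = Nu" | "nlos TBS = Nb"

record params =
  rho :: "channel \<Rightarrow> real"      \<comment> \<open>transmit power\<close>
  eta :: "channel \<Rightarrow> real"      \<comment> \<open>additional path loss\<close>
  alpha :: "channel \<Rightarrow> real"    \<comment> \<open>path loss exponent\<close>
  height :: "channel \<Rightarrow> real"
  shape :: "channel \<Rightarrow> nat"     \<comment> \<open>Nakagami parameter\<close>
  env_a :: real
  env_b :: real
  env_c :: real
  density :: "tier \<Rightarrow> real"     \<comment> \<open>of the UAVs and TBSs\<close>
  density_lbd :: real
  r_max :: real
  R_star :: real
  sigma2 :: real                \<comment> \<open>noise power\<close>

definition los_prob :: "params \<Rightarrow> tier \<Rightarrow> real \<Rightarrow> real" where
  "los_prob p t r = - env_a p * exp (- env_b p * arctan (height p (los t) / r)) + env_c p"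

definition channel_prob :: "params \<Rightarrow> channel \<Rightarrow> real \<Rightarrow> real" where
  "channel_prob p i r =
     (if i = los (tier_of i) then los_prob p (tier_of i) r else 1 - los_prob p (tier_of i) r)"

text \<open>The bounds on \<open>los_prob\<close> restrict \<open>env_a\<close>, \<open>env_b\<close>, \<open>env_c\<close> to values for which it is a
  probability. Only \<open>r > 0\<close> is required: at \<open>r = 0\<close> the formula uses the convention \<open>x / 0 = 0\<close>,
  which is immaterial since distances are almost surely positive.\<close>

definition valid_params :: "params \<Rightarrow> bool" where
  "valid_params p \<longleftrightarrow>
     (\<forall>j. 0 < rho p j \<and> 0 < eta p j \<and> 0 < alpha p j \<and> 0 < height p j \<and> 0 < shape p j) \<and>
     rho p Lu = rho p Nu \<and> rho p Lb = rho p Nb \<and>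
     height p Lu = height p Nu \<and> height p Lb = height p Nb \<and>
     (\<forall>t r. 0 < r \<longrightarrow> 0 \<le> los_prob p t r \<and> los_prob p t r \<le> 1) \<and>
     (\<forall>t. 0 < density p t) \<and> 0 < density_lbd p \<and> 0 < r_max p \<and> 0 < R_star p \<and> 0 \<le> sigma2 p"

definition avg_power :: "params \<Rightarrow> channel \<Rightarrow> real \<Rightarrow> real" where
  "avg_power p j x = rho p j * eta p j * (x\<^sup>2 + (height p j)\<^sup>2) powr (- alpha p j / 2)"


section \<open>The random network\<close>

datatype node = Central | Other tier nat

instance node :: countable by countable_datatype

text \<open>The origin is the position of the reference user. The uniform variable \<open>los_mark v\<close> decides
  whether node \<open>v\<close> is LOS (independent thinning). \<open>fading v j\<close> is the fading gain of node \<open>v\<close>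
  in case its channel type is \<open>j\<close>.\<close>

record 'w network =
  sample :: "'w measure"
  center :: "'w \<Rightarrow> real ^ 2"                \<comment> \<open>cluster center\<close>
  lbd :: "nat \<Rightarrow> 'w \<Rightarrow> real ^ 2"            \<comment> \<open>laser beam directors\<close>
  pts :: "tier \<Rightarrow> nat \<Rightarrow> 'w \<Rightarrow> real ^ 2"    \<comment> \<open>other UAVs, and TBSs\<close>
  los_mark :: "node \<Rightarrow> 'w \<Rightarrow> real"
  fading :: "node \<Rightarrow> channel \<Rightarrow> 'w \<Rightarrow> real"

datatype source = SCenter | SLbd | SPts tier | SMark node | SFading node channel

definition generated_events :: "'w measure \<Rightarrow> 'x measure \<Rightarrow> ('w \<Rightarrow> 'x) \<Rightarrow> 'w set set" where
  "generated_events M N X = {X -` A \<inter> space M | A. A \<in> sets N}"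

fun source_events :: "'w network \<Rightarrow> source \<Rightarrow> 'w set set" where
  "source_events w SCenter = generated_events (sample w) borel (center w)"
| "source_events w SLbd = generated_events (sample w) (Pi\<^sub>M UNIV (\<lambda>_. borel)) (\<lambda>\<omega> n. lbd w n \<omega>)"
| "source_events w (SPts t) =
     generated_events (sample w) (Pi\<^sub>M UNIV (\<lambda>_. borel)) (\<lambda>\<omega> n. pts w t n \<omega>)"
| "source_events w (SMark v) = generated_events (sample w) borel (los_mark w v)"
| "source_events w (SFading v j) = generated_events (sample w) borel (fading w v j)"

text \<open>A user uniform in the disc around the center means, in coordinates centered at the user, a
  center uniform in the disc around the origin. The Erlang law with density
  \<open>erlang_density (m - 1) m\<close> is the Gamma law with shape \<open>m\<close> and mean 1.\<close>

definition network_model :: "params \<Rightarrow> 'w network \<Rightarrow> bool" where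
  "network_model p w \<longleftrightarrow>
     prob_space (sample w) \<and>
     center w \<in> borel_measurable (sample w) \<and>
     distr (sample w) borel (center w) = uniform_measure lborel (cball 0 (r_max p)) \<and>
     homogeneous_ppp (sample w) (density_lbd p) (lbd w) \<and>
     (\<forall>t. homogeneous_ppp (sample w) (density p t) (pts w t)) \<and>
     (\<forall>v. los_mark w v \<in> borel_measurable (sample w) \<and>
          distr (sample w) borel (los_mark w v) = uniform_measure lborel {0..1}) \<and>
     (\<forall>v j. distributed (sample w) lborel (fading w v j)
              (erlang_density (shape p j - 1) (real (shape p j)))) \<and>
     prob_space.indep_sets (sample w) (source_events w) UNIV"

definition nearest_lbd :: "'w network \<Rightarrow> 'w \<Rightarrow> real ^ 2" where
  "nearest_lbd w \<omega> =
     lbd w (LEAST n. \<forall>k. dist (center w \<omega>) (lbd w n \<omega>) \<le> dist (center w \<omega>) (lbd w k \<omega>)) \<omega>"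

definition r_c :: "'w network \<Rightarrow> 'w \<Rightarrow> real" where
  "r_c w \<omega> = dist (center w \<omega>) (nearest_lbd w \<omega>)"

definition central_pos :: "params \<Rightarrow> 'w network \<Rightarrow> 'w \<Rightarrow> real ^ 2" where
  "central_pos p w \<omega> =
     (if r_c w \<omega> \<le> R_star p then center w \<omega>
      else nearest_lbd w \<omega> + (R_star p / r_c w \<omega>) *\<^sub>R (center w \<omega> - nearest_lbd w \<omega>))"

fun node_dist :: "params \<Rightarrow> 'w network \<Rightarrow> node \<Rightarrow> 'w \<Rightarrow> real" where
  "node_dist p w Central \<omega> = norm (central_pos p w \<omega>)"
| "node_dist p w (Other t n) \<omega> = norm (pts w t n \<omega>)"

abbreviation r_cu :: "params \<Rightarrow> 'w network \<Rightarrow> 'w \<Rightarrow> real" where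
  "r_cu p w \<equiv> node_dist p w Central"

fun node_tier :: "node \<Rightarrow> tier" where
  "node_tier Central = UAV" | "node_tier (Other t n) = t"

definition node_channel :: "params \<Rightarrow> 'w network \<Rightarrow> node \<Rightarrow> 'w \<Rightarrow> channel" where
  "node_channel p w v \<omega> =
     (if los_mark w v \<omega> \<le> los_prob p (node_tier v) (node_dist p w v \<omega>)
      then los (node_tier v) else nlos (node_tier v))"

definition node_avg :: "params \<Rightarrow> 'w network \<Rightarrow> node \<Rightarrow> 'w \<Rightarrow> real" where
  "node_avg p w v \<omega> = avg_power p (node_channel p w v \<omega>) (node_dist p w v \<omega>)"

definition received :: "params \<Rightarrow> 'w network \<Rightarrow> node \<Rightarrow> 'w \<Rightarrow> real" where
  "received p w v \<omega> = node_avg p w v \<omega> * fading w v (node_channel p w v \<omega>) \<omega>"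

text \<open>The node with the largest average received power. Ties have probability 0; they are broken
  by a fixed enumeration of the nodes so that there is at most one serving node.\<close>

definition serves :: "params \<Rightarrow> 'w network \<Rightarrow> node \<Rightarrow> 'w \<Rightarrow> bool" where
  "serves p w v \<omega> \<longleftrightarrow>
     (\<forall>u. node_avg p w u \<omega> \<le> node_avg p w v \<omega>) \<and>
     (\<forall>u. node_avg p w u \<omega> = node_avg p w v \<omega> \<longrightarrow> to_nat v \<le> to_nat u)"

text \<open>Indices of the points of the thinned process \<open>\<Phi>\<^sub>i\<close>, and the distance to its nearest point
  (meaningful only if the process is nonempty).\<close>

definition Phi :: "params \<Rightarrow> 'w network \<Rightarrow> channel \<Rightarrow> 'w \<Rightarrow> nat set" where
  "Phi p w i \<omega> = {n. node_channel p w (Other (tier_of i) n) \<omega> = i}"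

definition R_near :: "params \<Rightarrow> 'w network \<Rightarrow> channel \<Rightarrow> 'w \<Rightarrow> real" where
  "R_near p w i \<omega> = (INF n\<in>Phi p w i \<omega>. node_dist p w (Other (tier_of i) n) \<omega>)"

definition assoc_nearest :: "params \<Rightarrow> 'w network \<Rightarrow> channel \<Rightarrow> 'w \<Rightarrow> bool" where
  "assoc_nearest p w i \<omega> \<longleftrightarrow>
     (\<exists>n\<in>Phi p w i \<omega>. node_dist p w (Other (tier_of i) n) \<omega> = R_near p w i \<omega> \<and>
                       serves p w (Other (tier_of i) n) \<omega>)"

text \<open>Interference is valued in \<open>[0, \<infinity>]\<close>, as the sums may diverge for small path loss exponents.\<close>

definition interf_from :: "params \<Rightarrow> 'w network \<Rightarrow> channel \<Rightarrow> 'w \<Rightarrow> ennreal" where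
  "interf_from p w j \<omega> =
     (\<Sum>n. (if n \<in> Phi p w j \<omega> then ennreal (received p w (Other (tier_of j) n) \<omega>) else 0))"

definition interf_central :: "params \<Rightarrow> 'w network \<Rightarrow> 'w \<Rightarrow> ennreal" where
  "interf_central p w \<omega> = (\<Sum>j\<in>UNIV. interf_from p w j \<omega>)"

definition interf_nearest :: "params \<Rightarrow> 'w network \<Rightarrow> channel \<Rightarrow> 'w \<Rightarrow> ennreal" where
  "interf_nearest p w i \<omega> =
     ennreal (received p w Central \<omega>) + (\<Sum>j\<in>UNIV - {i}. interf_from p w j \<omega>)"

definition interference :: "params \<Rightarrow> 'w network \<Rightarrow> node \<Rightarrow> 'w \<Rightarrow> ennreal" where
  "interference p w v \<omega> =
     (case v of Central \<Rightarrow> interf_central p w \<omega>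
      | Other t n \<Rightarrow> interf_nearest p w (node_channel p w v \<omega>) \<omega>)"

definition coverage :: "params \<Rightarrow> 'w network \<Rightarrow> real \<Rightarrow> real" where
  "coverage p w \<gamma> = measure (sample w)
     {\<omega>\<in>space (sample w). \<exists>v. serves p w v \<omega> \<and>
        ennreal \<gamma> \<le> ennreal (received p w v \<omega>) / (interference p w v \<omega> + ennreal (sigma2 p))}"


section \<open>Association probabilities, interference laws and densities\<close>

text \<open>\<open>Within\<close> is the strategy \<open>r_c \<le> R_star\<close>; \<open>Beyond t\<close> is the strategy \<open>r_c > R_star\<close>
  together with the value \<open>r_c = t\<close>.\<close>

datatype strategy = Within | Beyond real

definition is_assoc_prob ::
    "params \<Rightarrow> 'w network \<Rightarrow> (real \<Rightarrow> channel \<Rightarrow> strategy \<Rightarrow> real) \<Rightarrow> bool" where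
  "is_assoc_prob p w A \<longleftrightarrow> (\<forall>i.
     is_cond_prob (sample w) (\<lambda>\<omega>. Phi p w i \<omega> \<noteq> {} \<and> r_c w \<omega> \<le> R_star p)
       borel (R_near p w i) (assoc_nearest p w i) (\<lambda>r. A r i Within) \<and>
     is_cond_prob (sample w) (\<lambda>\<omega>. Phi p w i \<omega> \<noteq> {} \<and> r_c w \<omega> > R_star p)
       (borel \<Otimes>\<^sub>M borel) (\<lambda>\<omega>. (r_c w \<omega>, R_near p w i \<omega>)) (assoc_nearest p w i)
       (\<lambda>(t, r). A r i (Beyond t)))"

definition is_assoc_prob_central ::
    "params \<Rightarrow> 'w network \<Rightarrow> (real \<Rightarrow> channel \<Rightarrow> real) \<Rightarrow> bool" where
  "is_assoc_prob_central p w A \<longleftrightarrow> (\<forall>i\<in>{Lu, Nu}.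
     is_cond_prob (sample w) (\<lambda>\<omega>. node_channel p w Central \<omega> = i)
       borel (r_cu p w) (serves p w Central) (\<lambda>r. A r i))"

definition is_interf_law ::
    "params \<Rightarrow> 'w network \<Rightarrow> (channel \<Rightarrow> real \<Rightarrow> strategy \<Rightarrow> ennreal measure) \<Rightarrow> bool" where
  "is_interf_law p w K \<longleftrightarrow> (\<forall>i.
     is_cond_law (sample w) (\<lambda>\<omega>. assoc_nearest p w i \<omega> \<and> r_c w \<omega> \<le> R_star p)
       borel (R_near p w i) borel (interf_nearest p w i) (\<lambda>r. K i r Within) \<and>
     is_cond_law (sample w) (\<lambda>\<omega>. assoc_nearest p w i \<omega> \<and> r_c w \<omega> > R_star p)
       (borel \<Otimes>\<^sub>M borel) (\<lambda>\<omega>. (r_c w \<omega>, R_near p w i \<omega>)) borel (interf_nearest p w i)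
       (\<lambda>(t, r). K i r (Beyond t)))"

definition is_interf_law_central ::
    "params \<Rightarrow> 'w network \<Rightarrow> (channel \<Rightarrow> real \<Rightarrow> ennreal measure) \<Rightarrow> bool" where
  "is_interf_law_central p w K \<longleftrightarrow> (\<forall>i\<in>{Lu, Nu}.
     is_cond_law (sample w) (\<lambda>\<omega>. serves p w Central \<omega> \<and> node_channel p w Central \<omega> = i)
       borel (r_cu p w) borel (interf_central p w) (K i))"

text \<open>\<open>f t r\<close> is the conditional density of the distance to the central UAV at \<open>r\<close> given
  \<open>r_c = t > R_star\<close>.\<close>

definition is_dens_cu_beyond :: "params \<Rightarrow> 'w network \<Rightarrow> (real \<Rightarrow> real \<Rightarrow> real) \<Rightarrow> bool" where
  "is_dens_cu_beyond p w f \<longleftrightarrow>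
     is_cond_density (sample w) (\<lambda>\<omega>. r_c w \<omega> > R_star p) borel (r_c w) (r_cu p w) f"

definition dens_cu_within :: "params \<Rightarrow> real \<Rightarrow> real" where
  "dens_cu_within p r = 2 * r / (r_max p)\<^sup>2 * indicator {0..r_max p} r"

definition dens_c :: "params \<Rightarrow> real \<Rightarrow> real" where
  "dens_c p t = 2 * pi * density_lbd p * t * exp (- pi * density_lbd p * t\<^sup>2)"

definition channel_density :: "params \<Rightarrow> channel \<Rightarrow> real \<Rightarrow> real" where
  "channel_density p i r = density p (tier_of i) * channel_prob p i r"

definition dens_R :: "params \<Rightarrow> channel \<Rightarrow> real \<Rightarrow> real" where
  "dens_R p i r = 2 * pi * channel_density p i r * r *
     exp (- 2 * pi * (LBINT x:{0..r}. channel_density p i x * x))"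

text \<open>The Laplace transform of \<open>I + \<sigma>\<^sup>2\<close> at \<open>s > 0\<close> when \<open>I\<close> has law \<open>K\<close>, with \<open>exp (-\<infinity>) = 0\<close>.\<close>

definition laplace :: "params \<Rightarrow> ennreal measure \<Rightarrow> real \<Rightarrow> real" where
  "laplace p K s = (LINT x|K. (if x = \<infinity> then 0 else exp (- s * (enn2real x + sigma2 p))))"

definition s_r :: "params \<Rightarrow> real \<Rightarrow> channel \<Rightarrow> real \<Rightarrow> real" where
  "s_r p \<gamma> i r = \<gamma> * real (shape p i) * ((height p i)\<^sup>2 + r\<^sup>2) powr (alpha p i / 2) / (rho p i * eta p i)"

text \<open>The sum defining \<open>L\<close> and \<open>L\<^sub>c\<close>, from the conditional law \<open>K\<close> of the interference.\<close>

definition cond_cov :: "params \<Rightarrow> real \<Rightarrow> channel \<Rightarrow> real \<Rightarrow> ennreal measure \<Rightarrow> real" where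
  "cond_cov p \<gamma> i r K =
     (\<Sum>k = 0..shape p i - 1. (-1) ^ k * ((s_r p \<gamma> i r) ^ k / fact k) *
        (deriv ^^ k) (laplace p K) (s_r p \<gamma> i r))"

definition expect_strategy :: "params \<Rightarrow> (strategy \<Rightarrow> real) \<Rightarrow> real" where
  "expect_strategy p F =
     F Within * (1 - exp (- density_lbd p * pi * (R_star p)\<^sup>2)) +
     (LBINT t:{R_star p<..}. F (Beyond t) * dens_c p t)"

end

theory Submission
  imports Defs
begin

text \<open>
  The coverage event is the disjoint union, over the possible serving nodes and their channel types,
  of the events that this node serves and is covered. The fading gain of the serving node enters
  neither the association nor the interference, so integrating it out replaces the coverage indicator
  by the tail \<open>\<Sum>k<m. (s y)\<^sup>k exp (- s y) / k!\<close> of the Gamma law at \<open>y = I + \<sigma>\<^sup>2\<close> and \<open>s = s\<^sub>r\<close>.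
  Differentiating the Laplace transform under the integral sign shows that the conditional expectation
  of this tail given the distance is \<open>L\<close> or \<open>L\<^sub>c\<close>, and conditioning on the distance alone brings in the
  association probabilities.

  It remains to find the laws of the distances. Void probabilities, stationarity and the independence of
  the cluster center give the law of \<open>r\<^sub>c\<close> and its independence of the center. Integrating out the LOS
  marks one by one turns the probability that \<open>\<Phi>\<^sub>i\<close> has no point in a disc into a value of the
  generating functional of the unthinned process, hence the density of \<open>R\<^sub>i\<close>.
\<close>

section \<open>Preliminaries on measures and conditional laws\<close>

text \<open>The conditional objects \<open>A\<close>, \<open>A_c\<close>, \<open>K\<close>,
  \<open>K_c\<close> and \<open>f_beyond\<close> are versions, fixed only up to null sets, so they
  cannot be evaluated at a given distance. Each one is used solely through an integral identity, and
  the products \<open>L * A\<close> and \<open>L_c * A_c\<close> arise by chaining two of these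
  identities under one integral. The computation stays in [0, \<infinity>]: interference may be
  infinite, and Fubini and additivity then need no integrability. The return to real integrals is
  delicate only for the average of \<open>f_beyond\<close> over \<open>r_c\<close>, which is known
  to be finite only almost everywhere. The enumeration of a point process is arbitrary, and nothing
  is known about the law of its \<open>n\<close>-th point alone. Thinning is therefore computed for
  the first \<open>N\<close> points, conditionally on all positions, and only the limit in
  \<open>N\<close> has an explicit value. Void probabilities suffice, since only the distance to the
  nearest point needs a law. A thinned process can be empty with positive probability, so the law of
  that distance is taken on the event that it is nonempty and may have mass below 1.\<close>

text \<open>The record field \<open>density\<close> hides the library constant of that name.\<close>

abbreviation with_density :: "'a measure \<Rightarrow> ('a \<Rightarrow> ennreal) \<Rightarrow> 'a measure" where
  "with_density \<equiv> Nonnegative_Lebesgue_Integration.density"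

text \<open>Half-lines are stable under intersection and generate the Borel sets, so a distribution
  function determines a finite measure. The radial law on a disc, the law of \<open>r_c\<close> and
  the law of \<open>R_near\<close> are all identified in this way.\<close>

lemma finite_measure_eq_density_atMost:
  fixes f :: "real \<Rightarrow> ennreal"
  assumes N: "finite_measure N" "sets N = sets borel"
    and f[measurable]: "f \<in> borel_measurable borel"
    and eq: "\<And>x. emeasure N {..x} = (\<integral>\<^sup>+y. f y * indicator {..x} y \<partial>lborel)"
  shows "N = with_density lborel f"
proof (rule measure_eqI_generator_eq[where E="range atMost" and \<Omega>=UNIV and A="\<lambda>n. {..real n}"])
  interpret finite_measure N by fact
  show "Int_stable (range atMost :: real set set)"
    by (auto simp: Int_stable_def)
  show "sets N = sigma_sets UNIV (range atMost)"
    by (simp add: N(2) borel_eq_atMost)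
  then show "sets (with_density lborel f) = sigma_sets UNIV (range atMost)"
    by (simp add: N(2))
  show "(\<Union>n. {..real n}) = UNIV"
    using real_arch_simple by auto
  show "emeasure N X = emeasure (with_density lborel f) X" if "X \<in> range atMost" for X
    using that by (auto simp: emeasure_density eq)
  show "emeasure N {..real i} \<noteq> \<infinity>" for i by simp
qed auto

text \<open>The defining equation for sets \<open>B\<close> says that two measures on
  \<open>N\<close> coincide: the images under \<open>X\<close> of \<open>M\<close> restricted to
  \<open>D\<close> and \<open>E\<close>, and of \<open>M\<close> weighted by
  \<open>q (X \<omega>)\<close> on \<open>D\<close>. Hence every nonnegative \<open>f\<close> has
  the same integral against both.\<close>

lemma is_cond_prob_nn_integral:
  assumes "is_cond_prob M D N X E q"
    and M: "prob_space M"
    and [measurable]: "Measurable.pred M D" "X \<in> M \<rightarrow>\<^sub>M N" "Measurable.pred M E"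
      "f \<in> borel_measurable N"
  shows "(\<integral>\<^sup>+\<omega>. f (X \<omega>) * indicator {\<omega>. D \<omega> \<and> E \<omega>} \<omega> \<partial>M) =
     (\<integral>\<^sup>+\<omega>. f (X \<omega>) * ennreal (q (X \<omega>)) * indicator {\<omega>. D \<omega>} \<omega> \<partial>M)"
proof -
  interpret prob_space M by fact
  have q[measurable]: "q \<in> borel_measurable N" and q01: "\<And>x. x \<in> space N \<Longrightarrow> 0 \<le> q x \<and> q x \<le> 1"
    and eq: "\<And>B. B \<in> sets N \<Longrightarrow> measure M {\<omega>\<in>space M. D \<omega> \<and> X \<omega> \<in> B \<and> E \<omega>} =
        (LINT \<omega>|M. indicator {\<omega>. D \<omega> \<and> X \<omega> \<in> B} \<omega> * q (X \<omega>))"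
    using assms(1) by (auto simp: is_cond_prob_def)
  let ?A = "distr (with_density M (indicator {\<omega>. D \<omega> \<and> E \<omega>})) N X"
  let ?B = "distr (with_density M (\<lambda>\<omega>. ennreal (q (X \<omega>)) * indicator {\<omega>. D \<omega>} \<omega>)) N X"
  have AB: "?A = ?B"
  proof (rule measure_eqI)
    fix B assume "B \<in> sets ?A"
    then have [measurable]: "B \<in> sets N" by simp
    have "emeasure ?A B = (\<integral>\<^sup>+\<omega>. indicator {\<omega>. D \<omega> \<and> E \<omega>} \<omega> * indicator (X -` B \<inter> space M) \<omega> \<partial>M)"
      by (simp add: emeasure_distr emeasure_density)
    also have "\<dots> = (\<integral>\<^sup>+\<omega>. indicator {\<omega>\<in>space M. D \<omega> \<and> X \<omega> \<in> B \<and> E \<omega>} \<omega> \<partial>M)"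
      by (intro nn_integral_cong) (auto split: split_indicator)
    also have "\<dots> = emeasure M {\<omega>\<in>space M. D \<omega> \<and> X \<omega> \<in> B \<and> E \<omega>}"
      by (intro nn_integral_indicator) measurable
    also have "\<dots> = ennreal (LINT \<omega>|M. indicator {\<omega>. D \<omega> \<and> X \<omega> \<in> B} \<omega> * q (X \<omega>))"
      by (simp add: emeasure_eq_measure eq)
    also have "\<dots> = (\<integral>\<^sup>+\<omega>. ennreal (indicator {\<omega>. D \<omega> \<and> X \<omega> \<in> B} \<omega> * q (X \<omega>)) \<partial>M)"
    proof (rule nn_integral_eq_integral[symmetric])
      show "integrable M (\<lambda>\<omega>. indicator {\<omega>. D \<omega> \<and> X \<omega> \<in> B} \<omega> * q (X \<omega>))"
        using q01 measurable_space[OF assms(4)]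
        by (intro integrable_const_bound[where B=1] AE_I2) (auto split: split_indicator)
      show "AE \<omega> in M. 0 \<le> indicator {\<omega>. D \<omega> \<and> X \<omega> \<in> B} \<omega> * q (X \<omega>)"
        using q01 measurable_space[OF assms(4)] by (intro AE_I2) (auto split: split_indicator)
    qed
    also have "\<dots> = (\<integral>\<^sup>+\<omega>. ennreal (q (X \<omega>)) * indicator {\<omega>. D \<omega>} \<omega> * indicator (X -` B \<inter> space M) \<omega> \<partial>M)"
      by (intro nn_integral_cong) (auto split: split_indicator)
    also have "\<dots> = emeasure ?B B"
      by (simp add: emeasure_distr emeasure_density)
    finally show "emeasure ?A B = emeasure ?B B" .
  qed simp
  have "(\<integral>\<^sup>+x. f x \<partial>?A) = (\<integral>\<^sup>+x. f x \<partial>?B)" by (simp only: AB)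
  then show ?thesis by (simp add: nn_integral_distr nn_integral_density mult_ac)
qed

text \<open>On rectangles the defining equation identifies the joint law of \<open>X\<close> and
  \<open>Y\<close> on \<open>D\<close> with the law obtained by drawing \<open>X\<close> first and
  then \<open>Y\<close> from \<open>K\<close>. Rectangles form an intersection-stable generator, so
  the two laws are equal and \<open>f\<close> may depend on both variables.\<close>

lemma is_cond_law_nn_integral:
  assumes "is_cond_law M D N X N' Y K"
    and M: "prob_space M"
    and [measurable]: "Measurable.pred M D" "X \<in> M \<rightarrow>\<^sub>M N" "Y \<in> M \<rightarrow>\<^sub>M N'"
      "f \<in> borel_measurable (N \<Otimes>\<^sub>M N')"
  shows "(\<integral>\<^sup>+\<omega>. f (X \<omega>, Y \<omega>) * indicator {\<omega>. D \<omega>} \<omega> \<partial>M) =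
     (\<integral>\<^sup>+\<omega>. (\<integral>\<^sup>+y. f (X \<omega>, y) \<partial>K (X \<omega>)) * indicator {\<omega>. D \<omega>} \<omega> \<partial>M)"
proof -
  interpret prob_space M by fact
  have K: "K \<in> N \<rightarrow>\<^sub>M prob_algebra N'"
    and eq: "\<And>B E. B \<in> sets N \<Longrightarrow> E \<in> sets N' \<Longrightarrow>
        measure M {\<omega>\<in>space M. D \<omega> \<and> X \<omega> \<in> B \<and> Y \<omega> \<in> E} =
        (LINT \<omega>|M. indicator {\<omega>. D \<omega> \<and> X \<omega> \<in> B} \<omega> * measure (K (X \<omega>)) E)"
    using assms(1) by (auto simp: is_cond_law_def)
  note [measurable] = measurable_prob_algebraD[OF K]
  have Kx: "sets (K (X \<omega>)) = sets N'" "prob_space (K (X \<omega>))" if "\<omega> \<in> space M" for \<omega>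
    using measurable_space[OF K] measurable_space[OF assms(4)] that
    by (auto simp: space_prob_algebra)
  let ?M = "with_density M (indicator {\<omega>. D \<omega>})"
  \<comment> \<open>The kernel keeps \<open>X \<omega>\<close> as first coordinate, so that binding
    it to the restricted measure gives a joint law and not merely that of \<open>Y\<close>.\<close>
  let ?\<kappa> = "\<lambda>\<omega>. distr (K (X \<omega>)) (N \<Otimes>\<^sub>M N') (\<lambda>y. (X \<omega>, y))"
  let ?A = "distr ?M (N \<Otimes>\<^sub>M N') (\<lambda>\<omega>. (X \<omega>, Y \<omega>))"
  let ?B = "?M \<bind> ?\<kappa>"
  have ne: "space M \<noteq> {}" by (rule not_empty)
  have \<kappa>[measurable]: "?\<kappa> \<in> ?M \<rightarrow>\<^sub>M subprob_algebra (N \<Otimes>\<^sub>M N')"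
    by (rule measurable_distr2[where M=N']) simp_all
  have sets_B: "sets ?B = sets (N \<Otimes>\<^sub>M N')"
    using ne by (intro sets_bind[OF sets_kernel[OF \<kappa>]]) auto
  have AB: "?A = ?B"
  proof (rule measure_eqI_generator_eq[where E="{a \<times> b |a b. a \<in> sets N \<and> b \<in> sets N'}"
        and \<Omega>="space N \<times> space N'" and A="\<lambda>_. space N \<times> space N'"])
    show "Int_stable {a \<times> b |a b. a \<in> sets N \<and> b \<in> sets N'}"
      by (rule Int_stable_pair_measure_generator)
    show "{a \<times> b |a b. a \<in> sets N \<and> b \<in> sets N'} \<subseteq> Pow (space N \<times> space N')"
      by (rule pair_measure_closed)
    show "sets ?A = sigma_sets (space N \<times> space N') {a \<times> b |a b. a \<in> sets N \<and> b \<in> sets N'}"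
      by (simp add: sets_pair_measure)
    show "sets ?B = sigma_sets (space N \<times> space N') {a \<times> b |a b. a \<in> sets N \<and> b \<in> sets N'}"
      by (simp only: sets_B sets_pair_measure)
    have "finite_measure ?M"
      by (intro finite_measureI) (simp add: emeasure_density nn_integral_indicator_finite emeasure_eq_measure
          nn_integral_cong[of M _ "indicator {\<omega>\<in>space M. D \<omega>}"] split: split_indicator)
    then have "finite_measure ?A" by (intro finite_measure.finite_measure_distr) auto
    then show "emeasure ?A (space N \<times> space N') \<noteq> \<infinity>"
      by (simp add: finite_measure.emeasure_finite)
    show "range (\<lambda>_. space N \<times> space N') \<subseteq> {a \<times> b |a b. a \<in> sets N \<and> b \<in> sets N'}"
      by auto
    fix Q assume "Q \<in> {a \<times> b |a b. a \<in> sets N \<and> b \<in> sets N'}"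
    then obtain B E where Q: "Q = B \<times> E" and [measurable]: "B \<in> sets N" "E \<in> sets N'" by auto
    have "emeasure ?A Q = (\<integral>\<^sup>+\<omega>. indicator {\<omega>. D \<omega>} \<omega> *
        indicator ((\<lambda>\<omega>. (X \<omega>, Y \<omega>)) -` Q \<inter> space M) \<omega> \<partial>M)"
      by (simp add: Q emeasure_distr emeasure_density)
    also have "\<dots> = (\<integral>\<^sup>+\<omega>. indicator {\<omega>\<in>space M. D \<omega> \<and> X \<omega> \<in> B \<and> Y \<omega> \<in> E} \<omega> \<partial>M)"
      by (intro nn_integral_cong) (auto simp: Q split: split_indicator)
    also have "\<dots> = emeasure M {\<omega>\<in>space M. D \<omega> \<and> X \<omega> \<in> B \<and> Y \<omega> \<in> E}"
      by (intro nn_integral_indicator) measurable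
    also have "\<dots> = ennreal (LINT \<omega>|M. indicator {\<omega>. D \<omega> \<and> X \<omega> \<in> B} \<omega> * measure (K (X \<omega>)) E)"
      by (simp add: emeasure_eq_measure eq)
    also have "\<dots> = (\<integral>\<^sup>+\<omega>. ennreal (indicator {\<omega>. D \<omega> \<and> X \<omega> \<in> B} \<omega> * measure (K (X \<omega>)) E) \<partial>M)"
    proof (rule nn_integral_eq_integral[symmetric])
      show "integrable M (\<lambda>\<omega>. indicator {\<omega>. D \<omega> \<and> X \<omega> \<in> B} \<omega> * measure (K (X \<omega>)) E)"
        using Kx by (intro integrable_const_bound[where B=1] AE_I2)
          (auto split: split_indicator intro: prob_space.prob_le_1)
    qed simp
    also have "\<dots> = (\<integral>\<^sup>+\<omega>. indicator {\<omega>. D \<omega>} \<omega> * emeasure (?\<kappa> \<omega>) Q \<partial>M)"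
    proof (intro nn_integral_cong)
      fix \<omega> assume \<omega>: "\<omega> \<in> space M"
      interpret K: prob_space "K (X \<omega>)" using Kx \<omega> by auto
      have [measurable]: "(\<lambda>y. (X \<omega>, y)) \<in> K (X \<omega>) \<rightarrow>\<^sub>M N \<Otimes>\<^sub>M N'"
        using Kx(1)[OF \<omega>] measurable_space[OF assms(4) \<omega>]
        by (simp cong: measurable_cong_sets)
      have "emeasure (?\<kappa> \<omega>) Q = indicator B (X \<omega>) * emeasure (K (X \<omega>)) E"
        using sets.sets_into_space[of E "K (X \<omega>)"] Kx(1)[OF \<omega>]
        by (simp add: Q emeasure_distr vimage_def Int_def[symmetric] Int_absorb2 split: split_indicator)
      then show "ennreal (indicator {\<omega>. D \<omega> \<and> X \<omega> \<in> B} \<omega> * measure (K (X \<omega>)) E) =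
          indicator {\<omega>. D \<omega>} \<omega> * emeasure (?\<kappa> \<omega>) Q"
        by (simp add: K.emeasure_eq_measure split: split_indicator)
    qed
    also have "\<dots> = emeasure ?B Q"
      using ne by (subst emeasure_bind[OF _ \<kappa>])
        (auto simp: nn_integral_density Q intro!: pair_measureI)
    finally show "emeasure ?A Q = emeasure ?B Q" .
  qed auto
  have "(\<integral>\<^sup>+x. f x \<partial>?A) = (\<integral>\<^sup>+x. f x \<partial>?B)" by (simp only: AB)
  also have "\<dots> = (\<integral>\<^sup>+\<omega>. \<integral>\<^sup>+x. f x \<partial>?\<kappa> \<omega> \<partial>?M)"
    by (rule nn_integral_bind[OF _ \<kappa>]) simp
  also have "\<dots> = (\<integral>\<^sup>+\<omega>. indicator {\<omega>. D \<omega>} \<omega> * (\<integral>\<^sup>+x. f x \<partial>?\<kappa> \<omega>) \<partial>M)"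
    by (rule nn_integral_density) auto
  also have "\<dots> = (\<integral>\<^sup>+\<omega>. (\<integral>\<^sup>+y. f (X \<omega>, y) \<partial>K (X \<omega>)) * indicator {\<omega>. D \<omega>} \<omega> \<partial>M)"
  proof (intro nn_integral_cong)
    fix \<omega> assume \<omega>: "\<omega> \<in> space M"
    have "(\<lambda>y. (X \<omega>, y)) \<in> K (X \<omega>) \<rightarrow>\<^sub>M N \<Otimes>\<^sub>M N'"
      using Kx(1)[OF \<omega>] measurable_space[OF assms(4) \<omega>] by (simp cong: measurable_cong_sets)
    then show "indicator {\<omega>. D \<omega>} \<omega> * (\<integral>\<^sup>+x. f x \<partial>?\<kappa> \<omega>) =
        (\<integral>\<^sup>+y. f (X \<omega>, y) \<partial>K (X \<omega>)) * indicator {\<omega>. D \<omega>} \<omega>"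
      by (simp add: nn_integral_distr mult.commute)
  qed
  finally show ?thesis by (simp add: nn_integral_distr nn_integral_density mult_ac)
qed

section \<open>Laplace transforms and fading\<close>

text \<open>A single term of the series of \<open>exp (c * y)\<close> is at most its sum. The bound
  does not depend on \<open>y\<close> and supplies the dominating constants for all moments
  below.\<close>

lemma power_mult_exp_le:
  fixes c y :: real
  assumes "c > 0" "y \<ge> 0"
  shows "y ^ n * exp (- c * y) \<le> fact n / c ^ n"
proof -
  have "(c * y) ^ n / fact n \<le> exp (c * y)"
  proof -
    have "(\<Sum>k\<in>{n}. inverse (fact k) *\<^sub>R (c * y) ^ k) \<le> (\<Sum>k. inverse (fact k) *\<^sub>R (c * y) ^ k)"
      using assms by (intro sum_le_suminf summable_exp_generic) auto
    then show ?thesis by (simp add: exp_def divide_inverse mult.commute)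
  qed
  then show ?thesis
    using assms by (simp add: exp_minus field_simps power_mult_distrib)
qed

text \<open>Mean value inequality in the exponent: for \<open>\<bar>h\<bar> \<le> s / 2\<close> the
  parameter never drops below \<open>s / 2\<close>, and the decay left over absorbs any power of
  \<open>y\<close>.\<close>

lemma abs_exp_diff_le:
  fixes s h y :: real
  assumes "\<bar>h\<bar> \<le> s / 2" "y \<ge> 0"
  shows "\<bar>exp (- (s + h) * y) - exp (- s * y)\<bar> \<le> \<bar>h\<bar> * (y * exp (- (s / 2) * y))"
proof -
  have "norm (exp (- (s + h) * y) - exp (- s * y)) \<le> (y * exp (- (s / 2) * y)) * norm ((s + h) - s)"
  proof (rule field_differentiable_bound[where S="{s - \<bar>h\<bar>..s + \<bar>h\<bar>}" and f'="\<lambda>t. - y * exp (- t * y)"])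
    fix t assume t: "t \<in> {s - \<bar>h\<bar>..s + \<bar>h\<bar>}"
    show "((\<lambda>t. exp (- t * y)) has_field_derivative - y * exp (- t * y)) (at t within {s - \<bar>h\<bar>..s + \<bar>h\<bar>})"
      by (auto intro!: derivative_eq_intros)
    have "s / 2 \<le> t" using t assms(1) by auto
    then have "s / 2 * y \<le> t * y" using assms(2) by (intro mult_right_mono)
    then show "norm (- y * exp (- t * y)) \<le> y * exp (- (s / 2) * y)"
      using assms by (auto simp: abs_mult intro!: mult_left_mono)
  qed auto
  then show ?thesis by (simp add: mult.commute)
qed

text \<open>Dominated convergence applied to difference quotients along sequences. The bounded
  weight \<open>g\<close> will be the indicator of finite interference, which encodes
  \<open>exp (-\<infinity>) = 0\<close>.\<close>

lemma DERIV_laplace_moment: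
  fixes g Y :: "'a \<Rightarrow> real"
  assumes M: "finite_measure M" and [measurable]: "g \<in> borel_measurable M" "Y \<in> borel_measurable M"
    and g: "\<And>x. \<bar>g x\<bar> \<le> 1" and Y: "\<And>x. 0 \<le> Y x" and s: "s > 0"
  shows "((\<lambda>s. LINT x|M. g x * Y x ^ k * exp (- s * Y x)) has_field_derivative
     - (LINT x|M. g x * Y x ^ Suc k * exp (- s * Y x))) (at s)"
proof -
  interpret finite_measure M by fact
  have int: "integrable M (\<lambda>x. g x * Y x ^ n * exp (- t * Y x))" if "t > 0" for t n
  proof (rule integrable_const_bound[where B="fact n / t ^ n"])
    show "AE x in M. norm (g x * Y x ^ n * exp (- t * Y x)) \<le> fact n / t ^ n"
    proof (rule AE_I2)
      fix x
      have "norm (g x * Y x ^ n * exp (- t * Y x)) = \<bar>g x\<bar> * (Y x ^ n * exp (- t * Y x))"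
        using Y[of x] by (simp add: abs_mult)
      also have "\<dots> \<le> 1 * (fact n / t ^ n)"
        using g[of x] Y[of x] power_mult_exp_le[OF that Y[of x], of n] by (intro mult_mono) auto
      finally show "norm (g x * Y x ^ n * exp (- t * Y x)) \<le> fact n / t ^ n" by simp
    qed
  qed simp
  let ?F = "\<lambda>s. LINT x|M. g x * Y x ^ k * exp (- s * Y x)"
  \<comment> \<open>Increments are confined to this window, where \<open>s + h\<close> stays above
    \<open>s / 2\<close>; the derivative at \<open>s\<close> sees nothing else.\<close>
  let ?S = "{- (s / 2)<..<s / 2}"
  let ?q = "\<lambda>h x. g x * Y x ^ k * ((exp (- (s + h) * Y x) - exp (- s * Y x)) / h)"
  have "((\<lambda>h. (?F (s + h) - ?F s) / h) \<longlongrightarrow> - (LINT x|M. g x * Y x ^ Suc k * exp (- s * Y x))) (at 0 within ?S)"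
    unfolding tendsto_at_iff_sequentially
  proof (intro allI impI)
    fix h :: "nat \<Rightarrow> real" assume h: "\<forall>i. h i \<in> ?S - {0}" and h0: "h \<longlonglongrightarrow> 0"
    have eq: "((\<lambda>h. (?F (s + h) - ?F s) / h) \<circ> h) i = (LINT x|M. ?q (h i) x)" for i
    proof -
      have hi: "h i \<noteq> 0" "s + h i > 0" using h[rule_format, of i] s by auto
      have "(?F (s + h i) - ?F s) / h i = (LINT x|M. g x * Y x ^ k * exp (- (s + h i) * Y x) -
          g x * Y x ^ k * exp (- s * Y x)) / h i"
        by (subst Bochner_Integration.integral_diff[OF int[OF hi(2)] int[OF s]]) (rule refl)
      also have "\<dots> = (LINT x|M. (g x * Y x ^ k * exp (- (s + h i) * Y x) -
          g x * Y x ^ k * exp (- s * Y x)) / h i)"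
        by (rule Bochner_Integration.integral_divide_zero[symmetric])
      finally show ?thesis by (simp only: comp_def right_diff_distrib diff_divide_distrib times_divide_eq_right)
    qed
    have "(\<lambda>i. LINT x|M. ?q (h i) x) \<longlonglongrightarrow> (LINT x|M. - (g x * Y x ^ Suc k * exp (- s * Y x)))"
    \<comment> \<open>The constant is the bound of \<open>power_mult_exp_le\<close> with rate
      \<open>s / 2\<close> and exponent \<open>Suc k\<close>, one factor of \<open>Y\<close> coming
      from the difference quotient.\<close>
    proof (rule integral_dominated_convergence[where w="\<lambda>x. fact (Suc k) / (s / 2) ^ Suc k"])
      show "AE x in M. (\<lambda>i. ?q (h i) x) \<longlonglongrightarrow> - (g x * Y x ^ Suc k * exp (- s * Y x))"
      proof (rule AE_I2)
        fix x
        have "((\<lambda>s. exp (- s * Y x)) has_field_derivative - Y x * exp (- s * Y x)) (at s)"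
          by (auto intro!: derivative_eq_intros)
        then have *: "((\<lambda>h. (exp (- (s + h) * Y x) - exp (- s * Y x)) / h) \<longlongrightarrow> - Y x * exp (- s * Y x)) (at 0)"
          by (simp only: DERIV_def)
        have "filterlim h (at 0) sequentially"
          using h h0 by (auto simp: filterlim_at)
        from tendsto_mult_left[OF filterlim_compose[OF * this], of "g x * Y x ^ k"]
        show "(\<lambda>i. ?q (h i) x) \<longlonglongrightarrow> - (g x * Y x ^ Suc k * exp (- s * Y x))"
          by (simp add: mult_ac)
      qed
      show "AE x in M. norm (?q (h i) x) \<le> fact (Suc k) / (s / 2) ^ Suc k" for i
      proof (rule AE_I2)
        fix x
        have hi: "h i \<noteq> 0" "\<bar>h i\<bar> \<le> s / 2" using h[rule_format, of i] s by auto
        have "norm (?q (h i) x) = \<bar>g x\<bar> * (Y x ^ k * (\<bar>exp (- (s + h i) * Y x) - exp (- s * Y x)\<bar> / \<bar>h i\<bar>))"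
          using Y[of x] by (simp add: abs_mult)
        also have "\<dots> \<le> 1 * (Y x ^ k * (Y x * exp (- (s / 2) * Y x)))"
          using g[of x] Y[of x] abs_exp_diff_le[OF hi(2) Y[of x]] hi(1)
          by (intro mult_mono) (auto simp: divide_le_eq mult.commute)
        also have "\<dots> \<le> fact (Suc k) / (s / 2) ^ Suc k"
          using power_mult_exp_le[of "s / 2" "Y x" "Suc k"] s Y[of x] by (simp add: mult_ac)
        finally show "norm (?q (h i) x) \<le> fact (Suc k) / (s / 2) ^ Suc k" .
      qed
    qed auto
    then show "((\<lambda>h. (?F (s + h) - ?F s) / h) \<circ> h) \<longlonglongrightarrow> - (LINT x|M. g x * Y x ^ Suc k * exp (- s * Y x))"
      unfolding eq[abs_def] by (simp add: fun_eq_iff comp_def eq[unfolded comp_def])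
  qed
  moreover have "at 0 within ?S = at 0"
    using s by (intro at_within_open) auto
  ultimately show ?thesis
    by (simp only: DERIV_def)
qed

lemma higher_deriv_laplace_moment:
  fixes g Y :: "'a \<Rightarrow> real"
  assumes M: "finite_measure M" and gY: "g \<in> borel_measurable M" "Y \<in> borel_measurable M"
    and g: "\<And>x. \<bar>g x\<bar> \<le> 1" and Y: "\<And>x. 0 \<le> Y x" and s: "s > 0"
  shows "(deriv ^^ k) (\<lambda>s. LINT x|M. g x * exp (- s * Y x)) s =
     (-1) ^ k * (LINT x|M. g x * Y x ^ k * exp (- s * Y x))"
  using s
proof (induction k arbitrary: s)
  case (Suc k)
  have "(deriv ^^ Suc k) (\<lambda>s. LINT x|M. g x * exp (- s * Y x)) s =
      deriv (\<lambda>s. (-1) ^ k * (LINT x|M. g x * Y x ^ k * exp (- s * Y x))) s"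
    unfolding funpow.simps comp_def
  proof (rule deriv_cong_ev)
    \<comment> \<open>\<open>deriv\<close> depends on values near \<open>s\<close>, so the induction
      hypothesis is needed at all positive parameters close to \<open>s\<close>, not only at
      \<open>s\<close>.\<close>
    have "eventually (\<lambda>t. t \<in> {0<..}) (nhds s)"
      using Suc.prems by (intro eventually_nhds_in_open) auto
    then show "\<forall>\<^sub>F t in nhds s. (deriv ^^ k) (\<lambda>s. LINT x|M. g x * exp (- s * Y x)) t =
        (-1) ^ k * (LINT x|M. g x * Y x ^ k * exp (- t * Y x))"
      by eventually_elim (use Suc.IH in simp)
  qed simp
  also have "\<dots> = (-1) ^ k * - (LINT x|M. g x * Y x ^ Suc k * exp (- s * Y x))"
    by (intro DERIV_imp_deriv DERIV_cmult DERIV_laplace_moment[OF M gY g Y Suc.prems])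
  finally show ?case by simp
qed simp

text \<open>The tail at \<open>y\<close> of the Gamma law with shape \<open>k + 1\<close> and rate
  1; equally, the probability that a Poisson variable with mean \<open>y\<close> is at most
  \<open>k\<close>.\<close>

definition erlang_tail :: "nat \<Rightarrow> real \<Rightarrow> real" where
  "erlang_tail k y = (\<Sum>n\<le>k. y ^ n * exp (- y) / fact n)"

lemma erlang_tail_nonneg: "y \<ge> 0 \<Longrightarrow> 0 \<le> erlang_tail k y"
  by (auto simp: erlang_tail_def intro!: sum_nonneg)

lemma erlang_tail_le_1:
  assumes "y \<ge> 0"
  shows "erlang_tail k y \<le> 1"
proof -
  have "(\<Sum>n\<le>k. inverse (fact n) *\<^sub>R y ^ n) \<le> exp y"
    unfolding exp_def using assms by (intro sum_le_suminf summable_exp_generic) auto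
  then have "(\<Sum>n\<le>k. inverse (fact n) *\<^sub>R y ^ n) * exp (- y) \<le> exp y * exp (- y)"
    by (intro mult_right_mono) auto
  then show ?thesis
    by (simp add: erlang_tail_def sum_distrib_left exp_minus divide_inverse mult_ac)
qed

lemma erlang_tail_0: "erlang_tail k 0 = 1"
  by (simp add: erlang_tail_def power_0_left if_distrib[of "\<lambda>x. x / _"] cong: if_cong)

text \<open>The probability of coverage when distance and interference are frozen and only the
  fading gain is random. Infinite interference gives 0, in agreement with the convention in
  \<open>laplace\<close>.\<close>

definition cover_prob :: "params \<Rightarrow> real \<Rightarrow> channel \<Rightarrow> real \<Rightarrow> ennreal \<Rightarrow> real" where
  "cover_prob p \<gamma> i r x =
     (if x = \<infinity> then 0 else erlang_tail (shape p i - 1) (s_r p \<gamma> i r * (enn2real x + sigma2 p)))"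

lemma measurable_cover_prob[measurable]:
  "(\<lambda>(r, x). cover_prob p \<gamma> i r x) \<in> borel_measurable (borel \<Otimes>\<^sub>M borel)"
  unfolding cover_prob_def erlang_tail_def s_r_def by measurable

lemma s_r_pos:
  assumes "valid_params p" "\<gamma> > 0"
  shows "s_r p \<gamma> i r > 0"
proof -
  have "(height p i)\<^sup>2 + r\<^sup>2 > 0"
    using assms by (intro add_pos_nonneg zero_le_power2 zero_less_power) (simp add: valid_params_def)
  then show ?thesis
    using assms unfolding s_r_def valid_params_def by (intro divide_pos_pos mult_pos_pos) auto
qed

lemma cover_prob_bounds:
  assumes "valid_params p" "\<gamma> > 0"
  shows "0 \<le> cover_prob p \<gamma> i r x" "cover_prob p \<gamma> i r x \<le> 1"
  using assms s_r_pos[OF assms, of i r]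
  by (auto simp: cover_prob_def valid_params_def intro!: erlang_tail_nonneg erlang_tail_le_1)

text \<open>The sign \<open>(-1) ^ k\<close> from differentiating the Laplace transform
  \<open>k\<close> times cancels the one in \<open>cond_cov\<close>, and the remaining sum of
  moments is the integral of the Gamma tail. This removes the derivatives for good.\<close>

lemma cond_cov_eq_integral_cover_prob:
  assumes p: "valid_params p" "\<gamma> > 0" and K: "prob_space K" "sets K = sets borel"
  shows "cond_cov p \<gamma> i r K = (LINT x|K. cover_prob p \<gamma> i r x)"
proof -
  interpret prob_space K by fact
  note [measurable_cong] = K(2)
  let ?g = "\<lambda>x::ennreal. if x = \<infinity> then 0 else 1 :: real"
  let ?Y = "\<lambda>x::ennreal. enn2real x + sigma2 p"
  let ?s = "s_r p \<gamma> i r"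
  have s: "?s > 0" using s_r_pos[OF p] .
  have Y: "?Y x \<ge> 0" for x using p by (simp add: valid_params_def)
  have laplace: "laplace p K = (\<lambda>s. LINT x|K. ?g x * exp (- s * ?Y x))"
    unfolding laplace_def by (intro ext Bochner_Integration.integral_cong) auto
  have deriv: "(deriv ^^ k) (laplace p K) ?s = (-1) ^ k * (LINT x|K. ?g x * ?Y x ^ k * exp (- ?s * ?Y x))" for k
    unfolding laplace by (rule higher_deriv_laplace_moment[OF _ _ _ _ Y s]) (unfold_locales, auto)
  have int: "integrable K (\<lambda>x. ?g x * ?Y x ^ k * exp (- ?s * ?Y x))" for k
    using Y power_mult_exp_le[OF s Y, of _ k] s
    by (intro integrable_const_bound[where B="fact k / ?s ^ k"] AE_I2) (auto simp: abs_mult)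
  have "cond_cov p \<gamma> i r K =
      (\<Sum>k = 0..shape p i - 1. LINT x|K. (?s ^ k / fact k) * (?g x * ?Y x ^ k * exp (- ?s * ?Y x)))"
    unfolding cond_cov_def deriv by (intro sum.cong) (auto simp: power_mult_distrib[symmetric])
  also have "\<dots> = (LINT x|K. (\<Sum>k = 0..shape p i - 1. (?s ^ k / fact k) * (?g x * ?Y x ^ k * exp (- ?s * ?Y x))))"
    using int by (intro Bochner_Integration.integral_sum[symmetric] integrable_mult_right)
  also have "\<dots> = (LINT x|K. cover_prob p \<gamma> i r x)"
    by (intro Bochner_Integration.integral_cong)
      (auto simp: cover_prob_def erlang_tail_def atLeast0AtMost power_mult_distrib intro!: sum.cong)
  finally show ?thesis .
qed

lemma nn_integral_cover_prob:
  assumes p: "valid_params p" "\<gamma> > 0" and K: "prob_space K" "sets K = sets borel"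
  shows "(\<integral>\<^sup>+x. ennreal (cover_prob p \<gamma> i r x) \<partial>K) = ennreal (cond_cov p \<gamma> i r K)"
    and "0 \<le> cond_cov p \<gamma> i r K" "cond_cov p \<gamma> i r K \<le> 1"
proof -
  interpret prob_space K by fact
  note [measurable_cong] = K(2)
  have int: "integrable K (cover_prob p \<gamma> i r)"
    using cover_prob_bounds[OF p, of i r] by (intro integrable_const_bound[where B=1] AE_I2) auto
  show "(\<integral>\<^sup>+x. ennreal (cover_prob p \<gamma> i r x) \<partial>K) = ennreal (cond_cov p \<gamma> i r K)"
    using cover_prob_bounds[OF p, of i r] int
    by (simp add: nn_integral_eq_integral cond_cov_eq_integral_cover_prob[OF p K])
  show "0 \<le> cond_cov p \<gamma> i r K" "cond_cov p \<gamma> i r K \<le> 1"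
    using cover_prob_bounds[OF p, of i r] int
    by (auto simp: cond_cov_eq_integral_cover_prob[OF p K] intro!: integral_nonneg_AE integral_le_const)
qed

lemma avg_power_pos: "valid_params p \<Longrightarrow> 0 < avg_power p i d"
proof -
  assume p: "valid_params p"
  then have "d\<^sup>2 + (height p i)\<^sup>2 > 0"
    by (intro add_nonneg_pos zero_le_power2 zero_less_power) (simp add: valid_params_def)
  with p show ?thesis
    unfolding avg_power_def valid_params_def by (intro mult_pos_pos) auto
qed

text \<open>The Gamma law has no atoms, so strict and weak inequality have the same probability.
  Coverage needs the weak form, except without noise and interference, where it reads
  \<open>0 < G\<close>.\<close>

lemma (in prob_space) erlang_distributed_ge:
  assumes D: "distributed M lborel G (erlang_density k l)" and "0 < l" "0 \<le> a"
  shows "emeasure M {\<omega>\<in>space M. a \<le> G \<omega>} = ennreal (erlang_tail k (l * a))"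
    and "emeasure M {\<omega>\<in>space M. a < G \<omega>} = ennreal (erlang_tail k (l * a))"
proof -
  have [measurable]: "random_variable borel G"
    using distributed_measurable[OF D] by simp
  have gt: "emeasure M {\<omega>\<in>space M. a < G \<omega>} = ennreal (1 - erlang_CDF k l a)"
    using erlang_distributed_gt[OF D assms(2,3)] by (simp add: emeasure_eq_measure)
  also have "1 - erlang_CDF k l a = erlang_tail k (l * a)"
    using assms by (simp add: erlang_CDF_def erlang_tail_def)
  finally show "emeasure M {\<omega>\<in>space M. a < G \<omega>} = ennreal (erlang_tail k (l * a))" .
  moreover have "emeasure M (G -` {a..} \<inter> space M) = emeasure M (G -` {a<..} \<inter> space M)"
  proof -
    have "AE x in lborel. x \<noteq> a" by (rule AE_lborel_singleton)
    then have "AE x in lborel. ennreal (erlang_density k l x) * indicator {a..} x =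
        ennreal (erlang_density k l x) * indicator {a<..} x"
      by eventually_elim (auto split: split_indicator)
    then show ?thesis
      using distributed_emeasure[OF D, of "{a..}"] distributed_emeasure[OF D, of "{a<..}"]
      by (simp cong: nn_integral_cong_AE)
  qed
  ultimately show "emeasure M {\<omega>\<in>space M. a \<le> G \<omega>} = ennreal (erlang_tail k (l * a))"
    by (simp add: vimage_def Int_def conj_commute)
qed

text \<open>In \<open>[0, \<infinity>]\<close>, \<open>0 / 0 = 0\<close>; without noise and interference, coverage therefore needs
  the fading gain to be positive, which it is almost surely.\<close>

lemma (in prob_space) emeasure_covered_eq_cover_prob:
  assumes p: "valid_params p" "\<gamma> > 0"
    and D: "distributed M lborel G (erlang_density (shape p i - 1) (real (shape p i)))"
  shows "emeasure M {\<omega>\<in>space M. ennreal \<gamma> \<le> ennreal (avg_power p i d * G \<omega>) / (x + ennreal (sigma2 p))} =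
    ennreal (cover_prob p \<gamma> i d x)"
proof (cases "x = \<infinity>")
  case True
  then show ?thesis using p by (simp add: cover_prob_def)
next
  case False
  let ?a = "avg_power p i d" and ?z = "enn2real x + sigma2 p"
  have a: "?a > 0" by (rule avg_power_pos[OF p(1)])
  have m: "real (shape p i) > 0" and \<sigma>: "0 \<le> sigma2 p" using p by (auto simp: valid_params_def)
  have z: "x + ennreal (sigma2 p) = ennreal ?z"
    using False \<sigma> by (cases x) (auto simp: ennreal_plus)
  have z0: "?z \<ge> 0" using \<sigma> by simp
  show ?thesis
  proof (cases "?z = 0")
    case True
    have "ennreal \<gamma> \<le> ennreal (?a * g) / 0 \<longleftrightarrow> 0 < g" for g :: real
      using a p(2) by (cases "0 < g") (auto simp: ennreal_neg mult_le_0_iff not_less ennreal_eq_0_iff)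
    then show ?thesis
      using erlang_distributed_ge(2)[OF D m, of 0] False
      by (simp add: z True cover_prob_def erlang_tail_0)
  next
    case nz: False
    with z0 have z1: "?z > 0" by simp
    have "ennreal \<gamma> \<le> ennreal (?a * g) / ennreal ?z \<longleftrightarrow> \<gamma> * ?z / ?a \<le> g" for g :: real
    proof (cases "0 \<le> g")
      case True
      then show ?thesis
        using a z1 p(2) by (simp add: divide_ennreal field_simps)
    next
      case False
      then have "?a * g < 0" using a by (simp add: mult_pos_neg)
      moreover have "\<gamma> * ?z / ?a > 0" using a z1 p(2) by simp
      ultimately show ?thesis using False p(2) by (simp add: ennreal_neg not_le del: divide_le_eq)
    qed
    \<comment> \<open>Here \<open>s_r\<close> originates: it is the Gamma rate times the fading
      threshold per unit of interference plus noise.\<close>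
    moreover have "real (shape p i) * (\<gamma> * ?z / ?a) = s_r p \<gamma> i d * ?z"
      by (simp add: avg_power_def s_r_def powr_minus field_simps add.commute)
    moreover have "0 \<le> \<gamma> * ?z / ?a" using a z1 p(2) by simp
    ultimately show ?thesis
      using erlang_distributed_ge(1)[OF D m, of "\<gamma> * ?z / ?a"] False
      by (simp add: z cover_prob_def)
  qed
qed

section \<open>Poisson point processes\<close>

lemma homogeneous_ppp_finite:
  "homogeneous_ppp M l X \<Longrightarrow> B \<in> sets borel \<Longrightarrow> bounded B \<Longrightarrow> AE \<omega> in M. finite {n. X n \<omega> \<in> B}"
  by (simp add: homogeneous_ppp_def)

lemma (in prob_space) homogeneous_ppp_indep_counts:
  fixes B :: "nat \<Rightarrow> 'b::euclidean_space set"
  assumes "homogeneous_ppp M l X"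
    and "\<forall>i<N. B i \<in> sets borel \<and> bounded (B i)" "disjoint_family_on B {..<N}"
  shows "indep_vars (\<lambda>_. count_space UNIV) (\<lambda>i. point_count X (B i)) {..<N}"
  using assms(1)[unfolded homogeneous_ppp_def, THEN conjunct2, THEN conjunct2, rule_format, of N B] assms(2,3)
  by simp

text \<open>Independence of a family includes measurability of its members, so a family with the
  single set \<open>B\<close> suffices.\<close>

lemma (in prob_space) homogeneous_ppp_measurable_count:
  assumes "homogeneous_ppp M l X" "B \<in> sets borel" "bounded B"
  shows "point_count X B \<in> M \<rightarrow>\<^sub>M count_space UNIV"
proof -
  have "indep_vars (\<lambda>_. count_space UNIV) (\<lambda>_. point_count X B) {..<1::nat}"
    using assms by (intro homogeneous_ppp_indep_counts) (auto simp: disjoint_family_on_def)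
  then show ?thesis by (auto simp: indep_vars_def)
qed

text \<open>\<open>card\<close> is 0 for infinite sets as well, so a zero count differs from the
  void event on the set where \<open>B\<close> holds infinitely many points; local finiteness makes
  this a null set.\<close>

lemma (in prob_space) homogeneous_ppp_void:
  assumes ppp: "homogeneous_ppp M l X" and B: "B \<in> sets borel" "bounded B"
  shows "measure M {\<omega>\<in>space M. \<forall>n. X n \<omega> \<notin> B} = exp (- (l * measure lborel B))"
proof -
  have fin: "AE \<omega> in M. finite {n. X n \<omega> \<in> B}"
    and "measure M {\<omega>\<in>space M. point_count X B \<omega> = 0} = exp (- (l * measure lborel B))"
    and [measurable]: "\<And>n. X n \<in> borel_measurable M"
    using assms by (auto simp: homogeneous_ppp_def)
  moreover have "measure M {\<omega>\<in>space M. \<forall>n. X n \<omega> \<notin> B} = measure M {\<omega>\<in>space M. point_count X B \<omega> = 0}"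
  proof (rule measure_eq_AE)
    show "AE \<omega> in M. \<omega> \<in> {\<omega>\<in>space M. \<forall>n. X n \<omega> \<notin> B} \<longleftrightarrow> \<omega> \<in> {\<omega>\<in>space M. point_count X B \<omega> = 0}"
      using fin by eventually_elim (auto simp: point_count_def)
    note [measurable] = homogeneous_ppp_measurable_count[OF ppp B] B(1)
    show "{\<omega>\<in>space M. \<forall>n. X n \<omega> \<notin> B} \<in> sets M" "{\<omega>\<in>space M. point_count X B \<omega> = 0} \<in> sets M"
      by measurable
  qed
  ultimately show ?thesis by simp
qed

text \<open>This is the generating function of the Poisson law: weighting its probabilities by
  \<open>q ^ k\<close> leaves an exponential series in
  \<open>q * l * measure lborel B\<close>.\<close>

lemma (in prob_space) homogeneous_ppp_expectation_power:
  assumes ppp: "homogeneous_ppp M l X" and B: "B \<in> sets borel" "bounded B" and q: "0 \<le> q" "q \<le> 1"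
  shows "expectation (\<lambda>\<omega>. q ^ point_count X B \<omega>) = exp (- (l * measure lborel B * (1 - q)))"
proof -
  note [measurable] = homogeneous_ppp_measurable_count[OF ppp B]
  let ?N = "point_count X B" and ?a = "l * measure lborel B"
  have pr: "prob {\<omega>\<in>space M. ?N \<omega> = k} = ?a ^ k / fact k * exp (- ?a)" for k
    using assms by (auto simp: homogeneous_ppp_def)
  have sums: "(\<lambda>k. q ^ k * prob {\<omega>\<in>space M. ?N \<omega> = k}) sums exp (- (?a * (1 - q)))"
  proof -
    have "(\<lambda>k. ((q * ?a) ^ k /\<^sub>R fact k) * exp (- ?a)) sums (exp (q * ?a) * exp (- ?a))"
      by (intro sums_mult2 exp_converges)
    then show ?thesis
      unfolding pr by (simp add: power_mult_distrib exp_add[symmetric] algebra_simps divide_inverse)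
  qed
  have "(\<integral>\<^sup>+\<omega>. ennreal (q ^ ?N \<omega>) \<partial>M) =
      (\<integral>\<^sup>+\<omega>. (\<Sum>k. ennreal (q ^ k) * indicator {\<omega>\<in>space M. ?N \<omega> = k} \<omega>) \<partial>M)"
  proof (intro nn_integral_cong)
    fix \<omega> assume "\<omega> \<in> space M"
    then show "ennreal (q ^ ?N \<omega>) = (\<Sum>k. ennreal (q ^ k) * indicator {\<omega>\<in>space M. ?N \<omega> = k} \<omega>)"
      by (subst suminf_finite[of "{?N \<omega>}"]) auto
  qed
  also have "\<dots> = (\<Sum>k. ennreal (q ^ k) * emeasure M {\<omega>\<in>space M. ?N \<omega> = k})"
    by (subst nn_integral_suminf) (simp_all add: nn_integral_cmult)
  also have "\<dots> = (\<Sum>k. ennreal (q ^ k * prob {\<omega>\<in>space M. ?N \<omega> = k}))"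
    using q by (simp add: emeasure_eq_measure ennreal_mult)
  also have "\<dots> = ennreal (exp (- (?a * (1 - q))))"
    using q by (intro suminf_ennreal_eq sums) auto
  finally show ?thesis
    using q by (subst integral_eq_nn_integral) auto
qed

lemma (in prob_space) homogeneous_ppp_expectation_prod:
  fixes N :: nat
  assumes ppp: "homogeneous_ppp M l X"
    and B: "\<And>k. k < N \<Longrightarrow> B k \<in> sets borel" "\<And>k. k < N \<Longrightarrow> bounded (B k)" "disjoint_family_on B {..<N}"
    and q: "\<And>k. k < N \<Longrightarrow> 0 \<le> q k" "\<And>k. k < N \<Longrightarrow> q k \<le> 1"
  shows "expectation (\<lambda>\<omega>. \<Prod>k<N. q k ^ point_count X (B k) \<omega>) =
     exp (- (l * (\<Sum>k<N. measure lborel (B k) * (1 - q k))))"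
proof -
  have "indep_vars (\<lambda>_. count_space UNIV) (\<lambda>k. point_count X (B k)) {..<N}"
    using B by (intro homogeneous_ppp_indep_counts[OF ppp]) auto
  then have ind: "indep_vars (\<lambda>_. borel) (\<lambda>k \<omega>. q k ^ point_count X (B k) \<omega>) {..<N}"
    by (rule indep_vars_compose2) simp
  have "integrable M (\<lambda>\<omega>. q k ^ point_count X (B k) \<omega>)" if k: "k < N" for k
  proof -
    note [measurable] = homogeneous_ppp_measurable_count[OF ppp B(1,2)[OF k]]
    show ?thesis
      using q[OF k] by (intro integrable_const_bound[where B=1] AE_I2) (auto simp: power_le_one)
  qed
  with ind have "expectation (\<lambda>\<omega>. \<Prod>k<N. q k ^ point_count X (B k) \<omega>) =
      (\<Prod>k<N. expectation (\<lambda>\<omega>. q k ^ point_count X (B k) \<omega>))"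
    by (intro indep_vars_lebesgue_integral) auto
  also have "\<dots> = (\<Prod>k<N. exp (- (l * measure lborel (B k) * (1 - q k))))"
    using B q by (intro prod.cong homogeneous_ppp_expectation_power[OF ppp]) auto
  finally show ?thesis
    by (simp add: exp_sum[symmetric] sum_distrib_left sum_negf mult_ac)
qed

lemma floor_approx_LIMSEQ:
  fixes q :: real
  assumes "0 \<le> q"
  shows "(\<lambda>j. real (nat \<lfloor>real (Suc j) * q\<rfloor>) / real (Suc j)) \<longlonglongrightarrow> q"
proof (rule tendsto_sandwich[where f="\<lambda>j. q - 1 / real (Suc j)" and h="\<lambda>_. q"])
  have "(\<lambda>j. q - inverse (real (Suc j))) \<longlonglongrightarrow> q - 0"
    by (intro tendsto_diff tendsto_const LIMSEQ_inverse_real_of_nat)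
  then show "(\<lambda>j. q - 1 / real (Suc j)) \<longlonglongrightarrow> q" by (simp add: inverse_eq_divide)
  show "\<forall>\<^sub>F j in sequentially. q - 1 / real (Suc j) \<le> real (nat \<lfloor>real (Suc j) * q\<rfloor>) / real (Suc j)"
  proof (rule always_eventually, rule allI)
    fix j
    have "real (nat \<lfloor>real (Suc j) * q\<rfloor>) = of_int \<lfloor>real (Suc j) * q\<rfloor>"
      using assms by (subst of_nat_nat) auto
    moreover have "real (Suc j) * q - 1 \<le> of_int \<lfloor>real (Suc j) * q\<rfloor>" by linarith
    ultimately have "(real (Suc j) * q - 1) / real (Suc j) \<le> real (nat \<lfloor>real (Suc j) * q\<rfloor>) / real (Suc j)"
      by (intro divide_right_mono) auto
    then show "q - 1 / real (Suc j) \<le> real (nat \<lfloor>real (Suc j) * q\<rfloor>) / real (Suc j)"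
      by (simp add: diff_divide_distrib)
  qed
  show "\<forall>\<^sub>F j in sequentially. real (nat \<lfloor>real (Suc j) * q\<rfloor>) / real (Suc j) \<le> q"
  proof (rule always_eventually, rule allI)
    fix j
    have "real (nat \<lfloor>real (Suc j) * q\<rfloor>) = of_int \<lfloor>real (Suc j) * q\<rfloor>"
      using assms by (subst of_nat_nat) auto
    also have "\<dots> \<le> real (Suc j) * q" by linarith
    finally show "real (nat \<lfloor>real (Suc j) * q\<rfloor>) / real (Suc j) \<le> q"
      by (subst divide_le_eq) (auto simp: mult.commute)
  qed
qed simp

text \<open>\<open>q\<close> is approximated by the step functions \<open>\<lfloor>j q\<rfloor> / j\<close>, whose level sets carry independent Poisson counts.\<close>

lemma (in prob_space) homogeneous_ppp_generating_functional:
  fixes X :: "nat \<Rightarrow> 'a \<Rightarrow> 'b::euclidean_space" and q :: "'b \<Rightarrow> real"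
  assumes ppp: "homogeneous_ppp M l X" and B[measurable]: "B \<in> sets borel" and bB: "bounded B"
    and q[measurable]: "q \<in> borel_measurable borel" and q01: "\<And>x. 0 \<le> q x" "\<And>x. q x \<le> 1"
    and q1: "\<And>x. x \<notin> B \<Longrightarrow> q x = 1"
  shows "(\<lambda>N. expectation (\<lambda>\<omega>. \<Prod>n<N. q (X n \<omega>))) \<longlonglongrightarrow> exp (- (l * (LINT x|lborel. 1 - q x)))"
proof -
  have fin: "AE \<omega> in M. finite {n. X n \<omega> \<in> B}" and X[measurable]: "\<And>n. X n \<in> borel_measurable M"
    using assms by (auto simp: homogeneous_ppp_def)
  define Z where "Z \<omega> = {n. X n \<omega> \<in> B}" for \<omega>
  \<comment> \<open>Measurability is immediate for a limit of finite products, but not for the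
    product over the random index set \<open>Z \<omega>\<close>, with which it agrees almost
    surely.\<close>
  define F where "F \<omega> = lim (\<lambda>N. \<Prod>n<N. q (X n \<omega>))" for \<omega>
  have [measurable]: "F \<in> borel_measurable M" unfolding F_def by measurable
  \<comment> \<open>Only finitely many factors differ from 1, since \<open>q\<close> is 1 outside
    \<open>B\<close>; the partial products are eventually constant.\<close>
  have lim: "(\<lambda>N. \<Prod>n<N. q (X n \<omega>)) \<longlonglongrightarrow> (\<Prod>n\<in>Z \<omega>. q (X n \<omega>))" if "finite {n. X n \<omega> \<in> B}" for \<omega>
  proof -
    have "finite (Z \<omega>)" using that by (simp add: Z_def)
    then obtain k where k: "Z \<omega> \<subseteq> {..<k}" using finite_nat_iff_bounded by blast
    have "eventually (\<lambda>N. (\<Prod>n<N. q (X n \<omega>)) = (\<Prod>n\<in>Z \<omega>. q (X n \<omega>))) sequentially"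
      using eventually_ge_at_top[of k]
    proof eventually_elim
      case (elim N)
      then show ?case using k q1 by (intro prod.mono_neutral_right) (auto simp: Z_def)
    qed
    then show ?thesis by (rule tendsto_eventually)
  qed
  have F: "AE \<omega> in M. F \<omega> = (\<Prod>n\<in>Z \<omega>. q (X n \<omega>))"
    using fin by eventually_elim (auto simp: F_def intro!: limI lim)
  have 1: "(\<lambda>N. expectation (\<lambda>\<omega>. \<Prod>n<N. q (X n \<omega>))) \<longlonglongrightarrow> expectation F"
  proof (rule integral_dominated_convergence[where w="\<lambda>_. 1"])
    show "AE \<omega> in M. (\<lambda>N. \<Prod>n<N. q (X n \<omega>)) \<longlonglongrightarrow> F \<omega>"
      using fin F by eventually_elim (use lim in auto)
    show "AE \<omega> in M. norm (\<Prod>n<N. q (X n \<omega>)) \<le> 1" for N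
      using q01 by (auto simp: abs_prod intro!: prod_le_1)
  qed auto
  define g where "g j x = nat \<lfloor>real (Suc j) * q x\<rfloor>" for j x
  define C where "C j k = {x\<in>B. g j x = k}" for j k
  define s where "s j x = real (g j x) / real (Suc j)" for j x
  have [measurable]: "\<And>j. g j \<in> borel \<rightarrow>\<^sub>M count_space UNIV" unfolding g_def by measurable
  have [measurable]: "\<And>j. s j \<in> borel_measurable borel" unfolding s_def by measurable
  have C[measurable]: "C j k \<in> sets borel" for j k unfolding C_def by measurable
  have bC: "bounded (C j k)" for j k using bB by (rule bounded_subset) (auto simp: C_def)
  have g_le: "g j x \<le> Suc j" for j x
  proof -
    have "real (Suc j) * q x \<le> real (Suc j)" using q01 by (simp add: mult_left_le)
    then have "\<lfloor>real (Suc j) * q x\<rfloor> \<le> int (Suc j)" by linarith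
    then show ?thesis by (simp add: g_def)
  qed
  have s01: "0 \<le> s j x" "s j x \<le> 1" for j x
    using g_le[of j x] by (auto simp: s_def)
  have s_lim: "(\<lambda>j. s j x) \<longlonglongrightarrow> q x" for x
    unfolding s_def g_def by (rule floor_approx_LIMSEQ[OF q01(1)])
  \<comment> \<open>The level \<open>g j x\<close> takes the values 0 to \<open>j + 1\<close>, the
    last one exactly where \<open>q\<close> is 1; hence the range \<open>k < j + 2\<close>.\<close>
  let ?P = "\<lambda>j \<omega>. \<Prod>k<j + 2. (real k / real (Suc j)) ^ point_count X (C j k) \<omega>"
  have P: "?P j \<omega> = (\<Prod>n\<in>Z \<omega>. s j (X n \<omega>))" if "finite {n. X n \<omega> \<in> B}" for j \<omega>
  proof -
    have fZ: "finite (Z \<omega>)" using that by (simp add: Z_def)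
    have "(\<Prod>n\<in>Z \<omega>. s j (X n \<omega>)) = (\<Prod>k<j + 2. \<Prod>n\<in>{n \<in> Z \<omega>. g j (X n \<omega>) = k}. s j (X n \<omega>))"
      by (rule prod.group[symmetric]) (use fZ g_le[of j] in \<open>auto simp: less_Suc_eq_le\<close>)
    also have "\<dots> = (\<Prod>k<j + 2. \<Prod>n\<in>{n. X n \<omega> \<in> C j k}. real k / real (Suc j))"
      by (intro prod.cong) (auto simp: C_def Z_def s_def)
    finally show ?thesis by (simp add: point_count_def)
  qed
  have [measurable]: "point_count X (C j k) \<in> M \<rightarrow>\<^sub>M count_space UNIV" for j k
    by (rule homogeneous_ppp_measurable_count[OF ppp C bC])
  have 2: "(\<lambda>j. expectation (?P j)) \<longlonglongrightarrow> expectation F"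
  proof (rule integral_dominated_convergence[where w="\<lambda>_. 1"])
    show "AE \<omega> in M. (\<lambda>j. ?P j \<omega>) \<longlonglongrightarrow> F \<omega>"
      using fin F
    proof eventually_elim
      case (elim \<omega>)
      then show ?case unfolding P[OF elim(1)] elim(2) by (intro tendsto_prod s_lim)
    qed
    show "AE \<omega> in M. norm (?P j \<omega>) \<le> 1" for j
    proof (rule AE_I2)
      fix \<omega>
      have "0 \<le> ?P j \<omega>" by (intro prod_nonneg) auto
      moreover have "?P j \<omega> \<le> 1" by (intro prod_le_1 conjI power_le_one) auto
      ultimately show "norm (?P j \<omega>) \<le> 1" by simp
    qed
  qed auto
  have 3: "expectation (?P j) = exp (- (l * (LINT x|lborel. indicator B x * (1 - s j x))))" for j
  proof -
    have "expectation (?P j) =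
        exp (- (l * (\<Sum>k<j + 2. measure lborel (C j k) * (1 - real k / real (Suc j)))))"
      by (rule homogeneous_ppp_expectation_prod[OF ppp C bC])
        (auto simp: disjoint_family_on_def C_def)
    also have "(\<Sum>k<j + 2. measure lborel (C j k) * (1 - real k / real (Suc j))) =
        (\<Sum>k<j + 2. LINT x|lborel. indicator (C j k) x * (1 - real k / real (Suc j)))"
      by simp
    also have "\<dots> = (LINT x|lborel. (\<Sum>k<j + 2. indicator (C j k) x * (1 - real k / real (Suc j))))"
      using emeasure_bounded_finite[OF bC]
      by (intro Bochner_Integration.integral_sum[symmetric] integrable_mult_left integrable_real_indicator) auto
    also have "\<dots> = (LINT x|lborel. indicator B x * (1 - s j x))"
    proof (intro Bochner_Integration.integral_cong refl)
      fix x
      have "(\<Sum>k<j + 2. indicator (C j k) x * (1 - real k / real (Suc j))) =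
          (\<Sum>k<j + 2. if k = g j x then indicator B x * (1 - s j x) else 0)"
        by (intro sum.cong) (auto simp: C_def s_def split: split_indicator)
      then show "(\<Sum>k<j + 2. indicator (C j k) x * (1 - real k / real (Suc j))) = indicator B x * (1 - s j x)"
        using g_le[of j x] by simp
    qed
    finally show ?thesis .
  qed
  have 4: "(\<lambda>j. LINT x|lborel. indicator B x * (1 - s j x)) \<longlonglongrightarrow> (LINT x|lborel. indicator B x * (1 - q x))"
  proof (rule integral_dominated_convergence[where w="indicator B"])
    show "integrable lborel (indicator B :: 'b \<Rightarrow> real)"
      using emeasure_bounded_finite[OF bB] by (intro integrable_real_indicator) auto
    show "AE x in lborel. (\<lambda>j. indicator B x * (1 - s j x)) \<longlonglongrightarrow> indicator B x * (1 - q x)"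
      by (intro AE_I2 tendsto_intros s_lim)
    show "AE x in lborel. norm (indicator B x * (1 - s j x)) \<le> indicator B x" for j
      using s01 by (intro AE_I2) (auto split: split_indicator)
  qed auto
  have "(\<lambda>j. expectation (?P j)) \<longlonglongrightarrow> exp (- (l * (LINT x|lborel. indicator B x * (1 - q x))))"
    unfolding 3 by (intro tendsto_intros 4)
  then have "expectation F = exp (- (l * (LINT x|lborel. indicator B x * (1 - q x))))"
    using 2 LIMSEQ_unique by blast
  moreover have "(LINT x|lborel. indicator B x * (1 - q x)) = (LINT x|lborel. 1 - q x)"
    using q1 by (intro Bochner_Integration.integral_cong) (auto split: split_indicator)
  ultimately show ?thesis using 1 by simp
qed

section \<open>Independence and measurability in the network\<close>

text \<open>The randomness behind \<open>Phi p w i\<close> and \<open>R_near p w i\<close>. It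
  contains neither \<open>SCenter\<close> nor \<open>SLbd\<close>, which makes both independent of
  \<open>r_c\<close>.\<close>

definition mark_sources :: "channel \<Rightarrow> source set" where
  "mark_sources i = insert (SPts (tier_of i)) {SMark (Other (tier_of i) n) |n. True}"

text \<open>Association rests on average powers, so it is determined by these sources alone.\<close>

definition nonfading :: "source set" where
  "nonfading = - {SFading v j |v j. True}"

lemma Int_stable_generated_events: "Int_stable (generated_events L N X)"
proof (rule Int_stableI)
  fix a b assume "a \<in> generated_events L N X" "b \<in> generated_events L N X"
  then obtain A B where "a = X -` A \<inter> space L" "b = X -` B \<inter> space L" "A \<in> sets N" "B \<in> sets N"
    by (auto simp: generated_events_def)
  then show "a \<inter> b \<in> generated_events L N X"
    unfolding generated_events_def by (intro CollectI exI[of _ "A \<inter> B"]) auto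
qed

locale uav_network =
  fixes p :: params and w :: "'w network"
  assumes valid: "valid_params p" and model: "network_model p w"
begin

sublocale prob_space "sample w"
  using model by (simp add: network_model_def)

text \<open>The information carried by the sources in \<open>S\<close>. Measurability with respect
  to \<open>info S\<close> records what a variable depends on, and disjoint sets of sources yield
  independence.\<close>

definition info :: "source set \<Rightarrow> 'w measure" where
  "info S = sigma (space (sample w)) (\<Union>s\<in>S. source_events w s)"

lemma indep_sources: "indep_sets (source_events w) UNIV"
  using model by (simp add: network_model_def)

lemma source_events_subset: "source_events w s \<subseteq> events"
  using indep_sources by (auto simp: indep_sets_def)

lemma Union_source_events_subset: "(\<Union>s\<in>S. source_events w s) \<subseteq> Pow (space (sample w))"
  using source_events_subset sets.space_closed[of "sample w"] by blast

lemma space_info[simp]: "space (info S) = space (sample w)"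
  by (simp add: info_def space_measure_of_conv)

lemma sets_info: "sets (info S) = sigma_sets (space (sample w)) (\<Union>s\<in>S. source_events w s)"
  unfolding info_def by (rule sets_measure_of[OF Union_source_events_subset])

lemma sets_info_subset_events: "sets (info S) \<subseteq> events"
  unfolding sets_info using source_events_subset by (intro sets.sigma_sets_subset) blast

lemma measurable_info_mono:
  "X \<in> info S \<rightarrow>\<^sub>M N \<Longrightarrow> S \<subseteq> T \<Longrightarrow> X \<in> info T \<rightarrow>\<^sub>M N"
proof -
  assume X: "X \<in> info S \<rightarrow>\<^sub>M N" and "S \<subseteq> T"
  then have "sets (info S) \<subseteq> sets (info T)"
    unfolding sets_info by (intro sigma_sets_mono' UN_mono) auto
  from measurable_mono[OF order_refl refl this] X show ?thesis by auto
qed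

lemma measurable_info_sample: "X \<in> info S \<rightarrow>\<^sub>M N \<Longrightarrow> X \<in> sample w \<rightarrow>\<^sub>M N"
  by (rule measurable_mono[OF order_refl refl sets_info_subset_events, THEN subsetD]) auto

lemma Int_stable_source_events: "Int_stable (source_events w s)"
  by (cases s) (simp_all add: Int_stable_generated_events)

text \<open>The generators \<open>source_events w s\<close> are stable under intersection, so their
  independence extends to the sigma-algebras generated by disjoint groups of sources.\<close>

lemma indep_set_info:
  assumes "S \<inter> T = {}"
  shows "indep_set (sets (info S)) (sets (info T))"
proof -
  have "indep_sets (\<lambda>j. sigma_sets (space (sample w)) (\<Union>s\<in>case_bool S T j. source_events w s)) UNIV"
    using assms by (intro indep_sets_collect_sigma indep_sets_mono_index[OF _ indep_sources] Int_stable_source_events)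
      (auto simp: disjoint_family_on_def split: bool.split)
  then have "indep_sets (\<lambda>j. sets (info (case_bool S T j))) UNIV"
    by (simp add: sets_info)
  then show ?thesis
    unfolding indep_set_def by (rule indep_sets_mono_sets) (auto split: bool.split)
qed

text \<open>The joint law is a product, so \<open>Y\<close> may be averaged over a separate sample
  point while \<open>X\<close> is frozen. All later uses of independence between sources go through
  this form.\<close>

lemma nn_integral_indep:
  assumes ST: "S \<inter> T = {}" and X: "X \<in> info S \<rightarrow>\<^sub>M N" and Y: "Y \<in> info T \<rightarrow>\<^sub>M N'"
    and f[measurable]: "(\<lambda>(x, y). f x y) \<in> borel_measurable (N \<Otimes>\<^sub>M N')"
  shows "(\<integral>\<^sup>+\<omega>. f (X \<omega>) (Y \<omega>) \<partial>sample w) = (\<integral>\<^sup>+\<omega>. (\<integral>\<^sup>+\<omega>'. f (X \<omega>) (Y \<omega>') \<partial>sample w) \<partial>sample w)"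
proof -
  note [measurable] = measurable_info_sample[OF X] measurable_info_sample[OF Y]
  interpret Y: prob_space "distr (sample w) N' Y" by (rule prob_space_distr) simp
  interpret X: prob_space "distr (sample w) N X" by (rule prob_space_distr) simp
  have eq: "distr (sample w) N X \<Otimes>\<^sub>M distr (sample w) N' Y =
      distr (sample w) (N \<Otimes>\<^sub>M N') (\<lambda>\<omega>. (X \<omega>, Y \<omega>))"
  proof (rule pair_measure_eqI)
    fix A B assume "A \<in> sets (distr (sample w) N X)" "B \<in> sets (distr (sample w) N' Y)"
    then have [measurable]: "A \<in> sets N" "B \<in> sets N'" by auto
    have "prob ((X -` A \<inter> space (sample w)) \<inter> (Y -` B \<inter> space (sample w))) =
        prob (X -` A \<inter> space (sample w)) * prob (Y -` B \<inter> space (sample w))"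
      using measurable_sets[OF X, of A] measurable_sets[OF Y, of B]
      by (intro indep_setD[OF indep_set_info[OF ST]]) auto
    moreover have "(X -` A \<inter> space (sample w)) \<inter> (Y -` B \<inter> space (sample w)) =
        (\<lambda>\<omega>. (X \<omega>, Y \<omega>)) -` (A \<times> B) \<inter> space (sample w)"
      by auto
    ultimately show "emeasure (distr (sample w) N X) A * emeasure (distr (sample w) N' Y) B =
        emeasure (distr (sample w) (N \<Otimes>\<^sub>M N') (\<lambda>\<omega>. (X \<omega>, Y \<omega>))) (A \<times> B)"
      by (simp add: emeasure_distr emeasure_eq_measure ennreal_mult[symmetric])
  qed (unfold_locales, auto)
  have "(\<integral>\<^sup>+\<omega>. f (X \<omega>) (Y \<omega>) \<partial>sample w) =
      (\<integral>\<^sup>+z. (case z of (x, y) \<Rightarrow> f x y) \<partial>distr (sample w) (N \<Otimes>\<^sub>M N') (\<lambda>\<omega>. (X \<omega>, Y \<omega>)))"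
    by (subst nn_integral_distr) auto
  also have "\<dots> = (\<integral>\<^sup>+x. \<integral>\<^sup>+y. f x y \<partial>distr (sample w) N' Y \<partial>distr (sample w) N X)"
    unfolding eq[symmetric] by (subst Y.nn_integral_fst[symmetric]) (auto cong: measurable_cong_sets)
  also have "\<dots> = (\<integral>\<^sup>+\<omega>. (\<integral>\<^sup>+y. f (X \<omega>) y \<partial>distr (sample w) N' Y) \<partial>sample w)"
    by (subst nn_integral_distr) auto
  also have "\<dots> = (\<integral>\<^sup>+\<omega>. (\<integral>\<^sup>+\<omega>'. f (X \<omega>) (Y \<omega>') \<partial>sample w) \<partial>sample w)"
  proof (intro nn_integral_cong)
    fix \<omega> assume "\<omega> \<in> space (sample w)"
    then have "X \<omega> \<in> space N" using measurable_space[OF X] by simp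
    then show "(\<integral>\<^sup>+y. f (X \<omega>) y \<partial>distr (sample w) N' Y) = (\<integral>\<^sup>+\<omega>'. f (X \<omega>) (Y \<omega>') \<partial>sample w)"
      by (subst nn_integral_distr) auto
  qed
  finally show ?thesis .
qed

lemma measurable_generated:
  assumes "source_events w s = generated_events (sample w) N X" "X \<in> sample w \<rightarrow>\<^sub>M N" "s \<in> S"
  shows "X \<in> info S \<rightarrow>\<^sub>M N"
proof (rule measurableI)
  fix A assume "A \<in> sets N"
  then have "X -` A \<inter> space (sample w) \<in> source_events w s"
    by (auto simp: assms(1) generated_events_def)
  then show "X -` A \<inter> space (info S) \<in> sets (info S)"
    using assms(3) by (auto simp: sets_info)
qed (use measurable_space[OF assms(2)] in simp)

section \<open>Which sources determine which variables\<close>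

lemma measurable_center: "SCenter \<in> S \<Longrightarrow> center w \<in> borel_measurable (info S)"
  using model by (intro measurable_generated[where s=SCenter]) (auto simp: network_model_def)

lemma measurable_lbd_sequence:
  "SLbd \<in> S \<Longrightarrow> (\<lambda>\<omega> n. lbd w n \<omega>) \<in> info S \<rightarrow>\<^sub>M Pi\<^sub>M UNIV (\<lambda>_. borel)"
  using model by (intro measurable_generated[where s=SLbd])
    (auto simp: network_model_def homogeneous_ppp_def intro!: measurable_PiM_single')

lemma measurable_lbd: "SLbd \<in> S \<Longrightarrow> lbd w n \<in> borel_measurable (info S)"
  using measurable_compose[OF measurable_lbd_sequence measurable_component_singleton[of n]] by simp

lemma measurable_pts_sequence:
  "SPts t \<in> S \<Longrightarrow> (\<lambda>\<omega> n. pts w t n \<omega>) \<in> info S \<rightarrow>\<^sub>M Pi\<^sub>M UNIV (\<lambda>_. borel)"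
  using model by (intro measurable_generated[where s="SPts t"])
    (auto simp: network_model_def homogeneous_ppp_def intro!: measurable_PiM_single')

lemma measurable_pts: "SPts t \<in> S \<Longrightarrow> pts w t n \<in> borel_measurable (info S)"
  using measurable_compose[OF measurable_pts_sequence measurable_component_singleton[of n]] by simp

lemma measurable_los_mark: "SMark v \<in> S \<Longrightarrow> los_mark w v \<in> borel_measurable (info S)"
  using model by (intro measurable_generated[where s="SMark v"]) (auto simp: network_model_def)

lemma measurable_fading: "SFading v j \<in> S \<Longrightarrow> fading w v j \<in> borel_measurable (info S)"
  using model by (intro measurable_generated[where s="SFading v j"])
    (auto simp: network_model_def distributed_def)

lemma measurable_los_prob[measurable]: "los_prob p t \<in> borel_measurable borel"
  unfolding los_prob_def[abs_def] by measurable

lemma measurable_channel_prob[measurable]: "channel_prob p i \<in> borel_measurable borel"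
  unfolding channel_prob_def[abs_def] by measurable

lemma measurable_avg_power[measurable]: "avg_power p j \<in> borel_measurable borel"
  unfolding avg_power_def[abs_def] by measurable

lemma measurable_nearest_lbd:
  assumes "{SCenter, SLbd} \<subseteq> S"
  shows "nearest_lbd w \<in> borel_measurable (info S)"
proof -
  have [measurable]: "center w \<in> borel_measurable (info S)" "\<And>n. lbd w n \<in> borel_measurable (info S)"
    using assms by (auto intro: measurable_center measurable_lbd)
  show ?thesis
    unfolding nearest_lbd_def[abs_def] by (rule measurable_compose_countable) measurable
qed

lemma measurable_r_c:
  assumes "{SCenter, SLbd} \<subseteq> S"
  shows "r_c w \<in> borel_measurable (info S)"
proof -
  have [measurable]: "center w \<in> borel_measurable (info S)" "nearest_lbd w \<in> borel_measurable (info S)"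
    using assms by (auto intro: measurable_center measurable_nearest_lbd)
  show ?thesis unfolding r_c_def[abs_def] by measurable
qed

lemma measurable_r_cu:
  assumes "{SCenter, SLbd} \<subseteq> S"
  shows "r_cu p w \<in> borel_measurable (info S)"
proof -
  have [measurable]: "center w \<in> borel_measurable (info S)" "nearest_lbd w \<in> borel_measurable (info S)"
      "r_c w \<in> borel_measurable (info S)"
    using assms by (auto intro: measurable_center measurable_nearest_lbd measurable_r_c)
  have "r_cu p w = (\<lambda>\<omega>. norm (central_pos p w \<omega>))" by (simp add: fun_eq_iff)
  then show ?thesis
    unfolding central_pos_def[abs_def] by simp
qed

lemma measurable_dist_Other:
  assumes "SPts t \<in> S"
  shows "node_dist p w (Other t n) \<in> borel_measurable (info S)"
proof -
  note [measurable] = measurable_pts[OF assms]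
  have "node_dist p w (Other t n) = (\<lambda>\<omega>. norm (pts w t n \<omega>))" by (simp add: fun_eq_iff)
  then show ?thesis by simp
qed

lemma measurable_channel:
  assumes "node_dist p w v \<in> borel_measurable (info S)" "SMark v \<in> S"
  shows "node_channel p w v \<in> info S \<rightarrow>\<^sub>M count_space UNIV"
proof -
  note [measurable] = assms(1) measurable_los_mark[OF assms(2)]
  show ?thesis unfolding node_channel_def[abs_def] by measurable
qed

lemma measurable_channel_Other:
  assumes "SPts t \<in> S" "SMark (Other t n) \<in> S"
  shows "node_channel p w (Other t n) \<in> info S \<rightarrow>\<^sub>M count_space UNIV"
  using assms by (intro measurable_channel measurable_dist_Other)

lemma measurable_dist_nonfading:
  "nonfading \<subseteq> S \<Longrightarrow> node_dist p w v \<in> borel_measurable (info S)"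
  by (cases v) (auto simp: nonfading_def simp del: node_dist.simps intro!: measurable_r_cu measurable_dist_Other)

lemma measurable_channel_nonfading:
  assumes "nonfading \<subseteq> S" shows "node_channel p w v \<in> info S \<rightarrow>\<^sub>M count_space UNIV"
  using assms by (intro measurable_channel measurable_dist_nonfading) (auto simp: nonfading_def)

lemma measurable_avg_nonfading:
  assumes "nonfading \<subseteq> S" shows "node_avg p w v \<in> borel_measurable (info S)"
proof -
  note [measurable] = measurable_channel_nonfading[OF assms] measurable_dist_nonfading[OF assms]
  show ?thesis unfolding node_avg_def[abs_def]
    by (rule measurable_compose_countable[where g="node_channel p w v" and
          f="\<lambda>i \<omega>. avg_power p i (node_dist p w v \<omega>)"]) measurable
qed

lemma measurable_serves:
  assumes "nonfading \<subseteq> S" shows "Measurable.pred (info S) (serves p w v)"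
proof -
  note [measurable] = measurable_avg_nonfading[OF assms]
  show ?thesis unfolding serves_def[abs_def] by measurable
qed

lemma measurable_Phi:
  assumes "mark_sources i \<subseteq> S" shows "Measurable.pred (info S) (\<lambda>\<omega>. n \<in> Phi p w i \<omega>)"
proof -
  have [measurable]: "node_channel p w (Other (tier_of i) n) \<in> info S \<rightarrow>\<^sub>M count_space UNIV"
    using assms by (intro measurable_channel_Other) (auto simp: mark_sources_def)
  show ?thesis unfolding Phi_def by simp
qed

lemma measurable_Phi_nonempty:
  assumes "mark_sources i \<subseteq> S" shows "Measurable.pred (info S) (\<lambda>\<omega>. Phi p w i \<omega> \<noteq> {})"
proof -
  note [measurable] = measurable_Phi[OF assms]
  have "Measurable.pred (info S) (\<lambda>\<omega>. \<exists>n. n \<in> Phi p w i \<omega>)" by measurable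
  then show ?thesis by (simp add: ex_in_conv)
qed

text \<open>A strict bound on an infimum is witnessed by an index whether or not the infimum is
  attained, so measurability follows at every sample point, without local finiteness. On empty
  \<open>Phi\<close> the distance is the fixed value \<open>Inf {}\<close>.\<close>

lemma R_near_less_iff:
  "R_near p w i \<omega> < a \<longleftrightarrow>
    (if Phi p w i \<omega> \<noteq> {} then \<exists>n. n \<in> Phi p w i \<omega> \<and> node_dist p w (Other (tier_of i) n) \<omega> < a
     else Inf {} < a)"
proof (cases "Phi p w i \<omega> = {}")
  case False
  have "bdd_below ((\<lambda>n. node_dist p w (Other (tier_of i) n) \<omega>) ` Phi p w i \<omega>)"
    by (intro bdd_belowI2[where m=0]) simp
  with False show ?thesis
    unfolding R_near_def by (auto simp: cINF_less_iff simp del: node_dist.simps)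
qed (simp add: R_near_def)

lemma measurable_R_near:
  assumes "mark_sources i \<subseteq> S" shows "R_near p w i \<in> borel_measurable (info S)"
proof -
  have [measurable]: "\<And>n. node_dist p w (Other (tier_of i) n) \<in> borel_measurable (info S)"
    using assms by (intro measurable_dist_Other) (auto simp: mark_sources_def)
  note [measurable] = measurable_Phi[OF assms] measurable_Phi_nonempty[OF assms]
  show ?thesis
    unfolding borel_measurable_iff_less
  proof
    fix a
    show "{\<omega> \<in> space (info S). R_near p w i \<omega> < a} \<in> sets (info S)"
      unfolding R_near_less_iff by measurable
  qed
qed

lemma mark_sources_nonfading: "mark_sources i \<subseteq> nonfading"
  by (auto simp: mark_sources_def nonfading_def)

lemma measurable_assoc_nearest:
  assumes "nonfading \<subseteq> S" shows "Measurable.pred (info S) (assoc_nearest p w i)"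
proof -
  have "mark_sources i \<subseteq> S" using mark_sources_nonfading assms by blast
  note [measurable] = measurable_serves[OF assms] measurable_dist_nonfading[OF assms]
    measurable_Phi[OF this] measurable_R_near[OF this]
  have "assoc_nearest p w i = (\<lambda>\<omega>. \<exists>n. n \<in> Phi p w i \<omega> \<and>
      node_dist p w (Other (tier_of i) n) \<omega> = R_near p w i \<omega> \<and> serves p w (Other (tier_of i) n) \<omega>)"
    by (auto simp: assoc_nearest_def fun_eq_iff)
  then show ?thesis by (simp del: node_dist.simps)
qed

lemma measurable_interf_from:
  assumes "nonfading \<subseteq> S" "\<And>n. SFading (Other (tier_of j) n) j \<in> S"
  shows "interf_from p w j \<in> borel_measurable (info S)"
proof -
  have "mark_sources j \<subseteq> S" using mark_sources_nonfading assms by blast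
  note [measurable] = measurable_Phi[OF this] measurable_avg_nonfading[OF assms(1)]
    measurable_fading[OF assms(2)]
  have "interf_from p w j = (\<lambda>\<omega>. \<Sum>n. if n \<in> Phi p w j \<omega>
      then ennreal (node_avg p w (Other (tier_of j) n) \<omega> * fading w (Other (tier_of j) n) j \<omega>) else 0)"
    unfolding interf_from_def by (intro ext suminf_cong) (auto simp: received_def Phi_def)
  then show ?thesis by simp
qed

text \<open>The interference omits the whole process of type \<open>i\<close>, so the
  type-\<open>i\<close> gains of the nodes of this tier never enter; in particular that of the
  serving node does not.\<close>

lemma measurable_interf_nearest:
  "interf_nearest p w i \<in> borel_measurable (info (- {SFading (Other (tier_of i) n) i |n. True}))"
    (is "_ \<in> borel_measurable (info ?S)")
proof -
  have S: "nonfading \<subseteq> ?S" by (auto simp: nonfading_def)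
  have [measurable]: "fading w Central j \<in> borel_measurable (info ?S)" for j
    by (intro measurable_fading) auto
  note [measurable] = measurable_channel_nonfading[OF S] measurable_avg_nonfading[OF S]
  have [measurable]: "received p w Central \<in> borel_measurable (info ?S)"
    unfolding received_def[abs_def]
    by (rule measurable_compose_countable[where g="node_channel p w Central" and
          f="\<lambda>i \<omega>. node_avg p w Central \<omega> * fading w Central i \<omega>"]) measurable
  have "interf_from p w j \<in> borel_measurable (info ?S)" if "j \<noteq> i" for j
    using that by (intro measurable_interf_from S) auto
  then have "(\<lambda>\<omega>. \<Sum>j\<in>UNIV - {i}. interf_from p w j \<omega>) \<in> borel_measurable (info ?S)"
    by (intro borel_measurable_sum) auto
  moreover have "(\<lambda>\<omega>. ennreal (received p w Central \<omega>)) \<in> borel_measurable (info ?S)"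
    by measurable
  ultimately show ?thesis
    unfolding interf_nearest_def[abs_def] by (rule borel_measurable_add[rotated])
qed

lemma measurable_interf_central:
  "interf_central p w \<in> borel_measurable (info (- {SFading Central j |j. True}))"
    (is "_ \<in> borel_measurable (info ?S)")
proof -
  have "interf_from p w j \<in> borel_measurable (info ?S)" for j
    by (intro measurable_interf_from) (auto simp: nonfading_def)
  then show ?thesis
    unfolding interf_central_def[abs_def] by (intro borel_measurable_sum) auto
qed

end

section \<open>Laws of the distances\<close>

lemma set_lebesgue_integral_Icc_measurable[measurable (raw)]:
  fixes f :: "'a \<Rightarrow> real \<Rightarrow> real"
  assumes [measurable]: "(\<lambda>(x, y). f x y) \<in> borel_measurable (N \<Otimes>\<^sub>M borel)" "b \<in> borel_measurable N"
  shows "(\<lambda>x. LBINT u:{a..b x}. f x u) \<in> borel_measurable N"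
proof -
  have "(\<lambda>x. LBINT u:{a..b x}. f x u) = (\<lambda>x. LINT u|lborel. (if a \<le> u \<and> u \<le> b x then f x u else 0))"
    unfolding set_lebesgue_integral_def
    by (intro ext Bochner_Integration.integral_cong) (auto split: split_indicator)
  then show ?thesis by simp
qed

text \<open>In the proof, \<open>h\<close> is extended to the left of \<open>0\<close> to have two-sided derivatives.\<close>

lemma nn_integral_hazard_density:
  fixes h :: "real \<Rightarrow> real"
  assumes cont: "continuous_on {0..} h" and nonneg: "\<And>u. 0 \<le> u \<Longrightarrow> 0 \<le> h u" and x: "0 \<le> x"
  shows "(\<integral>\<^sup>+y. ennreal (h y * exp (- (LBINT u:{0..y}. h u))) * indicator {0..x} y \<partial>lborel) =
    ennreal (1 - exp (- (LBINT u:{0..x}. h u)))"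
proof -
  define H where "H u = h (max 0 u)" for u
  define G where "G z = integral {-1..z} H" for z
  let ?\<Lambda> = "\<lambda>y. LBINT u:{0..y}. H u"
  have contH: "continuous_on S H" for S
    unfolding H_def by (intro continuous_on_compose2[OF cont] continuous_intros) auto
  then have [measurable]: "H \<in> borel_measurable borel"
    by (intro borel_measurable_continuous_onI)
  have \<Lambda>: "?\<Lambda> y = G y - G 0" if "0 \<le> y" for y
  proof -
    have "set_integrable lborel {0..y} H"
      by (rule borel_integrable_atLeastAtMost'[OF contH])
    then have "?\<Lambda> y = integral {0..y} H"
      by (rule set_borel_integral_eq_integral(2))
    moreover have "G 0 + integral {0..y} H = G y"
      unfolding G_def using that by (intro Henstock_Kurzweil_Integration.integral_combine integrable_continuous_interval contH) auto
    ultimately show ?thesis by simp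
  qed
  have \<Lambda>h: "?\<Lambda> y = (LBINT u:{0..y}. h u)" for y
    by (intro set_lebesgue_integral_cong) (auto simp: H_def)
  have G: "(G has_real_derivative H y) (at y)" if "0 \<le> y" "y \<le> x" for y
  proof -
    have "(G has_real_derivative H y) (at y within {-1..x + 1})"
      unfolding G_def using that by (intro integral_has_real_derivative contH) auto
    moreover have "at y within {-1..x + 1} = at y"
      using that by (intro at_within_interior) (auto simp: interior_atLeastAtMost_real)
    ultimately show ?thesis by simp
  qed
  have "(\<integral>\<^sup>+y. ennreal (h y * exp (- (LBINT u:{0..y}. h u))) * indicator {0..x} y \<partial>lborel) =
      (\<integral>\<^sup>+y. ennreal (H y * exp (- ?\<Lambda> y)) * indicator {0..x} y \<partial>lborel)"
  proof (intro nn_integral_cong)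
    fix y
    have "H y = h y" if "0 \<le> y" using that by (simp add: H_def)
    then show "ennreal (h y * exp (- (LBINT u:{0..y}. h u))) * indicator {0..x} y =
        ennreal (H y * exp (- ?\<Lambda> y)) * indicator {0..x} y"
      unfolding \<Lambda>h by (auto split: split_indicator)
  qed
  also have "\<dots> = ennreal (- exp (- (G x - G 0)) - - exp (- (G 0 - G 0)))"
  proof (rule nn_integral_FTC_Icc)
    fix y assume y: "y \<in> {0..x}"
    then show "((\<lambda>y. - exp (- (G y - G 0))) has_real_derivative H y * exp (- ?\<Lambda> y)) (at y)"
      by (auto intro!: derivative_eq_intros G simp: \<Lambda>)
    show "0 \<le> H y * exp (- ?\<Lambda> y)" using nonneg by (simp add: H_def)
  qed (use x in measurable)
  finally show ?thesis using \<Lambda>[OF x] \<Lambda>h by simp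
qed

section \<open>Radial integration in the plane\<close>

lemma content_cball_real2: "r \<ge> 0 \<Longrightarrow> measure lborel (cball (c :: real ^ 2) r) = pi * r\<^sup>2"
  by (simp add: content_cball unit_ball_vol_2)

lemma emeasure_cball_real2: "r \<ge> 0 \<Longrightarrow> emeasure lborel (cball (c :: real ^ 2) r) = ennreal (pi * r\<^sup>2)"
  by (simp add: emeasure_cball unit_ball_vol_2)

text \<open>Polar coordinates for radial functions: the area \<open>pi * x\<^sup>2\<close> of discs
  is the distribution function of the norm, and its derivative \<open>2 * pi * x\<close> is the
  density.\<close>

lemma nn_integral_norm_cball_real2:
  assumes R: "0 \<le> R" and [measurable]: "f \<in> borel_measurable borel"
  shows "(\<integral>\<^sup>+x. f (norm x) * indicator (cball 0 R) (x :: real ^ 2) \<partial>lborel) =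
    (\<integral>\<^sup>+y. f y * (ennreal (2 * pi * y) * indicator {0..R} y) \<partial>lborel)"
proof -
  let ?N = "distr (with_density lborel (indicator (cball (0 :: real ^ 2) R))) borel norm"
  have emeasure_N: "emeasure ?N A = emeasure lborel (cball 0 R \<inter> norm -` A :: (real ^ 2) set)"
    if [measurable]: "A \<in> sets borel" for A
  proof -
    have A: "norm -` A \<in> sets (borel :: (real ^ 2) measure)"
      using measurable_sets[OF borel_measurable_norm, of A] by simp
    show ?thesis
    proof -
      have "emeasure ?N A = (\<integral>\<^sup>+x. indicator (cball 0 R) (x :: real ^ 2) * indicator (norm -` A) x \<partial>lborel)"
        using A by (subst emeasure_distr, simp, simp, subst emeasure_density)
          (auto intro!: borel_measurable_indicator)
      also have "\<dots> = (\<integral>\<^sup>+x. indicator (cball 0 R \<inter> norm -` A) (x :: real ^ 2) \<partial>lborel)"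
        by (simp add: indicator_inter_arith)
      finally show ?thesis using A by simp
    qed
  qed
  have "?N = with_density lborel (\<lambda>y. ennreal (2 * pi * y) * indicator {0..R} y)"
  proof (rule finite_measure_eq_density_atMost)
    show "finite_measure ?N"
      using R by (intro finite_measureI) (simp add: emeasure_N emeasure_cball_real2)
    fix x
    show "emeasure ?N {..x} = (\<integral>\<^sup>+y. ennreal (2 * pi * y) * indicator {0..R} y * indicator {..x} y \<partial>lborel)"
    proof (cases "0 \<le> x")
      case True
      have "cball 0 R \<inter> norm -` {..x} = (cball 0 (min x R) :: (real ^ 2) set)" by auto
      then have "emeasure ?N {..x} = ennreal (pi * (min x R)\<^sup>2)"
        using R True by (simp add: emeasure_N emeasure_cball_real2)
      also have "\<dots> = (\<integral>\<^sup>+y. ennreal (2 * pi * y) * indicator {0..min x R} y \<partial>lborel)"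
        using R True by (subst nn_integral_FTC_Icc[where F="\<lambda>y. pi * y\<^sup>2"])
          (auto intro!: derivative_eq_intros)
      also have "\<dots> = (\<integral>\<^sup>+y. ennreal (2 * pi * y) * indicator {0..R} y * indicator {..x} y \<partial>lborel)"
        by (intro nn_integral_cong) (auto split: split_indicator)
      finally show ?thesis .
    next
      case False
      have "norm -` {..x} = ({} :: (real ^ 2) set)"
        using False by (auto dest: order_trans[OF norm_ge_zero])
      moreover have "(\<integral>\<^sup>+y. ennreal (2 * pi * y) * indicator {0..R} y * indicator {..x} y \<partial>lborel) = (\<integral>\<^sup>+y. 0 \<partial>(lborel :: real measure))"
        using False by (intro nn_integral_cong) (auto split: split_indicator)
      ultimately show ?thesis by (simp add: emeasure_N)
    qed
  qed auto
  then have "(\<integral>\<^sup>+y. f y \<partial>?N) = (\<integral>\<^sup>+y. f y \<partial>with_density lborel (\<lambda>y. ennreal (2 * pi * y) * indicator {0..R} y))"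
    by simp
  moreover have "(\<integral>\<^sup>+x. f (norm x) \<partial>with_density lborel (indicator (cball (0 :: real ^ 2) R))) =
      (\<integral>\<^sup>+x. indicator (cball 0 R) (x :: real ^ 2) * f (norm x) \<partial>lborel)"
    by (rule nn_integral_density) (auto intro!: borel_measurable_indicator)
  ultimately show ?thesis
    by (simp add: nn_integral_distr nn_integral_density mult_ac)
qed

text \<open>This is \<open>r_c\<close> as a function of the center and the sequence of beam
  directors, kept as separate arguments so that the center can be frozen.\<close>

definition nearest_dist :: "'b::metric_space \<Rightarrow> (nat \<Rightarrow> 'b) \<Rightarrow> real" where
  "nearest_dist c y = dist c (y (LEAST n. \<forall>k. dist c (y n) \<le> dist c (y k)))"

text \<open>Local finiteness leaves finitely many candidates no farther than the point with index 0
  lies, so a nearest point exists and \<open>LEAST\<close> selects one.\<close>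

lemma nearest_dist_le_iff:
  assumes fin: "\<And>k::nat. finite {n. y n \<in> cball c (real k)}"
  shows "nearest_dist c y \<le> t \<longleftrightarrow> (\<exists>n. y n \<in> cball c t)"
proof -
  obtain k where k: "dist c (y 0) \<le> real k" using real_arch_simple by blast
  let ?Z = "{n. y n \<in> cball c (real k)}"
  have "0 \<in> ?Z" using k by simp
  then obtain n where n: "n \<in> ?Z" "\<And>m. m \<in> ?Z \<Longrightarrow> dist c (y n) \<le> dist c (y m)"
    using ex_is_arg_min_if_finite[OF fin[of k], of "\<lambda>n. dist c (y n)"]
    unfolding is_arg_min_linorder by blast
  have "\<forall>m. dist c (y n) \<le> dist c (y m)"
  proof
    fix m show "dist c (y n) \<le> dist c (y m)"
      using n by (cases "m \<in> ?Z") auto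
  qed
  then have "\<forall>m. nearest_dist c y \<le> dist c (y m)"
    unfolding nearest_dist_def by (rule LeastI)
  moreover have "\<exists>n. nearest_dist c y = dist c (y n)"
    unfolding nearest_dist_def by blast
  ultimately show ?thesis by (auto intro: order_trans)
qed

lemma measurable_nearest_dist[measurable]:
  "(\<lambda>(c, y). nearest_dist c y) \<in>
    borel_measurable (borel \<Otimes>\<^sub>M Pi\<^sub>M UNIV (\<lambda>_. borel :: 'b::{second_countable_topology,metric_space} measure))"
proof -
  have [measurable]: "(\<lambda>z. snd z n) \<in> borel_measurable ((borel :: 'b measure) \<Otimes>\<^sub>M Pi\<^sub>M UNIV (\<lambda>_. borel :: 'b measure))" for n :: nat
    by (rule measurable_compose[OF measurable_snd]) (simp add: measurable_component_singleton)
  show ?thesis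
    unfolding nearest_dist_def case_prod_beta
    by (rule measurable_compose_countable[where f="\<lambda>n z. dist (fst z) (snd z n)"]) measurable
qed

text \<open>The channel type with distance and mark as separate arguments, so that the mark can be
  integrated out at a frozen distance.\<close>

definition channel_at :: "params \<Rightarrow> tier \<Rightarrow> real \<Rightarrow> real \<Rightarrow> channel" where
  "channel_at p t d u = (if u \<le> los_prob p t d then los t else nlos t)"

text \<open>Being a measure, this lies between 0 and 1 for every \<open>d\<close>, whereas
  \<open>channel_prob\<close> is known to do so only for \<open>0 < d\<close>, where the two
  agree.\<close>

definition mark_prob :: "params \<Rightarrow> channel \<Rightarrow> real \<Rightarrow> real" where
  "mark_prob p i d = measure (uniform_measure lborel {0..1}) {u. channel_at p (tier_of i) d u = i}"

lemma mark_prob_bounds: "0 \<le> mark_prob p i d" "mark_prob p i d \<le> 1"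
  unfolding mark_prob_def
  by (auto intro!: prob_space.prob_le_1 prob_space_uniform_measure)

lemma channel_cases: "i = los (tier_of i) \<or> i = nlos (tier_of i)"
  by (cases i) auto

lemma los_neq_nlos: "los t \<noteq> nlos t"
  by (cases t) auto

lemma mark_prob_eq_channel_prob:
  assumes "valid_params p" "0 < d"
  shows "mark_prob p i d = channel_prob p i d"
proof -
  let ?t = "tier_of i"
  have l: "0 \<le> los_prob p ?t d" "los_prob p ?t d \<le> 1"
    using assms by (auto simp: valid_params_def)
  have m: "mark_prob p i d = measure lborel ({0..1} \<inter> {u. channel_at p ?t d u = i})"
    unfolding mark_prob_def by (subst measure_uniform_measure) (auto simp: channel_at_def)
  show ?thesis
  proof (cases "i = los ?t")
    case True
    then have "{0..1} \<inter> {u. channel_at p ?t d u = i} = {0..los_prob p ?t d}"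
      using los_neq_nlos[of ?t] l by (auto simp: channel_at_def split: if_splits)
    then show ?thesis using l True by (simp add: m channel_prob_def)
  next
    case False
    then have "i = nlos ?t" using channel_cases by blast
    then have "{0..1} \<inter> {u. channel_at p ?t d u = i} = {los_prob p ?t d<..1}"
      using los_neq_nlos[of ?t] l by (auto simp: channel_at_def split: if_splits)
    then show ?thesis using l False by (simp add: m channel_prob_def)
  qed
qed

context uav_network
begin

lemma channel_prob_bounds: "0 < d \<Longrightarrow> 0 \<le> channel_prob p i d \<and> channel_prob p i d \<le> 1"
  using mark_prob_bounds[of p i d] mark_prob_eq_channel_prob[OF valid, of d i] by simp

lemma node_channel_eq: "node_channel p w v \<omega> = channel_at p (node_tier v) (node_dist p w v \<omega>) (los_mark w v \<omega>)"
  by (simp add: node_channel_def channel_at_def)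

lemma measurable_channel_at[measurable]:
  "(\<lambda>(d, u). channel_at p t d u) \<in> borel \<Otimes>\<^sub>M borel \<rightarrow>\<^sub>M count_space UNIV"
  unfolding channel_at_def by measurable

lemma nn_integral_los_mark:
  "(\<integral>\<^sup>+\<omega>. (if channel_at p (tier_of i) d (los_mark w v \<omega>) = i then a else b) \<partial>sample w) =
    a * ennreal (mark_prob p i d) + b * ennreal (1 - mark_prob p i d)"
proof -
  let ?U = "uniform_measure lborel {0..1::real}"
  have d: "distr (sample w) borel (los_mark w v) = ?U" and [measurable]: "los_mark w v \<in> borel_measurable (sample w)"
    using model by (auto simp: network_model_def)
  interpret U: prob_space ?U by (intro prob_space_uniform_measure) auto
  have [measurable]: "{u. channel_at p (tier_of i) d u = i} \<in> sets borel"
    by measurable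
  have "(\<integral>\<^sup>+\<omega>. (if channel_at p (tier_of i) d (los_mark w v \<omega>) = i then a else b) \<partial>sample w) =
      (\<integral>\<^sup>+u. (if channel_at p (tier_of i) d u = i then a else b) \<partial>distr (sample w) borel (los_mark w v))"
    by (subst nn_integral_distr) auto
  also have "\<dots> = (\<integral>\<^sup>+u. a * indicator {u. channel_at p (tier_of i) d u = i} u +
      b * indicator (UNIV - {u. channel_at p (tier_of i) d u = i}) u \<partial>?U)"
    unfolding d by (intro nn_integral_cong) (auto split: split_indicator)
  also have "\<dots> = a * emeasure ?U {u. channel_at p (tier_of i) d u = i} +
      b * emeasure ?U (UNIV - {u. channel_at p (tier_of i) d u = i})"
    by (subst nn_integral_add) (auto simp: nn_integral_cmult)
  also have "\<dots> = a * ennreal (mark_prob p i d) + b * ennreal (1 - mark_prob p i d)"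
    using U.prob_compl[of "{u. channel_at p (tier_of i) d u = i}"]
    by (simp add: U.emeasure_eq_measure mark_prob_def)
  finally show ?thesis .
qed

lemma measurable_mark_prob[measurable]: "mark_prob p i \<in> borel_measurable borel"
proof -
  interpret U: prob_space "uniform_measure lborel {0..1::real}" by (intro prob_space_uniform_measure) auto
  have "(\<lambda>d. emeasure (uniform_measure lborel {0..1::real}) {u. channel_at p (tier_of i) d u = i}) \<in> borel_measurable borel"
    by (rule U.measurable_emeasure[where N=borel]) measurable
  then show ?thesis unfolding mark_prob_def measure_def by measurable
qed

section \<open>The distance from the cluster center to its nearest laser beam director\<close>

lemma dens_c_nonneg: "0 \<le> t \<Longrightarrow> 0 \<le> dens_c p t"
  using valid by (simp add: dens_c_def valid_params_def)

lemma measurable_dens_c[measurable]: "dens_c p \<in> borel_measurable borel"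
  unfolding dens_c_def[abs_def] by measurable

lemma nn_integral_dens_c:
  assumes "0 \<le> t"
  shows "(\<integral>\<^sup>+u. ennreal (dens_c p u) * indicator {0..t} u \<partial>lborel) = ennreal (1 - exp (- density_lbd p * pi * t\<^sup>2))"
proof -
  have "(\<integral>\<^sup>+u. ennreal (dens_c p u) * indicator {0..t} u \<partial>lborel) =
      ennreal (- exp (- pi * density_lbd p * t\<^sup>2) - - exp (- pi * density_lbd p * 0\<^sup>2))"
  proof (rule nn_integral_FTC_Icc)
    fix u assume "u \<in> {0..t}"
    then show "0 \<le> dens_c p u" by (intro dens_c_nonneg) simp
    show "((\<lambda>u. - exp (- pi * density_lbd p * u\<^sup>2)) has_real_derivative dens_c p u) (at u)"
      by (auto intro!: derivative_eq_intros simp: dens_c_def)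
  qed (use assms in auto)
  then show ?thesis by (simp add: mult_ac)
qed

text \<open>A nearest distance exceeding \<open>x\<close> is a void event for the disc around
  \<open>c\<close>. The area of the disc does not depend on \<open>c\<close>, hence neither does the
  law.\<close>

lemma distr_nearest_lbd_dist:
  "distr (sample w) borel (\<lambda>\<omega>. nearest_dist c (\<lambda>n. lbd w n \<omega>)) =
    with_density lborel (\<lambda>t. ennreal (dens_c p t) * indicator {0..} t)"
proof (rule finite_measure_eq_density_atMost)
  have ppp: "homogeneous_ppp (sample w) (density_lbd p) (lbd w)"
    using model by (simp add: network_model_def)
  note [measurable] = measurable_info_sample[OF measurable_lbd_sequence[of UNIV, simplified]]
  have [measurable]: "\<And>n. lbd w n \<in> borel_measurable (sample w)"
    using ppp by (simp add: homogeneous_ppp_def)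
  have [measurable]: "(\<lambda>\<omega>. nearest_dist c (\<lambda>n. lbd w n \<omega>)) \<in> borel_measurable (sample w)"
    using measurable_compose[OF measurable_Pair[OF measurable_const[of c borel] \<open>(\<lambda>\<omega> n. lbd w n \<omega>) \<in> _\<close>]
        measurable_nearest_dist] by simp
  show "finite_measure (distr (sample w) borel (\<lambda>\<omega>. nearest_dist c (\<lambda>n. lbd w n \<omega>)))"
    by (intro finite_measure_distr) simp
  fix x
  have "AE \<omega> in sample w. \<forall>k::nat. finite {n. lbd w n \<omega> \<in> cball c (real k)}"
    unfolding AE_all_countable by (intro allI homogeneous_ppp_finite[OF ppp]) auto
  then have AE: "AE \<omega> in sample w. nearest_dist c (\<lambda>n. lbd w n \<omega>) \<le> x \<longleftrightarrow> (\<exists>n. lbd w n \<omega> \<in> cball c x)"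
    by eventually_elim (simp only: nearest_dist_le_iff)
  have "emeasure (distr (sample w) borel (\<lambda>\<omega>. nearest_dist c (\<lambda>n. lbd w n \<omega>))) {..x} =
      emeasure (sample w) {\<omega>\<in>space (sample w). nearest_dist c (\<lambda>n. lbd w n \<omega>) \<le> x}"
    by (subst emeasure_distr) (auto intro!: arg_cong[where f="emeasure (sample w)"])
  also have "\<dots> = emeasure (sample w) (space (sample w) - {\<omega>\<in>space (sample w). \<forall>n. lbd w n \<omega> \<notin> cball c x})"
    using AE by (intro emeasure_eq_AE) auto
  also have "\<dots> = ennreal (1 - prob {\<omega>\<in>space (sample w). \<forall>n. lbd w n \<omega> \<notin> cball c x})"
    by (subst emeasure_eq_measure, subst prob_compl) auto
  also have "\<dots> = ennreal (1 - exp (- (density_lbd p * measure lborel (cball c x))))"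
    by (subst homogeneous_ppp_void[OF ppp]) auto
  also have "\<dots> = (\<integral>\<^sup>+y. ennreal (dens_c p y) * indicator {0..} y * indicator {..x} y \<partial>lborel)"
  proof (cases "0 \<le> x")
    case True
    have "(\<integral>\<^sup>+y. ennreal (dens_c p y) * indicator {0..} y * indicator {..x} y \<partial>lborel) =
        (\<integral>\<^sup>+y. ennreal (dens_c p y) * indicator {0..x} y \<partial>lborel)"
      by (intro nn_integral_cong) (auto split: split_indicator)
    then show ?thesis
      using True by (simp add: nn_integral_dens_c content_cball_real2 mult_ac)
  next
    case False
    then have "(\<integral>\<^sup>+y. ennreal (dens_c p y) * indicator {0..} y * indicator {..x} y \<partial>lborel) =
        (\<integral>\<^sup>+y. 0 \<partial>(lborel :: real measure))"
      by (intro nn_integral_cong) (auto split: split_indicator)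
    with False show ?thesis by simp
  qed
  finally show "emeasure (distr (sample w) borel (\<lambda>\<omega>. nearest_dist c (\<lambda>n. lbd w n \<omega>))) {..x} =
      (\<integral>\<^sup>+y. ennreal (dens_c p y) * indicator {0..} y * indicator {..x} y \<partial>lborel)" .
qed auto

lemma nn_integral_center_r_c:
  assumes [measurable]: "(\<lambda>(x, t). f x t) \<in> borel_measurable (borel \<Otimes>\<^sub>M borel)"
  shows "(\<integral>\<^sup>+\<omega>. f (center w \<omega>) (r_c w \<omega>) \<partial>sample w) =
    (\<integral>\<^sup>+\<omega>. (\<integral>\<^sup>+t. f (center w \<omega>) t * (ennreal (dens_c p t) * indicator {0..} t) \<partial>lborel) \<partial>sample w)"
proof -
  note seq[measurable] = measurable_info_sample[OF measurable_lbd_sequence[of UNIV, simplified]]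
  have "(\<integral>\<^sup>+\<omega>. f (center w \<omega>) (r_c w \<omega>) \<partial>sample w) =
      (\<integral>\<^sup>+\<omega>. f (center w \<omega>) (nearest_dist (center w \<omega>) (\<lambda>n. lbd w n \<omega>)) \<partial>sample w)"
    by (simp add: r_c_def nearest_lbd_def nearest_dist_def)
  also have "\<dots> = (\<integral>\<^sup>+\<omega>. (\<integral>\<^sup>+\<omega>'. f (center w \<omega>) (nearest_dist (center w \<omega>) (\<lambda>n. lbd w n \<omega>')) \<partial>sample w) \<partial>sample w)"
    by (rule nn_integral_indep[OF _ measurable_center[of "{SCenter}"] measurable_lbd_sequence[of "{SLbd}"],
          where f="\<lambda>c y. f c (nearest_dist c y)"]) auto
  also have "\<dots> = (\<integral>\<^sup>+\<omega>. (\<integral>\<^sup>+t. f (center w \<omega>) t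
      \<partial>distr (sample w) borel (\<lambda>\<omega>'. nearest_dist (center w \<omega>) (\<lambda>n. lbd w n \<omega>'))) \<partial>sample w)"
  proof (intro nn_integral_cong)
    fix \<omega>
    have [measurable]: "(\<lambda>\<omega>'. nearest_dist (center w \<omega>) (\<lambda>n. lbd w n \<omega>')) \<in> borel_measurable (sample w)"
      using measurable_compose[OF measurable_Pair[OF measurable_const[of "center w \<omega>" borel] seq]
          measurable_nearest_dist] by simp
    show "(\<integral>\<^sup>+\<omega>'. f (center w \<omega>) (nearest_dist (center w \<omega>) (\<lambda>n. lbd w n \<omega>')) \<partial>sample w) =
        (\<integral>\<^sup>+t. f (center w \<omega>) t \<partial>distr (sample w) borel (\<lambda>\<omega>'. nearest_dist (center w \<omega>) (\<lambda>n. lbd w n \<omega>')))"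
      by (subst nn_integral_distr) auto
  qed
  also have "\<dots> = (\<integral>\<^sup>+\<omega>. (\<integral>\<^sup>+t. f (center w \<omega>) t * (ennreal (dens_c p t) * indicator {0..} t) \<partial>lborel) \<partial>sample w)"
    \<comment> \<open>The inner law is the same for every center, so \<open>r_c\<close> is
      independent of the center although it is computed from it.\<close>
    unfolding distr_nearest_lbd_dist by (simp add: nn_integral_density mult_ac)
  finally show ?thesis .
qed

lemma nn_integral_r_c:
  assumes [measurable]: "f \<in> borel_measurable borel"
  shows "(\<integral>\<^sup>+\<omega>. f (r_c w \<omega>) \<partial>sample w) = (\<integral>\<^sup>+t. f t * (ennreal (dens_c p t) * indicator {0..} t) \<partial>lborel)"
  using nn_integral_center_r_c[of "\<lambda>_. f"] by (simp add: emeasure_space_1)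

lemma nn_integral_norm_center:
  assumes [measurable]: "f \<in> borel_measurable borel"
  shows "(\<integral>\<^sup>+\<omega>. f (norm (center w \<omega>)) \<partial>sample w) = (\<integral>\<^sup>+y. f y * ennreal (dens_cu_within p y) \<partial>lborel)"
proof -
  have R: "0 < r_max p" using valid by (simp add: valid_params_def)
  have [measurable]: "center w \<in> borel_measurable (sample w)"
    and d: "distr (sample w) borel (center w) = uniform_measure lborel (cball 0 (r_max p))"
    using model by (auto simp: network_model_def)
  have "(\<integral>\<^sup>+\<omega>. f (norm (center w \<omega>)) \<partial>sample w) = (\<integral>\<^sup>+x. f (norm x) \<partial>uniform_measure lborel (cball (0 :: real ^ 2) (r_max p)))"
    unfolding d[symmetric] by (subst nn_integral_distr) auto
  also have "\<dots> = (\<integral>\<^sup>+x. f (norm x) * indicator (cball (0 :: real ^ 2) (r_max p)) x \<partial>lborel) / ennreal (pi * (r_max p)\<^sup>2)"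
    using R by (subst nn_integral_uniform_measure) (auto simp: emeasure_cball_real2)
  also have "\<dots> = (\<integral>\<^sup>+y. f y * (ennreal (2 * pi * y) * indicator {0..r_max p} y) \<partial>lborel) / ennreal (pi * (r_max p)\<^sup>2)"
    using R by (subst nn_integral_norm_cball_real2) auto
  also have "\<dots> = (\<integral>\<^sup>+y. f y * (ennreal (2 * pi * y) * indicator {0..r_max p} y) / ennreal (pi * (r_max p)\<^sup>2) \<partial>lborel)"
    by (subst nn_integral_divide) auto
  also have "\<dots> = (\<integral>\<^sup>+y. f y * ennreal (dens_cu_within p y) \<partial>lborel)"
  proof (intro nn_integral_cong)
    fix y
    show "f y * (ennreal (2 * pi * y) * indicator {0..r_max p} y) / ennreal (pi * (r_max p)\<^sup>2) =
        f y * ennreal (dens_cu_within p y)"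
    proof (cases "y \<in> {0..r_max p}")
      case True
      then have "ennreal (2 * pi * y) / ennreal (pi * (r_max p)\<^sup>2) = ennreal (2 * y / (r_max p)\<^sup>2)"
        using R by (simp add: divide_ennreal)
      then show ?thesis using True by (simp add: dens_cu_within_def ennreal_times_divide[symmetric])
    qed (simp add: dens_cu_within_def)
  qed
  finally show ?thesis .
qed


text \<open>The conditional probability, given its position \<open>x\<close>, that a point is not a
  point of \<open>Phi p w i\<close> within distance \<open>r\<close>.\<close>

abbreviation thin :: "channel \<Rightarrow> real \<Rightarrow> real ^ 2 \<Rightarrow> real" where
  "thin i r x \<equiv> (if norm x \<le> r then 1 - mark_prob p i (norm x) else 1)"

lemma in_Phi_iff: "n \<in> Phi p w i \<omega> \<longleftrightarrow>
    channel_at p (tier_of i) (norm (pts w (tier_of i) n \<omega>)) (los_mark w (Other (tier_of i) n) \<omega>) = i"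
  by (simp add: Phi_def node_channel_eq)

text \<open>The marks are integrated out one at a time; \<open>H\<close> carries the factors already replaced.\<close>

lemma nn_integral_thinning:
  assumes "H \<in> borel_measurable (info (- {SMark (Other (tier_of i) n) |n. True}))"
  shows "(\<integral>\<^sup>+\<omega>. H \<omega> * (\<Prod>n<N. if n \<in> Phi p w i \<omega> \<and> norm (pts w (tier_of i) n \<omega>) \<le> r then 0 else 1) \<partial>sample w) =
    (\<integral>\<^sup>+\<omega>. H \<omega> * (\<Prod>n<N. ennreal (thin i r (pts w (tier_of i) n \<omega>))) \<partial>sample w)"
  using assms
proof (induction N arbitrary: H)
  case (Suc N)
  let ?t = "tier_of i"
  \<comment> \<open>Only the mark of the last point is split off here: the marks with smaller index
    still occur in \<open>?Z\<close> and must remain among the sources.\<close>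
  let ?S = "- {SMark (Other ?t N)}"
  let ?z = "\<lambda>n \<omega>. if n \<in> Phi p w i \<omega> \<and> norm (pts w ?t n \<omega>) \<le> r then 0 else 1 :: ennreal"
  let ?f = "\<lambda>(a, x) u. a * (if channel_at p ?t (norm x) u = i then if norm x \<le> r then 0 else 1 else 1 :: ennreal)"
  let ?Z = "\<lambda>\<omega>. H \<omega> * (\<Prod>n<N. ?z n \<omega>)"
  have pts[measurable]: "\<And>n. pts w ?t n \<in> borel_measurable (info ?S)"
    by (intro measurable_pts) simp
  have H[measurable]: "H \<in> borel_measurable (info ?S)"
    by (rule measurable_info_mono[OF Suc.prems]) auto
  have [measurable]: "?z n \<in> borel_measurable (info ?S)" if "n < N" for n
  proof -
    have [measurable]: "los_mark w (Other ?t n) \<in> borel_measurable (info ?S)"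
      using that by (intro measurable_los_mark) simp
    show ?thesis unfolding in_Phi_iff by measurable
  qed
  have Z: "?Z \<in> borel_measurable (info ?S)"
    by (intro borel_measurable_times_ennreal H borel_measurable_prod_ennreal) auto
  have f: "(\<lambda>(z, u). ?f z u) \<in> borel_measurable ((borel \<Otimes>\<^sub>M borel) \<Otimes>\<^sub>M borel)"
    unfolding case_prod_beta by measurable
  have "(\<integral>\<^sup>+\<omega>. H \<omega> * (\<Prod>n<Suc N. ?z n \<omega>) \<partial>sample w) =
      (\<integral>\<^sup>+\<omega>. ?f (?Z \<omega>, pts w ?t N \<omega>) (los_mark w (Other ?t N) \<omega>) \<partial>sample w)"
    by (intro nn_integral_cong) (auto simp: in_Phi_iff mult.assoc)
  also have "\<dots> = (\<integral>\<^sup>+\<omega>. (\<integral>\<^sup>+\<omega>'. ?f (?Z \<omega>, pts w ?t N \<omega>) (los_mark w (Other ?t N) \<omega>') \<partial>sample w) \<partial>sample w)"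
    by (rule nn_integral_indep[OF _ measurable_Pair[OF Z pts] measurable_los_mark f, of "{SMark (Other ?t N)}"]) auto
  also have "\<dots> = (\<integral>\<^sup>+\<omega>. (H \<omega> * ennreal (thin i r (pts w ?t N \<omega>))) * (\<Prod>n<N. ?z n \<omega>) \<partial>sample w)"
  proof (intro nn_integral_cong)
    fix \<omega>
    let ?x = "pts w ?t N \<omega>"
    have "(\<integral>\<^sup>+\<omega>'. ?f (?Z \<omega>, ?x) (los_mark w (Other ?t N) \<omega>') \<partial>sample w) =
        (\<integral>\<^sup>+\<omega>'. (if channel_at p ?t (norm ?x) (los_mark w (Other ?t N) \<omega>') = i
            then ?Z \<omega> * (if norm ?x \<le> r then 0 else 1) else ?Z \<omega>) \<partial>sample w)"
      by (intro nn_integral_cong) auto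
    also have "\<dots> = ?Z \<omega> * (if norm ?x \<le> r then 0 else 1) * ennreal (mark_prob p i (norm ?x)) +
        ?Z \<omega> * ennreal (1 - mark_prob p i (norm ?x))"
      by (rule nn_integral_los_mark)
    also have "\<dots> = ?Z \<omega> * ennreal (thin i r ?x)"
      using mark_prob_bounds[of p i "norm ?x"]
      by (auto simp: distrib_left[symmetric] ennreal_plus[symmetric] simp del: ennreal_plus)
    finally show "(\<integral>\<^sup>+\<omega>'. ?f (?Z \<omega>, ?x) (los_mark w (Other ?t N) \<omega>') \<partial>sample w) =
        (H \<omega> * ennreal (thin i r ?x)) * (\<Prod>n<N. ?z n \<omega>)"
      by (simp add: mult_ac)
  qed
  also have "\<dots> = (\<integral>\<^sup>+\<omega>. (H \<omega> * ennreal (thin i r (pts w ?t N \<omega>))) *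
      (\<Prod>n<N. ennreal (thin i r (pts w ?t n \<omega>))) \<partial>sample w)"
  proof (rule Suc.IH)
    have [measurable]: "pts w ?t N \<in> borel_measurable (info (- {SMark (Other ?t n) |n. True}))"
      by (intro measurable_pts) simp
    note [measurable] = Suc.prems
    show "(\<lambda>\<omega>. H \<omega> * ennreal (thin i r (pts w ?t N \<omega>))) \<in>
        borel_measurable (info (- {SMark (Other ?t n) |n. True}))"
      by measurable
  qed
  also have "\<dots> = (\<integral>\<^sup>+\<omega>. H \<omega> * (\<Prod>n<Suc N. ennreal (thin i r (pts w ?t n \<omega>))) \<partial>sample w)"
    by (simp add: mult_ac)
  finally show ?case .
qed simp

text \<open>The intensity of the distances of the points of \<Phi>_i. With it, \<open>dens_R\<close>
  becomes a first-arrival density: the rate times the probability of no earlier arrival.\<close>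

definition hazard :: "channel \<Rightarrow> real \<Rightarrow> real" where
  "hazard i u = 2 * pi * channel_density p i u * u"

lemma dens_R_eq: "dens_R p i r = hazard i r * exp (- (LBINT u:{0..r}. hazard i u))"
proof -
  have "(LBINT u:{0..r}. hazard i u) = (LBINT u:{0..r}. (2 * pi) * (channel_density p i u * u))"
    by (simp add: hazard_def mult.assoc)
  also have "\<dots> = 2 * pi * (LBINT u:{0..r}. channel_density p i u * u)"
    by (rule set_integral_mult_right)
  finally show ?thesis by (simp add: dens_R_def hazard_def mult_ac)
qed

lemma hazard_nonneg: "0 \<le> u \<Longrightarrow> 0 \<le> hazard i u"
  using channel_prob_bounds[of u i] valid
  by (cases "u = 0") (auto simp: hazard_def channel_density_def valid_params_def less_imp_le)

text \<open>Away from 0 all ingredients are continuous. At 0 the convention for division by zero may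
  make \<open>los_prob\<close> jump, but the factor \<open>u\<close> squeezes the product between 0
  and a multiple of \<open>u\<close>.\<close>

lemma continuous_on_hazard: "continuous_on {0..} (hazard i)"
proof -
  have los: "continuous_on {0<..} (los_prob p t)" for t
    unfolding los_prob_def[abs_def] by (intro continuous_intros) auto
  have chan: "continuous_on {0<..} (channel_prob p i)"
    unfolding channel_prob_def[abs_def]
    by (cases "i = los (tier_of i)") (auto intro!: continuous_intros los)
  have "continuous (at x within {0..}) (hazard i)" if "0 \<le> x" for x
  proof (cases "x = 0")
    case True
    let ?C = "2 * pi * params.density p (tier_of i)"
    have "((\<lambda>u. hazard i u) \<longlongrightarrow> 0) (at 0 within {0..})"
    proof (rule tendsto_sandwich[where f="\<lambda>_. 0" and h="\<lambda>u. ?C * u"])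
      show "\<forall>\<^sub>F u in at 0 within {0..}. 0 \<le> hazard i u"
        by (auto simp: eventually_at_filter hazard_nonneg)
      show "\<forall>\<^sub>F u in at 0 within {0..}. hazard i u \<le> ?C * u"
      proof (unfold eventually_at_filter, rule always_eventually, intro allI impI)
        fix u :: real assume "u \<noteq> 0" "u \<in> {0..}"
        then have "channel_prob p i u \<le> 1" "0 < u" using channel_prob_bounds[of u i] by auto
        moreover have "0 < params.density p (tier_of i)" using valid by (simp add: valid_params_def)
        ultimately show "hazard i u \<le> ?C * u"
          by (simp add: hazard_def channel_density_def mult_left_le)
      qed
      have "((\<lambda>u. ?C * u) \<longlongrightarrow> ?C * 0) (at 0 within {0..})" by (intro tendsto_intros)
      then show "((\<lambda>u. ?C * u) \<longlongrightarrow> 0) (at 0 within {0..})" by simp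
    qed simp
    moreover have "hazard i 0 = 0" by (simp add: hazard_def)
    ultimately show ?thesis using True by (simp add: continuous_within)
  next
    case False
    with that have x: "x \<in> {0<..}" by simp
    have "continuous_on {0<..} (hazard i)"
      unfolding hazard_def[abs_def] channel_density_def by (intro continuous_intros chan)
    then have "isCont (hazard i) x"
      using x by (simp add: continuous_on_eq_continuous_at)
    then show ?thesis by (rule continuous_at_imp_continuous_at_within)
  qed
  then show ?thesis by (simp add: continuous_on_eq_continuous_within)
qed

lemma measurable_hazard[measurable]: "hazard i \<in> borel_measurable borel"
  unfolding hazard_def[abs_def] channel_density_def by measurable

lemma measurable_dens_R[measurable]: "dens_R p i \<in> borel_measurable borel"
  unfolding dens_R_eq[abs_def] by measurable

lemma dens_R_nonneg: "0 \<le> r \<Longrightarrow> 0 \<le> dens_R p i r"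
  by (simp add: dens_R_eq hazard_nonneg)

text \<open>Polar coordinates turn the exponent of the generating functional into the cumulative
  hazard. Radius 0, where \<open>mark_prob\<close> and \<open>channel_prob\<close> may differ, is
  cancelled by the factor \<open>u\<close>.\<close>

lemma integral_thin:
  assumes r: "0 \<le> r"
  shows "params.density p (tier_of i) * (LINT x|lborel. 1 - thin i r x) = (LBINT u:{0..r}. hazard i u)"
proof -
  let ?d = "params.density p (tier_of i)"
  have d: "0 < ?d" using valid by (simp add: valid_params_def)
  have eq: "(\<integral>\<^sup>+x. ennreal (?d * (1 - thin i r x)) \<partial>lborel) =
      (\<integral>\<^sup>+u. ennreal (indicator {0..r} u * hazard i u) \<partial>lborel)"
  proof -
    have "(\<integral>\<^sup>+x. ennreal (?d * (1 - thin i r x)) \<partial>lborel) =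
        (\<integral>\<^sup>+x. ennreal (?d * mark_prob p i (norm x)) * indicator (cball 0 r) (x :: real ^ 2) \<partial>lborel)"
      by (intro nn_integral_cong) (auto split: split_indicator)
    also have "\<dots> = (\<integral>\<^sup>+u. ennreal (?d * mark_prob p i u) * (ennreal (2 * pi * u) * indicator {0..r} u) \<partial>lborel)"
      by (rule nn_integral_norm_cball_real2[OF r]) measurable
    also have "\<dots> = (\<integral>\<^sup>+u. ennreal (indicator {0..r} u * hazard i u) \<partial>lborel)"
    proof (intro nn_integral_cong)
      fix u :: real
      show "ennreal (?d * mark_prob p i u) * (ennreal (2 * pi * u) * indicator {0..r} u) =
          ennreal (indicator {0..r} u * hazard i u)"
      proof (cases "0 < u")
        case True
        then show ?thesis
          using d mark_prob_bounds[of p i u]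
          by (simp add: hazard_def channel_density_def mark_prob_eq_channel_prob[OF valid] ennreal_mult[symmetric] mult_ac
              split: split_indicator)
      qed (auto simp: hazard_def split: split_indicator)
    qed
    finally show ?thesis .
  qed
  have [measurable]: "thin i r \<in> borel_measurable borel" by measurable
  have "?d * (LINT x|lborel. 1 - thin i r x) = (LINT x|lborel. ?d * (1 - thin i r x))"
    by simp
  also have "\<dots> = enn2real (\<integral>\<^sup>+x. ennreal (?d * (1 - thin i r x)) \<partial>lborel)"
    using d mark_prob_bounds[of p i] by (intro integral_eq_nn_integral) auto
  also have "\<dots> = (LINT u|lborel. indicator {0..r} u * hazard i u)"
    unfolding eq by (intro integral_eq_nn_integral[symmetric]) (auto simp: hazard_nonneg split: split_indicator)
  finally show ?thesis by (simp add: set_lebesgue_integral_def)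
qed

text \<open>For the first \<open>N\<close> points the void probability is the expected product of
  the \<open>thin\<close> factors. As \<open>N\<close> grows, the generating functional gives the
  limit of these expectations, and continuity from above gives that of the void
  probabilities.\<close>

lemma prob_no_Phi_within:
  assumes r: "0 \<le> r"
  shows "prob {\<omega>\<in>space (sample w). \<forall>n. n \<in> Phi p w i \<omega> \<longrightarrow> \<not> norm (pts w (tier_of i) n \<omega>) \<le> r} =
    exp (- (LBINT u:{0..r}. hazard i u))"
proof -
  let ?t = "tier_of i"
  let ?V = "\<lambda>N. {\<omega>\<in>space (sample w). \<forall>n<N. n \<in> Phi p w i \<omega> \<longrightarrow> \<not> norm (pts w ?t n \<omega>) \<le> r}"
  have ppp: "homogeneous_ppp (sample w) (params.density p ?t) (pts w ?t)"
    using model by (simp add: network_model_def)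
  note [measurable] = measurable_info_sample[OF measurable_Phi[of i UNIV, simplified]]
    measurable_info_sample[OF measurable_pts[of _ UNIV, simplified]]
  have V[measurable]: "?V N \<in> events" for N by measurable
  have "prob (?V N) = expectation (\<lambda>\<omega>. \<Prod>n<N. thin i r (pts w ?t n \<omega>))" for N
  proof -
    have "ennreal (prob (?V N)) = (\<integral>\<^sup>+\<omega>. indicator (?V N) \<omega> \<partial>sample w)"
      by (simp add: emeasure_eq_measure)
    also have "\<dots> = (\<integral>\<^sup>+\<omega>. 1 * (\<Prod>n<N. if n \<in> Phi p w i \<omega> \<and> norm (pts w ?t n \<omega>) \<le> r then 0 else 1) \<partial>sample w)"
    proof (intro nn_integral_cong)
      fix \<omega> assume \<omega>: "\<omega> \<in> space (sample w)"
      let ?z = "\<lambda>n. if n \<in> Phi p w i \<omega> \<and> norm (pts w ?t n \<omega>) \<le> r then 0 else 1 :: ennreal"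
      show "indicator (?V N) \<omega> = 1 * (\<Prod>n<N. ?z n)"
      proof (cases "\<omega> \<in> ?V N")
        case True
        then have "(\<Prod>n<N. ?z n) = 1" by (intro prod.neutral) auto
        with True show ?thesis by simp
      next
        case False
        then have "(\<Prod>n<N. ?z n) = 0" using \<omega> by (intro prod_zero) auto
        with False show ?thesis by simp
      qed
    qed
    also have "\<dots> = (\<integral>\<^sup>+\<omega>. 1 * (\<Prod>n<N. ennreal (thin i r (pts w ?t n \<omega>))) \<partial>sample w)"
      by (rule nn_integral_thinning) simp
    also have "\<dots> = (\<integral>\<^sup>+\<omega>. ennreal (\<Prod>n<N. thin i r (pts w ?t n \<omega>)) \<partial>sample w)"
      using mark_prob_bounds[of p i] by (simp add: prod_ennreal)
    also have "enn2real \<dots> = expectation (\<lambda>\<omega>. \<Prod>n<N. thin i r (pts w ?t n \<omega>))"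
      using mark_prob_bounds[of p i] by (intro integral_eq_nn_integral[symmetric]) (auto intro!: prod_nonneg)
    finally show ?thesis by simp
  qed
  moreover have "(\<lambda>N. expectation (\<lambda>\<omega>. \<Prod>n<N. thin i r (pts w ?t n \<omega>))) \<longlonglongrightarrow>
      exp (- (params.density p ?t * (LINT x|lborel. 1 - thin i r x)))"
    using mark_prob_bounds[of p i]
    by (intro homogeneous_ppp_generating_functional[OF ppp, where B="cball 0 r"]) auto
  ultimately have "(\<lambda>N. prob (?V N)) \<longlonglongrightarrow> exp (- (LBINT u:{0..r}. hazard i u))"
    by (simp only: integral_thin[OF r])
  moreover have "(\<lambda>N. prob (?V N)) \<longlonglongrightarrow> prob (\<Inter>N. ?V N)"
    using V by (intro finite_Lim_measure_decseq) (auto simp: decseq_def)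
  ultimately have "prob (\<Inter>N. ?V N) = exp (- (LBINT u:{0..r}. hazard i u))"
    using LIMSEQ_unique by blast
  moreover have "(\<Inter>N. ?V N) =
      {\<omega>\<in>space (sample w). \<forall>n. n \<in> Phi p w i \<omega> \<longrightarrow> \<not> norm (pts w ?t n \<omega>) \<le> r}"
    by auto
  ultimately show ?thesis by simp
qed

text \<open>Local finiteness makes the infimum attained, which the weak inequality requires, in
  contrast to \<open>R_near_less_iff\<close>.\<close>

lemma R_near_le_iff:
  assumes fin: "\<And>k::nat. finite {n. pts w (tier_of i) n \<omega> \<in> cball 0 (real k)}" and ne: "Phi p w i \<omega> \<noteq> {}"
  shows "R_near p w i \<omega> \<le> x \<longleftrightarrow> (\<exists>n. n \<in> Phi p w i \<omega> \<and> norm (pts w (tier_of i) n \<omega>) \<le> x)"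
proof -
  let ?d = "\<lambda>n. norm (pts w (tier_of i) n \<omega>)"
  obtain m where m: "m \<in> Phi p w i \<omega>" using ne by blast
  obtain k where k: "?d m \<le> real k" using real_arch_simple by blast
  let ?Z = "Phi p w i \<omega> \<inter> {n. pts w (tier_of i) n \<omega> \<in> cball 0 (real k)}"
  have "m \<in> ?Z" "finite ?Z" using m k fin by auto
  then obtain n where n: "n \<in> ?Z" "\<And>m. m \<in> ?Z \<Longrightarrow> ?d n \<le> ?d m"
    using ex_is_arg_min_if_finite[of ?Z ?d] unfolding is_arg_min_linorder by blast
  have least: "?d n \<le> ?d m" if "m \<in> Phi p w i \<omega>" for m
    using n that by (cases "m \<in> ?Z") auto
  have "R_near p w i \<omega> = ?d n"
    unfolding R_near_def using n(1) least by (intro cInf_eq_minimum) auto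
  then show ?thesis using n(1) least by (auto intro: order_trans)
qed

text \<open>The void probabilities give the distribution function. Restricting to nonempty
  \<open>Phi\<close> keeps out the meaningless value \<open>Inf {}\<close>, so the mass may be less
  than 1.\<close>

lemma distr_R_near:
  "distr (with_density (sample w) (indicator {\<omega>. Phi p w i \<omega> \<noteq> {}})) borel (R_near p w i) =
    with_density lborel (\<lambda>r. ennreal (dens_R p i r) * indicator {0..} r)"
    (is "?N = _")
proof (rule finite_measure_eq_density_atMost)
  let ?t = "tier_of i"
  have ppp: "homogeneous_ppp (sample w) (params.density p ?t) (pts w ?t)"
    using model by (simp add: network_model_def)
  note [measurable] = measurable_info_sample[OF measurable_Phi[of i UNIV, simplified]]
    measurable_info_sample[OF measurable_pts[of _ UNIV, simplified]]
    measurable_info_sample[OF measurable_R_near[of i UNIV, simplified]]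
    measurable_info_sample[OF measurable_Phi_nonempty[of i UNIV, simplified]]
  have emeasure_N: "emeasure ?N A = emeasure (sample w) {\<omega>\<in>space (sample w). Phi p w i \<omega> \<noteq> {} \<and> R_near p w i \<omega> \<in> A}"
    if [measurable]: "A \<in> sets borel" for A
  proof -
    have "emeasure ?N A = (\<integral>\<^sup>+\<omega>. indicator {\<omega>. Phi p w i \<omega> \<noteq> {}} \<omega> *
        indicator (R_near p w i -` A \<inter> space (sample w)) \<omega> \<partial>sample w)"
      by (simp add: emeasure_distr emeasure_density)
    also have "\<dots> = (\<integral>\<^sup>+\<omega>. indicator {\<omega>\<in>space (sample w). Phi p w i \<omega> \<noteq> {} \<and> R_near p w i \<omega> \<in> A} \<omega> \<partial>sample w)"
      by (intro nn_integral_cong) (auto split: split_indicator)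
    finally show ?thesis by simp
  qed
  show "finite_measure ?N"
    by (intro finite_measureI) (simp add: emeasure_N)
  fix x
  have "AE \<omega> in sample w. \<forall>k::nat. finite {n. pts w ?t n \<omega> \<in> cball 0 (real k)}"
    unfolding AE_all_countable by (intro allI homogeneous_ppp_finite[OF ppp]) auto
  then have AE: "AE \<omega> in sample w. (Phi p w i \<omega> \<noteq> {} \<and> R_near p w i \<omega> \<le> x) \<longleftrightarrow>
      (\<exists>n. n \<in> Phi p w i \<omega> \<and> norm (pts w ?t n \<omega>) \<le> x)"
  proof eventually_elim
    case (elim \<omega>)
    then show ?case
      using R_near_le_iff[of i \<omega> x] by (cases "Phi p w i \<omega> = {}") auto
  qed
  let ?W = "{\<omega>\<in>space (sample w). \<forall>n. n \<in> Phi p w i \<omega> \<longrightarrow> \<not> norm (pts w ?t n \<omega>) \<le> x}"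
  have "emeasure ?N {..x} = emeasure (sample w) (space (sample w) - ?W)"
    unfolding emeasure_N[of "{..x}", simplified]
  proof (rule emeasure_eq_AE)
    show "AE \<omega> in sample w. \<omega> \<in> {\<omega>\<in>space (sample w). Phi p w i \<omega> \<noteq> {} \<and> R_near p w i \<omega> \<le> x} \<longleftrightarrow>
        \<omega> \<in> space (sample w) - ?W"
      using AE by eventually_elim blast
  qed measurable
  also have "\<dots> = ennreal (1 - prob ?W)"
    by (subst emeasure_eq_measure, subst prob_compl) auto
  also have "\<dots> = (\<integral>\<^sup>+y. ennreal (dens_R p i y) * indicator {0..} y * indicator {..x} y \<partial>lborel)"
  proof (cases "0 \<le> x")
    case True
    have "(\<integral>\<^sup>+y. ennreal (dens_R p i y) * indicator {0..} y * indicator {..x} y \<partial>lborel) =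
        (\<integral>\<^sup>+y. ennreal (hazard i y * exp (- (LBINT u:{0..y}. hazard i u))) * indicator {0..x} y \<partial>lborel)"
      by (intro nn_integral_cong) (auto simp: dens_R_eq split: split_indicator)
    also have "\<dots> = ennreal (1 - exp (- (LBINT u:{0..x}. hazard i u)))"
      using True by (intro nn_integral_hazard_density continuous_on_hazard hazard_nonneg)
    finally show ?thesis using True by (simp add: prob_no_Phi_within)
  next
    case False
    then have "?W = space (sample w)" by (auto dest: order_trans[OF norm_ge_zero])
    moreover have "(\<integral>\<^sup>+y. ennreal (dens_R p i y) * indicator {0..} y * indicator {..x} y \<partial>lborel) =
        (\<integral>\<^sup>+y. 0 \<partial>(lborel :: real measure))"
      using False by (intro nn_integral_cong) (auto split: split_indicator)
    ultimately show ?thesis by (simp add: prob_space)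
  qed
  finally show "emeasure ?N {..x} =
      (\<integral>\<^sup>+y. ennreal (dens_R p i y) * indicator {0..} y * indicator {..x} y \<partial>lborel)" .
qed auto

text \<open>\<open>r_c\<close> comes from the center and the beam directors, the distance and the
  nonemptiness from one tier and its marks. These sources are disjoint, so the densities multiply;
  the Boolean in \<open>?f\<close> carries the nonemptiness through the independence step.\<close>

lemma nn_integral_r_c_R_near:
  assumes f[measurable]: "(\<lambda>(t, r). f t r) \<in> borel_measurable (borel \<Otimes>\<^sub>M borel)"
  shows "(\<integral>\<^sup>+\<omega>. f (r_c w \<omega>) (R_near p w i \<omega>) * indicator {\<omega>. Phi p w i \<omega> \<noteq> {}} \<omega> \<partial>sample w) =
    (\<integral>\<^sup>+t. (\<integral>\<^sup>+r. f t r * (ennreal (dens_R p i r) * indicator {0..} r) \<partial>lborel) *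
        (ennreal (dens_c p t) * indicator {0..} t) \<partial>lborel)"
proof -
  let ?B = "\<lambda>\<omega>. Phi p w i \<omega> \<noteq> {}"
  let ?f = "\<lambda>t (r, b). f t r * (if b then 1 else 0)"
  have RB: "(\<lambda>\<omega>. (R_near p w i \<omega>, ?B \<omega>)) \<in> info (mark_sources i) \<rightarrow>\<^sub>M borel \<Otimes>\<^sub>M count_space UNIV"
    using measurable_R_near[of i "mark_sources i"] measurable_Phi_nonempty[of i "mark_sources i"] by simp
  note [measurable] = measurable_info_sample[OF measurable_R_near[of i UNIV, simplified]]
    measurable_info_sample[OF measurable_Phi_nonempty[of i UNIV, simplified]]
  have "(\<integral>\<^sup>+\<omega>. f (r_c w \<omega>) (R_near p w i \<omega>) * indicator {\<omega>. ?B \<omega>} \<omega> \<partial>sample w) =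
      (\<integral>\<^sup>+\<omega>. ?f (r_c w \<omega>) (R_near p w i \<omega>, ?B \<omega>) \<partial>sample w)"
    by (intro nn_integral_cong) (auto split: split_indicator)
  also have "\<dots> = (\<integral>\<^sup>+\<omega>. (\<integral>\<^sup>+\<omega>'. ?f (r_c w \<omega>) (R_near p w i \<omega>', ?B \<omega>') \<partial>sample w) \<partial>sample w)"
  proof (rule nn_integral_indep[OF _ measurable_r_c[OF order_refl] RB])
    show "{SCenter, SLbd} \<inter> mark_sources i = {}" by (auto simp: mark_sources_def)
    show "(\<lambda>(t, z). ?f t z) \<in> borel_measurable (borel \<Otimes>\<^sub>M borel \<Otimes>\<^sub>M count_space UNIV)"
      unfolding case_prod_beta by measurable
  qed
  also have "\<dots> = (\<integral>\<^sup>+\<omega>. (\<integral>\<^sup>+r. f (r_c w \<omega>) r \<partial>distr (with_density (sample w) (indicator {\<omega>. ?B \<omega>})) borel (R_near p w i)) \<partial>sample w)"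
  proof (intro nn_integral_cong)
    fix \<omega>
    have "(\<integral>\<^sup>+\<omega>'. ?f (r_c w \<omega>) (R_near p w i \<omega>', ?B \<omega>') \<partial>sample w) =
        (\<integral>\<^sup>+\<omega>'. indicator {\<omega>. ?B \<omega>} \<omega>' * f (r_c w \<omega>) (R_near p w i \<omega>') \<partial>sample w)"
      by (intro nn_integral_cong) (auto split: split_indicator)
    then show "(\<integral>\<^sup>+\<omega>'. ?f (r_c w \<omega>) (R_near p w i \<omega>', ?B \<omega>') \<partial>sample w) =
        (\<integral>\<^sup>+r. f (r_c w \<omega>) r \<partial>distr (with_density (sample w) (indicator {\<omega>. ?B \<omega>})) borel (R_near p w i))"
      by (simp add: nn_integral_distr nn_integral_density)
  qed
  also have "\<dots> = (\<integral>\<^sup>+\<omega>. (\<integral>\<^sup>+r. f (r_c w \<omega>) r * (ennreal (dens_R p i r) * indicator {0..} r) \<partial>lborel) \<partial>sample w)"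
    unfolding distr_R_near by (simp add: nn_integral_density mult_ac)
  also have "\<dots> = (\<integral>\<^sup>+t. (\<integral>\<^sup>+r. f t r * (ennreal (dens_R p i r) * indicator {0..} r) \<partial>lborel) *
        (ennreal (dens_c p t) * indicator {0..} t) \<partial>lborel)"
    by (rule nn_integral_r_c) simp
  finally show ?thesis .
qed


section \<open>Association and coverage\<close>

lemma serves_unique:
  assumes "serves p w u \<omega>" "serves p w v \<omega>" shows "u = v"
proof -
  have "node_avg p w u \<omega> = node_avg p w v \<omega>"
    using assms by (auto simp: serves_def intro: order_antisym)
  then have "to_nat u \<le> to_nat v" "to_nat v \<le> to_nat u"
    using assms unfolding serves_def by metis+
  then have "to_nat u = to_nat v" by simp
  then show ?thesis by simp
qed

lemma avg_power_less:
  assumes "0 \<le> x" "x < y" shows "avg_power p i y < avg_power p i x"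
proof -
  have v: "0 < rho p i" "0 < eta p i" "0 < alpha p i" "0 < params.height p i" using valid by (auto simp: valid_params_def)
  have "x\<^sup>2 + (params.height p i)\<^sup>2 < y\<^sup>2 + (params.height p i)\<^sup>2"
    using assms by (simp add: power_strict_mono)
  moreover have "0 < x\<^sup>2 + (params.height p i)\<^sup>2"
    using v by (intro add_nonneg_pos) auto
  ultimately have "(y\<^sup>2 + (params.height p i)\<^sup>2) powr (- alpha p i / 2) < (x\<^sup>2 + (params.height p i)\<^sup>2) powr (- alpha p i / 2)"
    using v by (intro powr_less_mono2_neg) auto
  then show ?thesis using v by (simp add: avg_power_def)
qed

lemma tier_of_node_channel: "tier_of (node_channel p w (Other t n) \<omega>) = t"
  by (cases t) (auto simp: node_channel_def)

lemma node_channel_Central: "node_channel p w Central \<omega> \<in> {Lu, Nu}"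
  by (auto simp: node_channel_def)

text \<open>For a fixed channel type the average power strictly decreases with distance, so a
  serving node cannot be farther away than another node of its type.\<close>

lemma serving_node_dist:
  assumes "serves p w (Other (tier_of i) n) \<omega>" "node_channel p w (Other (tier_of i) n) \<omega> = i"
  shows "node_dist p w (Other (tier_of i) n) \<omega> = R_near p w i \<omega>"
proof -
  let ?d = "\<lambda>n. node_dist p w (Other (tier_of i) n) \<omega>"
  have n: "n \<in> Phi p w i \<omega>" using assms by (simp add: Phi_def)
  have "?d n \<le> ?d m" if m: "m \<in> Phi p w i \<omega>" for m
  proof (rule ccontr)
    assume "\<not> ?d n \<le> ?d m"
    then have "avg_power p i (?d n) < avg_power p i (?d m)"
      by (intro avg_power_less) (auto simp: not_le)
    moreover have "node_avg p w (Other (tier_of i) m) \<omega> \<le> node_avg p w (Other (tier_of i) n) \<omega>"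
      using assms(1) by (simp add: serves_def)
    ultimately show False
      using m assms(2) by (simp add: node_avg_def Phi_def del: node_dist.simps)
  qed
  then show ?thesis
    unfolding R_near_def using n by (intro cInf_eq_minimum[symmetric]) auto
qed

lemma assoc_nearest_iff:
  "assoc_nearest p w i \<omega> \<longleftrightarrow>
    (\<exists>n. serves p w (Other (tier_of i) n) \<omega> \<and> node_channel p w (Other (tier_of i) n) \<omega> = i)"
  using serving_node_dist by (auto simp: assoc_nearest_def Phi_def simp del: node_dist.simps)

lemma measurable_sample_rules:
  "serves p w v \<in> sample w \<rightarrow>\<^sub>M count_space UNIV"
  "assoc_nearest p w i \<in> sample w \<rightarrow>\<^sub>M count_space UNIV"
  "node_channel p w v \<in> sample w \<rightarrow>\<^sub>M count_space UNIV"
  "node_dist p w v \<in> borel_measurable (sample w)"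
  "R_near p w i \<in> borel_measurable (sample w)"
  "r_c w \<in> borel_measurable (sample w)"
  "center w \<in> borel_measurable (sample w)"
  "interf_nearest p w i \<in> borel_measurable (sample w)"
  "interf_central p w \<in> borel_measurable (sample w)"
  "Measurable.pred (sample w) (\<lambda>\<omega>. Phi p w i \<omega> \<noteq> {})"
  using measurable_info_sample[OF measurable_serves[of UNIV v]]
    measurable_info_sample[OF measurable_assoc_nearest[of UNIV i]]
    measurable_info_sample[OF measurable_channel_nonfading[of UNIV v]]
    measurable_info_sample[OF measurable_dist_nonfading[of UNIV v]]
    measurable_info_sample[OF measurable_R_near[of i UNIV]]
    measurable_info_sample[OF measurable_r_c[of UNIV]]
    measurable_info_sample[OF measurable_center[of UNIV]]
    measurable_info_sample[OF measurable_interf_nearest[of i]]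
    measurable_info_sample[OF measurable_interf_central]
    measurable_info_sample[OF measurable_Phi_nonempty[of i UNIV]]
  by simp_all

text \<open>The serving node does not contribute to the interference, so its fading gain is
  independent of the association, of the distances and of the interference.\<close>

lemma emeasure_serves_covered:
  assumes \<gamma>: "\<gamma> > 0" and S: "SFading v i \<notin> S" "nonfading \<subseteq> S" and I: "I \<in> borel_measurable (info S)"
  shows "emeasure (sample w) {\<omega>\<in>space (sample w). serves p w v \<omega> \<and> node_channel p w v \<omega> = i \<and>
        ennreal \<gamma> \<le> ennreal (received p w v \<omega>) / (I \<omega> + ennreal (sigma2 p))} =
    (\<integral>\<^sup>+\<omega>. ennreal (cover_prob p \<gamma> i (node_dist p w v \<omega>) (I \<omega>)) *
        indicator {\<omega>. serves p w v \<omega> \<and> node_channel p w v \<omega> = i} \<omega> \<partial>sample w)"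
proof -
  let ?b = "\<lambda>\<omega>. serves p w v \<omega> \<and> node_channel p w v \<omega> = i"
  let ?X = "\<lambda>\<omega>. (?b \<omega>, node_dist p w v \<omega>, I \<omega>)"
  let ?f = "\<lambda>(b, d, x) g. if b \<and> ennreal \<gamma> \<le> ennreal (avg_power p i d * g) / (x + ennreal (sigma2 p)) then 1 else 0 :: ennreal"
  note [measurable] = measurable_serves[OF S(2)] measurable_channel_nonfading[OF S(2)] I
    measurable_dist_nonfading[OF S(2)]
  note [measurable] = measurable_sample_rules measurable_info_sample[OF I]
  have X: "?X \<in> info S \<rightarrow>\<^sub>M count_space UNIV \<Otimes>\<^sub>M borel \<Otimes>\<^sub>M borel" by measurable
  have G: "fading w v i \<in> info {SFading v i} \<rightarrow>\<^sub>M borel" by (intro measurable_fading) simp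
  have D: "distributed (sample w) lborel (fading w v i) (erlang_density (shape p i - 1) (real (shape p i)))"
    using model by (simp add: network_model_def)
  have [measurable]: "fading w v i \<in> borel_measurable (sample w)" using G by (rule measurable_info_sample)
  have set: "{\<omega>\<in>space (sample w). serves p w v \<omega> \<and> node_channel p w v \<omega> = i \<and>
      ennreal \<gamma> \<le> ennreal (received p w v \<omega>) / (I \<omega> + ennreal (sigma2 p))} =
      {\<omega>\<in>space (sample w). ?b \<omega> \<and> ennreal \<gamma> \<le> ennreal (avg_power p i (node_dist p w v \<omega>) * fading w v i \<omega>) /
        (I \<omega> + ennreal (sigma2 p))}"
    by (auto simp: received_def node_avg_def)
  have "emeasure (sample w) {\<omega>\<in>space (sample w). serves p w v \<omega> \<and> node_channel p w v \<omega> = i \<and>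
        ennreal \<gamma> \<le> ennreal (received p w v \<omega>) / (I \<omega> + ennreal (sigma2 p))} =
      (\<integral>\<^sup>+\<omega>. indicator {\<omega>\<in>space (sample w). ?b \<omega> \<and> ennreal \<gamma> \<le>
        ennreal (avg_power p i (node_dist p w v \<omega>) * fading w v i \<omega>) / (I \<omega> + ennreal (sigma2 p))} \<omega> \<partial>sample w)"
    unfolding set by (rule nn_integral_indicator[symmetric]) (unfold divide_ennreal_def, measurable)
  also have "\<dots> = (\<integral>\<^sup>+\<omega>. ?f (?X \<omega>) (fading w v i \<omega>) \<partial>sample w)"
    by (intro nn_integral_cong) (auto split: split_indicator)
  also have "\<dots> = (\<integral>\<^sup>+\<omega>. (\<integral>\<^sup>+\<omega>'. ?f (?X \<omega>) (fading w v i \<omega>') \<partial>sample w) \<partial>sample w)"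
  proof (rule nn_integral_indep[OF _ X G])
    show "S \<inter> {SFading v i} = {}" using S(1) by auto
    show "(\<lambda>(x, g). ?f x g) \<in> borel_measurable ((count_space UNIV \<Otimes>\<^sub>M borel \<Otimes>\<^sub>M borel) \<Otimes>\<^sub>M borel)"
      unfolding case_prod_beta divide_ennreal_def by measurable
  qed
  also have "\<dots> = (\<integral>\<^sup>+\<omega>. ennreal (cover_prob p \<gamma> i (node_dist p w v \<omega>) (I \<omega>)) * indicator {\<omega>. ?b \<omega>} \<omega> \<partial>sample w)"
  proof (intro nn_integral_cong)
    fix \<omega>
    let ?C = "\<lambda>\<omega>'. ennreal \<gamma> \<le> ennreal (avg_power p i (node_dist p w v \<omega>) * fading w v i \<omega>') /
        (I \<omega> + ennreal (sigma2 p))"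
    have "(\<integral>\<^sup>+\<omega>'. ?f (?X \<omega>) (fading w v i \<omega>') \<partial>sample w) =
        (\<integral>\<^sup>+\<omega>'. indicator {\<omega>. ?b \<omega>} \<omega> * indicator {\<omega>'\<in>space (sample w). ?C \<omega>'} \<omega>' \<partial>sample w)"
      by (intro nn_integral_cong) (auto split: split_indicator)
    also have "\<dots> = indicator {\<omega>. ?b \<omega>} \<omega> * emeasure (sample w) {\<omega>'\<in>space (sample w). ?C \<omega>'}"
      by (rule nn_integral_cmult_indicator) (unfold divide_ennreal_def, measurable)
    also have "emeasure (sample w) {\<omega>'\<in>space (sample w). ?C \<omega>'} =
        ennreal (cover_prob p \<gamma> i (node_dist p w v \<omega>) (I \<omega>))"
      by (rule emeasure_covered_eq_cover_prob[OF valid \<gamma> D])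
    finally show "(\<integral>\<^sup>+\<omega>'. ?f (?X \<omega>) (fading w v i \<omega>') \<partial>sample w) =
        ennreal (cover_prob p \<gamma> i (node_dist p w v \<omega>) (I \<omega>)) * indicator {\<omega>. ?b \<omega>} \<omega>"
      by (simp add: mult.commute)
  qed
  finally show ?thesis .
qed

section \<open>Decomposition of the coverage event by serving node and channel type\<close>

definition covered_by :: "real \<Rightarrow> node \<Rightarrow> channel \<Rightarrow> 'w set" where
  "covered_by \<gamma> v i = {\<omega>\<in>space (sample w). serves p w v \<omega> \<and> node_channel p w v \<omega> = i \<and>
    ennreal \<gamma> \<le> ennreal (received p w v \<omega>) / (interference p w v \<omega> + ennreal (sigma2 p))}"

lemma covered_by_Central:
  assumes \<gamma>: "\<gamma> > 0"
  shows "emeasure (sample w) (covered_by \<gamma> Central i) =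
    (\<integral>\<^sup>+\<omega>. ennreal (cover_prob p \<gamma> i (r_cu p w \<omega>) (interf_central p w \<omega>)) *
        indicator {\<omega>. serves p w Central \<omega> \<and> node_channel p w Central \<omega> = i} \<omega> \<partial>sample w)"
  unfolding covered_by_def interference_def node.case
  by (rule emeasure_serves_covered[OF \<gamma> _ _ measurable_interf_central]) (auto simp: nonfading_def)

lemma covered_by_Other_eq:
  "covered_by \<gamma> (Other (tier_of i) n) i =
    {\<omega>\<in>space (sample w). serves p w (Other (tier_of i) n) \<omega> \<and> node_channel p w (Other (tier_of i) n) \<omega> = i \<and>
      ennreal \<gamma> \<le> ennreal (received p w (Other (tier_of i) n) \<omega>) / (interf_nearest p w i \<omega> + ennreal (sigma2 p))}"
  by (auto simp: covered_by_def interference_def)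

lemma sets_covered_by[measurable]: "covered_by \<gamma> v i \<in> events"
proof -
  note [measurable] = measurable_sample_rules
  have [measurable]: "fading w v j \<in> borel_measurable (sample w)" for v j
    using measurable_info_sample[OF measurable_fading[of v j UNIV]] by simp
  have [measurable]: "received p w v \<in> borel_measurable (sample w)" for v
    unfolding received_def[abs_def] node_avg_def
    by (rule measurable_compose_countable[where g="node_channel p w v" and
          f="\<lambda>i \<omega>. avg_power p i (node_dist p w v \<omega>) * fading w v i \<omega>"]) measurable
  show ?thesis
  proof (cases v)
    case Central
    show ?thesis
      unfolding Central covered_by_def interference_def divide_ennreal_def node.case by measurable
  next
    case (Other t n)
    show ?thesis
    proof (cases "tier_of i = t")
      case True
      then show ?thesis
        unfolding Other True[symmetric] covered_by_Other_eq divide_ennreal_def by measurable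
    next
      case False
      then have "covered_by \<gamma> v i = {}"
        using tier_of_node_channel by (auto simp: covered_by_def Other)
      then show ?thesis by simp
    qed
  qed
qed

lemma covered_by_disjoint:
  assumes "u \<noteq> v \<or> i \<noteq> j" shows "covered_by \<gamma> u i \<inter> covered_by \<gamma> v j = {}"
  using assms serves_unique by (auto simp: covered_by_def)

text \<open>When node \<open>n\<close> serves, its distance is \<open>R_near\<close>, so the
  integrand \<open>?h\<close> no longer depends on \<open>n\<close>. The disjoint events that node
  \<open>n\<close> serves are then summed under one measure, the one with density \<open>?h\<close>,
  and their union is the association event.\<close>

lemma emeasure_covered_by_nearest:
  assumes \<gamma>: "\<gamma> > 0"
  shows "emeasure (sample w) (\<Union>n. covered_by \<gamma> (Other (tier_of i) n) i) =
    (\<integral>\<^sup>+\<omega>. ennreal (cover_prob p \<gamma> i (R_near p w i \<omega>) (interf_nearest p w i \<omega>)) *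
        indicator {\<omega>. assoc_nearest p w i \<omega>} \<omega> \<partial>sample w)"
proof -
  let ?v = "\<lambda>n. Other (tier_of i) n"
  let ?h = "\<lambda>\<omega>. ennreal (cover_prob p \<gamma> i (R_near p w i \<omega>) (interf_nearest p w i \<omega>))"
  let ?S = "\<lambda>n. {\<omega>\<in>space (sample w). serves p w (?v n) \<omega> \<and> node_channel p w (?v n) \<omega> = i}"
  note [measurable] = measurable_sample_rules
  have eq: "emeasure (sample w) (covered_by \<gamma> (?v n) i) = emeasure (with_density (sample w) ?h) (?S n)" for n
  proof -
    have "emeasure (sample w) (covered_by \<gamma> (?v n) i) =
        (\<integral>\<^sup>+\<omega>. ennreal (cover_prob p \<gamma> i (node_dist p w (?v n) \<omega>) (interf_nearest p w i \<omega>)) *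
          indicator {\<omega>. serves p w (?v n) \<omega> \<and> node_channel p w (?v n) \<omega> = i} \<omega> \<partial>sample w)"
      unfolding covered_by_Other_eq
      by (rule emeasure_serves_covered[OF \<gamma> _ _ measurable_interf_nearest]) (auto simp: nonfading_def)
    also have "\<dots> = (\<integral>\<^sup>+\<omega>. ?h \<omega> * indicator (?S n) \<omega> \<partial>sample w)"
      by (intro nn_integral_cong) (auto simp: serving_node_dist simp del: node_dist.simps split: split_indicator)
    also have "\<dots> = emeasure (with_density (sample w) ?h) (?S n)"
      by (subst emeasure_density) auto
    finally show ?thesis .
  qed
  have "emeasure (sample w) (\<Union>n. covered_by \<gamma> (?v n) i) = (\<Sum>n. emeasure (sample w) (covered_by \<gamma> (?v n) i))"
    by (intro suminf_emeasure[symmetric]) (auto simp: disjoint_family_on_def intro!: covered_by_disjoint)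
  also have "\<dots> = (\<Sum>n. emeasure (with_density (sample w) ?h) (?S n))"
    by (simp only: eq)
  also have "\<dots> = emeasure (with_density (sample w) ?h) (\<Union>n. ?S n)"
    using serves_unique by (intro suminf_emeasure) (auto simp: disjoint_family_on_def)
  also have "\<dots> = (\<integral>\<^sup>+\<omega>. ?h \<omega> * indicator (\<Union>n. ?S n) \<omega> \<partial>sample w)"
    by (subst emeasure_density) auto
  also have "\<dots> = (\<integral>\<^sup>+\<omega>. ?h \<omega> * indicator {\<omega>. assoc_nearest p w i \<omega>} \<omega> \<partial>sample w)"
    by (intro nn_integral_cong) (auto simp: assoc_nearest_iff split: split_indicator)
  finally show ?thesis .
qed

lemma coverage_decomposition:
  assumes \<gamma>: "\<gamma> > 0"
  shows "ennreal (coverage p w \<gamma>) =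
    (\<Sum>i\<in>UNIV. emeasure (sample w) (\<Union>n. covered_by \<gamma> (Other (tier_of i) n) i)) +
    (\<Sum>i\<in>{Lu, Nu}. emeasure (sample w) (covered_by \<gamma> Central i))"
proof -
  let ?U = "\<lambda>i. \<Union>n. covered_by \<gamma> (Other (tier_of i) n) i"
  have "{\<omega>\<in>space (sample w). \<exists>v. serves p w v \<omega> \<and>
      ennreal \<gamma> \<le> ennreal (received p w v \<omega>) / (interference p w v \<omega> + ennreal (sigma2 p))} =
      (\<Union>i\<in>UNIV. ?U i) \<union> (\<Union>i\<in>{Lu, Nu}. covered_by \<gamma> Central i)" (is "?L = ?R")
  proof (intro set_eqI iffI)
    fix \<omega> assume "\<omega> \<in> ?L"
    then obtain v where v: "\<omega> \<in> space (sample w)" "serves p w v \<omega>"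
      "ennreal \<gamma> \<le> ennreal (received p w v \<omega>) / (interference p w v \<omega> + ennreal (sigma2 p))"
      by auto
    show "\<omega> \<in> ?R"
    proof (cases v)
      case Central
      then have "\<omega> \<in> (\<Union>i\<in>{Lu, Nu}. covered_by \<gamma> Central i)"
        using v node_channel_Central[of \<omega>] by (auto simp: covered_by_def)
      then show ?thesis by blast
    next
      case (Other t n)
      let ?i = "node_channel p w v \<omega>"
      have "\<omega> \<in> covered_by \<gamma> (Other (tier_of ?i) n) ?i"
        using v tier_of_node_channel[of t n \<omega>] by (simp add: covered_by_def Other)
      then show ?thesis by blast
    qed
  qed (auto simp: covered_by_def)
  then have "ennreal (coverage p w \<gamma>) =
      emeasure (sample w) ((\<Union>i\<in>UNIV. ?U i) \<union> (\<Union>i\<in>{Lu, Nu}. covered_by \<gamma> Central i))"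
    by (simp only: coverage_def emeasure_eq_measure)
  also have "\<dots> = emeasure (sample w) (\<Union>i\<in>UNIV. ?U i) + emeasure (sample w) (\<Union>i\<in>{Lu, Nu}. covered_by \<gamma> Central i)"
  proof (rule plus_emeasure[symmetric])
    show "(\<Union>i. ?U i) \<inter> (\<Union>i\<in>{Lu, Nu}. covered_by \<gamma> Central i) = {}"
      using serves_unique by (fastforce simp: covered_by_def)
  qed auto
  also have "emeasure (sample w) (\<Union>i\<in>UNIV. ?U i) = (\<Sum>i\<in>UNIV. emeasure (sample w) (?U i))"
  proof (intro sum_emeasure[symmetric])
    show "disjoint_family_on ?U UNIV"
      using covered_by_disjoint by (fastforce simp: disjoint_family_on_def)
  qed auto
  also have "emeasure (sample w) (\<Union>i\<in>{Lu, Nu}. covered_by \<gamma> Central i) =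
      (\<Sum>i\<in>{Lu, Nu}. emeasure (sample w) (covered_by \<gamma> Central i))"
    by (intro sum_emeasure[symmetric]) (auto simp: disjoint_family_on_def intro!: covered_by_disjoint)
  finally show ?thesis .
qed


section \<open>Averaging over the placement strategy\<close>

abbreviation within_prob :: real where
  "within_prob \<equiv> 1 - exp (- density_lbd p * pi * (R_star p)\<^sup>2)"

lemma R_star_pos: "0 < R_star p"
  using valid by (simp add: valid_params_def)

lemma within_prob_nonneg: "0 \<le> within_prob"
  using valid by (simp add: valid_params_def)

lemma nn_integral_dens_c_within:
  "(\<integral>\<^sup>+t. indicator {..R_star p} t * (ennreal (dens_c p t) * indicator {0..} t) \<partial>lborel) = ennreal within_prob"
proof -
  have "(\<integral>\<^sup>+t. indicator {..R_star p} t * (ennreal (dens_c p t) * indicator {0..} t) \<partial>lborel) =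
      (\<integral>\<^sup>+t. ennreal (dens_c p t) * indicator {0..R_star p} t \<partial>lborel)"
    by (intro nn_integral_cong) (auto split: split_indicator)
  then show ?thesis using R_star_pos by (simp only: nn_integral_dens_c less_imp_le)
qed

lemma nn_integral_dens_c_beyond_le:
  "(\<integral>\<^sup>+t. ennreal (dens_c p t) * indicator {R_star p<..} t \<partial>lborel) \<le> 1"
proof -
  have "(\<integral>\<^sup>+t. ennreal (dens_c p t) * indicator {R_star p<..} t \<partial>lborel) \<le>
      (\<integral>\<^sup>+t. 1 * (ennreal (dens_c p t) * indicator {0..} t) \<partial>lborel)"
    using R_star_pos by (intro nn_integral_mono) (auto split: split_indicator)
  also have "\<dots> = 1"
    by (subst nn_integral_r_c[of "\<lambda>_. 1", symmetric]) (auto simp: emeasure_space_1)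
  finally show ?thesis .
qed

lemma expect_strategy_nonneg:
  assumes "\<And>S. 0 \<le> F S" shows "0 \<le> expect_strategy p F"
  unfolding expect_strategy_def set_lebesgue_integral_def
  using assms within_prob_nonneg R_star_pos dens_c_nonneg
  by (intro add_nonneg_nonneg mult_nonneg_nonneg integral_nonneg_AE AE_I2) (auto split: split_indicator)

text \<open>Finiteness is essential: a divergent real integral in \<open>expect_strategy\<close>
  would take the default value 0 and not \<infinity>.\<close>

lemma ennreal_expect_strategy:
  assumes F: "\<And>S. 0 \<le> F S" and [measurable]: "(\<lambda>t. F (Beyond t)) \<in> borel_measurable borel"
    and fin: "(\<integral>\<^sup>+t. ennreal (F (Beyond t)) * (ennreal (dens_c p t) * indicator {R_star p<..} t) \<partial>lborel) < \<infinity>"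
  shows "ennreal (expect_strategy p F) = ennreal (F Within) * ennreal within_prob +
    (\<integral>\<^sup>+t. ennreal (F (Beyond t)) * (ennreal (dens_c p t) * indicator {R_star p<..} t) \<partial>lborel)"
    (is "_ = _ + ?I")
proof -
  have pos: "0 \<le> indicator {R_star p<..} t *\<^sub>R (F (Beyond t) * dens_c p t)" for t
    using F R_star_pos dens_c_nonneg[of t] by (auto split: split_indicator)
  have "?I = (\<integral>\<^sup>+t. ennreal (indicator {R_star p<..} t *\<^sub>R (F (Beyond t) * dens_c p t)) \<partial>lborel)"
    using F R_star_pos dens_c_nonneg
    by (intro nn_integral_cong) (auto simp: ennreal_mult split: split_indicator)
  moreover from pos have "(LBINT t:{R_star p<..}. F (Beyond t) * dens_c p t) =
      enn2real (\<integral>\<^sup>+t. ennreal (indicator {R_star p<..} t *\<^sub>R (F (Beyond t) * dens_c p t)) \<partial>lborel)"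
    unfolding set_lebesgue_integral_def by (intro integral_eq_nn_integral) auto
  ultimately have "ennreal (LBINT t:{R_star p<..}. F (Beyond t) * dens_c p t) = ?I"
    using fin by simp
  moreover have "0 \<le> (LBINT t:{R_star p<..}. F (Beyond t) * dens_c p t)"
    unfolding set_lebesgue_integral_def using pos by (intro integral_nonneg_AE AE_I2)
  ultimately show ?thesis
    unfolding expect_strategy_def using F within_prob_nonneg by (simp add: ennreal_plus ennreal_mult)
qed

lemma measurable_expect_strategy:
  assumes [measurable]: "(\<lambda>r. F r Within) \<in> borel_measurable borel"
    "(\<lambda>(t, r). F r (Beyond t)) \<in> borel_measurable (borel \<Otimes>\<^sub>M borel)"
  shows "(\<lambda>r. expect_strategy p (F r)) \<in> borel_measurable borel"
proof -
  have [measurable]: "(\<lambda>(r, t). F r (Beyond t)) \<in> borel_measurable (borel \<Otimes>\<^sub>M borel)"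
    using measurable_pair_swap[OF assms(2)] by simp
  show ?thesis
    unfolding expect_strategy_def set_lebesgue_integral_def by measurable
qed

text \<open>Measurability is not visible from the derivatives in \<open>cond_cov\<close>, but it is
  clear for the integral of \<open>cover_prob\<close> against a kernel.\<close>

lemma measurable_cond_cov:
  assumes \<gamma>: "\<gamma> > 0" and \<kappa>: "\<kappa> \<in> N \<rightarrow>\<^sub>M prob_algebra borel" and [measurable]: "\<rho> \<in> borel_measurable N"
  shows "(\<lambda>z. cond_cov p \<gamma> i (\<rho> z) (\<kappa> z)) \<in> borel_measurable N"
proof -
  have [measurable]: "(\<lambda>z. \<integral>\<^sup>+x. ennreal (cover_prob p \<gamma> i (\<rho> z) x) \<partial>\<kappa> z) \<in> borel_measurable N"
    by (rule nn_integral_measurable_subprob_algebra2[OF _ measurable_prob_algebraD[OF \<kappa>]]) measurable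
  have "cond_cov p \<gamma> i (\<rho> z) (\<kappa> z) = enn2real (\<integral>\<^sup>+x. ennreal (cover_prob p \<gamma> i (\<rho> z) x) \<partial>\<kappa> z)"
    if "z \<in> space N" for z
    using measurable_space[OF \<kappa> that] nn_integral_cover_prob[OF valid \<gamma>, of "\<kappa> z" i "\<rho> z"]
    by (simp add: space_prob_algebra)
  then show ?thesis
    by (subst measurable_cong[where g="\<lambda>z. enn2real (\<integral>\<^sup>+x. ennreal (cover_prob p \<gamma> i (\<rho> z) x) \<partial>\<kappa> z)"]) auto
qed

text \<open>Two conditionings are chained: given association, \<open>K\<close> averages the
  interference to the sum \<open>L\<close>; given that the process is nonempty, \<open>A\<close>
  averages the association event. What is left depends only on \<open>r_c\<close> and
  \<open>R_near\<close>, whose joint law is a product.\<close>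

lemma nn_integral_nearest:
  fixes i :: channel
  assumes \<gamma>: "\<gamma> > 0" and A: "is_assoc_prob p w A" and K: "is_interf_law p w K"
  defines "LA \<equiv> \<lambda>r S. cond_cov p \<gamma> i r (K i r S) * A r i S"
  shows "(\<integral>\<^sup>+\<omega>. ennreal (cover_prob p \<gamma> i (R_near p w i \<omega>) (interf_nearest p w i \<omega>)) *
        indicator {\<omega>. assoc_nearest p w i \<omega>} \<omega> \<partial>sample w) =
      (\<integral>\<^sup>+r. ennreal (expect_strategy p (LA r) * dens_R p i r) * indicator {0..} r \<partial>lborel)" (is "?lhs = ?rhs")
    and "(\<lambda>r. expect_strategy p (LA r)) \<in> borel_measurable borel"
    and "0 \<le> expect_strategy p (LA r)"
proof -
  let ?h = "\<lambda>\<omega>. ennreal (cover_prob p \<gamma> i (R_near p w i \<omega>) (interf_nearest p w i \<omega>))"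
  let ?R = "R_star p"
  let ?W = "\<lambda>\<omega>. r_c w \<omega> \<le> ?R" and ?B = "\<lambda>\<omega>. r_c w \<omega> > ?R"
  let ?L = "\<lambda>r S. cond_cov p \<gamma> i r (K i r S)"
  let ?dR = "\<lambda>r. ennreal (dens_R p i r) * indicator {0..} r"
  let ?dc = "\<lambda>t. ennreal (dens_c p t) * indicator {0..} t"
  note [measurable] = measurable_sample_rules
  have AW: "is_cond_prob (sample w) (\<lambda>\<omega>. Phi p w i \<omega> \<noteq> {} \<and> ?W \<omega>)
       borel (R_near p w i) (assoc_nearest p w i) (\<lambda>r. A r i Within)"
    and AB: "is_cond_prob (sample w) (\<lambda>\<omega>. Phi p w i \<omega> \<noteq> {} \<and> ?B \<omega>)
       (borel \<Otimes>\<^sub>M borel) (\<lambda>\<omega>. (r_c w \<omega>, R_near p w i \<omega>)) (assoc_nearest p w i) (\<lambda>(t, r). A r i (Beyond t))"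
    using A by (auto simp: is_assoc_prob_def)
  have KW: "is_cond_law (sample w) (\<lambda>\<omega>. assoc_nearest p w i \<omega> \<and> ?W \<omega>)
       borel (R_near p w i) borel (interf_nearest p w i) (\<lambda>r. K i r Within)"
    and KB: "is_cond_law (sample w) (\<lambda>\<omega>. assoc_nearest p w i \<omega> \<and> ?B \<omega>)
       (borel \<Otimes>\<^sub>M borel) (\<lambda>\<omega>. (r_c w \<omega>, R_near p w i \<omega>)) borel (interf_nearest p w i) (\<lambda>(t, r). K i r (Beyond t))"
    using K by (auto simp: is_interf_law_def)
  have mAW[measurable]: "(\<lambda>r. A r i Within) \<in> borel_measurable borel"
    and mAB[measurable]: "(\<lambda>(t, r). A r i (Beyond t)) \<in> borel_measurable (borel \<Otimes>\<^sub>M borel)"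
    and mKW: "(\<lambda>r. K i r Within) \<in> borel \<rightarrow>\<^sub>M prob_algebra borel"
    and mKB: "(\<lambda>(t, r). K i r (Beyond t)) \<in> borel \<Otimes>\<^sub>M borel \<rightarrow>\<^sub>M prob_algebra borel"
    using AW AB KW KB by (auto simp: is_cond_prob_def is_cond_law_def)
  have A01: "0 \<le> A r i S" "A r i S \<le> 1" for r S
    using AW AB by (cases S; auto simp: is_cond_prob_def space_pair_measure)+
  have K_prob: "prob_space (K i r S)" "sets (K i r S) = sets borel" for r S
    using measurable_space[OF mKW, of r] measurable_space[OF mKB, of "(t, r)" for t]
    by (cases S; auto simp: space_prob_algebra space_pair_measure)+
  note L = nn_integral_cover_prob[OF valid \<gamma> K_prob]
  have [measurable]: "(\<lambda>r. ?L r Within) \<in> borel_measurable borel"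
    by (rule measurable_cond_cov[OF \<gamma> mKW]) simp
  have [measurable]: "(\<lambda>(t, r). ?L r (Beyond t)) \<in> borel_measurable (borel \<Otimes>\<^sub>M borel)"
    using measurable_cond_cov[OF \<gamma> mKB, of snd i] by (simp add: case_prod_beta)
  have LA01: "0 \<le> LA r S" "LA r S \<le> 1" for r S
    using A01 L(2,3) by (auto simp: LA_def intro!: mult_le_one)
  have mW[measurable]: "(\<lambda>r. LA r Within) \<in> borel_measurable borel"
    and mB[measurable]: "(\<lambda>(t, r). LA r (Beyond t)) \<in> borel_measurable (borel \<Otimes>\<^sub>M borel)"
    unfolding LA_def by measurable
  show "(\<lambda>r. expect_strategy p (LA r)) \<in> borel_measurable borel"
    by (rule measurable_expect_strategy) measurable
  show "0 \<le> expect_strategy p (LA r)"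
    using LA01 by (intro expect_strategy_nonneg)
  have W: "(\<integral>\<^sup>+\<omega>. ?h \<omega> * indicator {\<omega>. assoc_nearest p w i \<omega> \<and> ?W \<omega>} \<omega> \<partial>sample w) =
      (\<integral>\<^sup>+r. ennreal (LA r Within) * ?dR r \<partial>lborel) * ennreal within_prob"
  proof -
    have "(\<integral>\<^sup>+\<omega>. ?h \<omega> * indicator {\<omega>. assoc_nearest p w i \<omega> \<and> ?W \<omega>} \<omega> \<partial>sample w) =
        (\<integral>\<^sup>+\<omega>. ennreal (?L (R_near p w i \<omega>) Within) * indicator {\<omega>. assoc_nearest p w i \<omega> \<and> ?W \<omega>} \<omega> \<partial>sample w)"
      using is_cond_law_nn_integral[OF KW prob_space_axioms, of "\<lambda>(r, x). ennreal (cover_prob p \<gamma> i r x)"]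
      by (simp add: L(1))
    \<comment> \<open>Association with a point of \<Phi>_i forces \<open>Phi\<close> to be nonempty.
      Adding this condition brings the event into the form on which \<open>A\<close> is
      defined.\<close>
    also have "\<dots> = (\<integral>\<^sup>+\<omega>. ennreal (?L (R_near p w i \<omega>) Within) *
        indicator {\<omega>. (Phi p w i \<omega> \<noteq> {} \<and> ?W \<omega>) \<and> assoc_nearest p w i \<omega>} \<omega> \<partial>sample w)"
      by (intro nn_integral_cong) (auto simp: assoc_nearest_def split: split_indicator)
    also have "\<dots> = (\<integral>\<^sup>+\<omega>. ennreal (?L (R_near p w i \<omega>) Within) * ennreal (A (R_near p w i \<omega>) i Within) *
        indicator {\<omega>. Phi p w i \<omega> \<noteq> {} \<and> ?W \<omega>} \<omega> \<partial>sample w)"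
      by (rule is_cond_prob_nn_integral[OF AW prob_space_axioms]) measurable
    also have "\<dots> = (\<integral>\<^sup>+\<omega>. (indicator {..?R} (r_c w \<omega>) * ennreal (LA (R_near p w i \<omega>) Within)) *
        indicator {\<omega>. Phi p w i \<omega> \<noteq> {}} \<omega> \<partial>sample w)"
      by (intro nn_integral_cong) (auto simp: LA_def ennreal_mult L(2) A01 split: split_indicator)
    also have "\<dots> = (\<integral>\<^sup>+t. (\<integral>\<^sup>+r. (indicator {..?R} t * ennreal (LA r Within)) * ?dR r \<partial>lborel) * ?dc t \<partial>lborel)"
      by (rule nn_integral_r_c_R_near) measurable
    also have "\<dots> = (\<integral>\<^sup>+t. (\<integral>\<^sup>+r. ennreal (LA r Within) * ?dR r \<partial>lborel) * (indicator {..?R} t * ?dc t) \<partial>lborel)"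
      by (intro nn_integral_cong) (simp only: mult.assoc, subst nn_integral_cmult, measurable, simp add: mult_ac)
    also have "\<dots> = (\<integral>\<^sup>+r. ennreal (LA r Within) * ?dR r \<partial>lborel) * ennreal within_prob"
      by (subst nn_integral_cmult) (simp_all only: nn_integral_dens_c_within, measurable)
    finally show ?thesis .
  qed
  let ?I = "\<lambda>r. \<integral>\<^sup>+t. ennreal (LA r (Beyond t)) * (ennreal (dens_c p t) * indicator {?R<..} t) \<partial>lborel"
  have mB'[measurable]: "(\<lambda>(r, t). LA r (Beyond t)) \<in> borel_measurable (borel \<Otimes>\<^sub>M borel)"
    using measurable_pair_swap[OF mB] by simp
  have B: "(\<integral>\<^sup>+\<omega>. ?h \<omega> * indicator {\<omega>. assoc_nearest p w i \<omega> \<and> ?B \<omega>} \<omega> \<partial>sample w) =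
      (\<integral>\<^sup>+r. ?I r * ?dR r \<partial>lborel)"
  proof -
    have m: "(\<lambda>((t, r), x). ennreal (cover_prob p \<gamma> i r x)) \<in>
        borel_measurable ((borel \<Otimes>\<^sub>M borel) \<Otimes>\<^sub>M borel)"
      unfolding case_prod_beta by measurable
    have "(\<integral>\<^sup>+\<omega>. ?h \<omega> * indicator {\<omega>. assoc_nearest p w i \<omega> \<and> ?B \<omega>} \<omega> \<partial>sample w) =
        (\<integral>\<^sup>+\<omega>. ennreal (?L (R_near p w i \<omega>) (Beyond (r_c w \<omega>))) *
          indicator {\<omega>. assoc_nearest p w i \<omega> \<and> ?B \<omega>} \<omega> \<partial>sample w)"
      using is_cond_law_nn_integral[OF KB prob_space_axioms, of "\<lambda>((t, r), x). ennreal (cover_prob p \<gamma> i r x)"]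
      by (simp add: L(1) m)
    also have "\<dots> = (\<integral>\<^sup>+\<omega>. (\<lambda>(t, r). ennreal (?L r (Beyond t))) (r_c w \<omega>, R_near p w i \<omega>) *
        indicator {\<omega>. (Phi p w i \<omega> \<noteq> {} \<and> ?B \<omega>) \<and> assoc_nearest p w i \<omega>} \<omega> \<partial>sample w)"
      by (intro nn_integral_cong) (auto simp: assoc_nearest_def split: split_indicator)
    also have "\<dots> = (\<integral>\<^sup>+\<omega>. (\<lambda>(t, r). ennreal (?L r (Beyond t))) (r_c w \<omega>, R_near p w i \<omega>) *
        ennreal ((\<lambda>(t, r). A r i (Beyond t)) (r_c w \<omega>, R_near p w i \<omega>)) *
        indicator {\<omega>. Phi p w i \<omega> \<noteq> {} \<and> ?B \<omega>} \<omega> \<partial>sample w)"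
      by (rule is_cond_prob_nn_integral[OF AB prob_space_axioms]) measurable
    also have "\<dots> = (\<integral>\<^sup>+\<omega>. (indicator {?R<..} (r_c w \<omega>) * ennreal (LA (R_near p w i \<omega>) (Beyond (r_c w \<omega>)))) *
        indicator {\<omega>. Phi p w i \<omega> \<noteq> {}} \<omega> \<partial>sample w)"
      by (intro nn_integral_cong) (auto simp: LA_def ennreal_mult L(2) A01 split: split_indicator)
    also have "\<dots> = (\<integral>\<^sup>+t. (\<integral>\<^sup>+r. (indicator {?R<..} t * ennreal (LA r (Beyond t))) * ?dR r \<partial>lborel) * ?dc t \<partial>lborel)"
      by (rule nn_integral_r_c_R_near) measurable
    also have "\<dots> = (\<integral>\<^sup>+t. (\<integral>\<^sup>+r. (indicator {?R<..} t * ennreal (LA r (Beyond t))) * ?dR r * ?dc t \<partial>lborel) \<partial>lborel)"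
      by (intro nn_integral_cong nn_integral_multc[symmetric]) measurable
    \<comment> \<open>Exchanging the order leaves, for each distance \<open>r\<close>, the integral
      over the values of \<open>r_c\<close> that occurs in \<open>expect_strategy\<close>.\<close>
    also have "\<dots> = (\<integral>\<^sup>+r. (\<integral>\<^sup>+t. (indicator {?R<..} t * ennreal (LA r (Beyond t))) * ?dR r * ?dc t \<partial>lborel) \<partial>lborel)"
      by (rule lborel_pair.Fubini') measurable
    also have "\<dots> = (\<integral>\<^sup>+r. (\<integral>\<^sup>+t. ennreal (LA r (Beyond t)) * (ennreal (dens_c p t) * indicator {?R<..} t) * ?dR r \<partial>lborel) \<partial>lborel)"
      using R_star_pos by (intro nn_integral_cong) (auto simp: mult_ac split: split_indicator)
    also have "\<dots> = (\<integral>\<^sup>+r. ?I r * ?dR r \<partial>lborel)"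
      by (intro nn_integral_cong nn_integral_multc) measurable
    finally show ?thesis .
  qed
  have mI[measurable]: "?I \<in> borel_measurable borel" by measurable
  \<comment> \<open>Since \<open>LA\<close> is at most 1, the integral over \<open>r_c\<close> is at
    most 1 for every \<open>r\<close>, so no exceptional distances arise here.\<close>
  have E: "ennreal (expect_strategy p (LA r)) = ennreal (LA r Within) * ennreal within_prob + ?I r" for r
  proof (rule ennreal_expect_strategy)
    have "?I r \<le> (\<integral>\<^sup>+t. ennreal (dens_c p t) * indicator {?R<..} t \<partial>lborel)"
    proof (intro nn_integral_mono)
      fix t
      have "ennreal (LA r (Beyond t)) * c \<le> 1 * c" for c
        by (intro mult_right_mono) (simp_all add: LA01)
      then show "ennreal (LA r (Beyond t)) * (ennreal (dens_c p t) * indicator {?R<..} t) \<le>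
          ennreal (dens_c p t) * indicator {?R<..} t"
        by simp
    qed
    also have "\<dots> \<le> 1" by (rule nn_integral_dens_c_beyond_le)
    finally show "?I r < \<infinity>" by (rule le_less_trans) simp
  qed (use LA01 in measurable)
  have "?lhs = (\<integral>\<^sup>+\<omega>. ?h \<omega> * indicator {\<omega>. assoc_nearest p w i \<omega> \<and> ?W \<omega>} \<omega> +
      ?h \<omega> * indicator {\<omega>. assoc_nearest p w i \<omega> \<and> ?B \<omega>} \<omega> \<partial>sample w)"
    by (intro nn_integral_cong) (auto split: split_indicator)
  also have "\<dots> = (\<integral>\<^sup>+\<omega>. ?h \<omega> * indicator {\<omega>. assoc_nearest p w i \<omega> \<and> ?W \<omega>} \<omega> \<partial>sample w) +
      (\<integral>\<^sup>+\<omega>. ?h \<omega> * indicator {\<omega>. assoc_nearest p w i \<omega> \<and> ?B \<omega>} \<omega> \<partial>sample w)"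
    by (rule nn_integral_add) measurable
  also have "\<dots> = (\<integral>\<^sup>+r. ennreal (LA r Within) * ?dR r * ennreal within_prob \<partial>lborel) + (\<integral>\<^sup>+r. ?I r * ?dR r \<partial>lborel)"
    unfolding W B by (subst nn_integral_multc) auto
  also have "\<dots> = (\<integral>\<^sup>+r. ennreal (LA r Within) * ?dR r * ennreal within_prob + ?I r * ?dR r \<partial>lborel)"
    by (rule nn_integral_add[symmetric]) measurable
  also have "\<dots> = (\<integral>\<^sup>+r. ennreal (expect_strategy p (LA r)) * ?dR r \<partial>lborel)"
    unfolding E by (simp add: distrib_left distrib_right mult_ac)
  also have "\<dots> = ?rhs"
    using LA01 by (intro nn_integral_cong)
      (auto simp: ennreal_mult expect_strategy_nonneg dens_R_nonneg split: split_indicator)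
  finally show "?lhs = ?rhs" .
qed

lemma measurable_dens_cu_within[measurable]: "dens_cu_within p \<in> borel_measurable borel"
  unfolding dens_cu_within_def[abs_def] by measurable

text \<open>Within range the central UAV sits above the center, which is independent of
  \<open>r_c\<close>, so the uniform radial law is weighted by \<open>within_prob\<close>. Beyond
  range the conditional densities are mixed over the law of \<open>r_c\<close>.\<close>

lemma nn_integral_r_cu:
  assumes f: "is_dens_cu_beyond p w f" and g[measurable]: "g \<in> borel_measurable borel"
  shows "(\<integral>\<^sup>+\<omega>. g (r_cu p w \<omega>) \<partial>sample w) = (\<integral>\<^sup>+y. g y * (ennreal (dens_cu_within p y) * ennreal within_prob +
    (\<integral>\<^sup>+t. ennreal (f t y) * (ennreal (dens_c p t) * indicator {R_star p<..} t) \<partial>lborel)) \<partial>lborel)"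
proof -
  let ?R = "R_star p"
  let ?W = "\<lambda>\<omega>. r_c w \<omega> \<le> ?R" and ?B = "\<lambda>\<omega>. r_c w \<omega> > ?R"
  let ?dc = "\<lambda>t. ennreal (dens_c p t) * indicator {0..} t"
  let ?I = "\<lambda>y. \<integral>\<^sup>+t. ennreal (f t y) * (ennreal (dens_c p t) * indicator {?R<..} t) \<partial>lborel"
  note [measurable] = measurable_sample_rules
  have f_meas[measurable]: "(\<lambda>(t, y). f t y) \<in> borel_measurable (borel \<Otimes>\<^sub>M borel)"
    and f_law: "\<And>B E. B \<in> sets borel \<Longrightarrow> E \<in> sets borel \<Longrightarrow>
      emeasure (sample w) {\<omega>\<in>space (sample w). ?B \<omega> \<and> r_c w \<omega> \<in> B \<and> r_cu p w \<omega> \<in> E} =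
        (\<integral>\<^sup>+\<omega>. indicator {\<omega>. ?B \<omega> \<and> r_c w \<omega> \<in> B} \<omega> *
               (\<integral>\<^sup>+y. indicator E y * ennreal (f (r_c w \<omega>) y) \<partial>lborel) \<partial>sample w)"
    using f unfolding is_dens_cu_beyond_def is_cond_density_def by blast+
  have [measurable]: "(\<lambda>(y, t). f t y) \<in> borel_measurable (borel \<Otimes>\<^sub>M borel)"
    using measurable_pair_swap[OF f_meas] by simp
  have [measurable]: "r_cu p w \<in> borel_measurable (sample w)" by (rule measurable_sample_rules)
  have [measurable]: "?I \<in> borel_measurable borel" by measurable
  have W: "(\<integral>\<^sup>+\<omega>. g (r_cu p w \<omega>) * indicator {\<omega>. ?W \<omega>} \<omega> \<partial>sample w) =
      (\<integral>\<^sup>+y. g y * ennreal (dens_cu_within p y) \<partial>lborel) * ennreal within_prob"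
  proof -
    have "(\<integral>\<^sup>+\<omega>. g (r_cu p w \<omega>) * indicator {\<omega>. ?W \<omega>} \<omega> \<partial>sample w) =
        (\<integral>\<^sup>+\<omega>. g (norm (center w \<omega>)) * indicator {..?R} (r_c w \<omega>) \<partial>sample w)"
      by (intro nn_integral_cong) (auto simp: central_pos_def split: split_indicator)
    also have "\<dots> = (\<integral>\<^sup>+\<omega>. (\<integral>\<^sup>+t. (g (norm (center w \<omega>)) * indicator {..?R} t) * ?dc t \<partial>lborel) \<partial>sample w)"
      by (rule nn_integral_center_r_c) measurable
    also have "\<dots> = (\<integral>\<^sup>+\<omega>. g (norm (center w \<omega>)) * ennreal within_prob \<partial>sample w)"
      by (intro nn_integral_cong) (simp only: mult.assoc[of "g x" for x], subst nn_integral_cmult, measurable, simp only: nn_integral_dens_c_within)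
    also have "\<dots> = (\<integral>\<^sup>+\<omega>. g (norm (center w \<omega>)) \<partial>sample w) * ennreal within_prob"
      by (rule nn_integral_multc) measurable
    finally show ?thesis by (simp only: nn_integral_norm_center[OF g])
  qed
  have "distr (with_density (sample w) (indicator {\<omega>. ?B \<omega>})) borel (r_cu p w) = with_density lborel ?I"
  proof (rule measure_eqI)
    fix E assume "E \<in> sets (distr (with_density (sample w) (indicator {\<omega>. ?B \<omega>})) borel (r_cu p w))"
    then have [measurable]: "E \<in> sets borel" by simp
    have "emeasure (distr (with_density (sample w) (indicator {\<omega>. ?B \<omega>})) borel (r_cu p w)) E =
        (\<integral>\<^sup>+\<omega>. indicator {\<omega>. ?B \<omega>} \<omega> * indicator (r_cu p w -` E \<inter> space (sample w)) \<omega> \<partial>sample w)"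
      by (subst emeasure_distr, simp, simp, subst emeasure_density) auto
    \<comment> \<open>The trivial condition on \<open>r_c\<close> puts the event into the form of
      the defining equation of \<open>f\<close>, used with all of \<open>UNIV\<close> as set of
      values.\<close>
    also have "\<dots> = (\<integral>\<^sup>+\<omega>. indicator {\<omega>\<in>space (sample w). ?B \<omega> \<and> r_c w \<omega> \<in> UNIV \<and> r_cu p w \<omega> \<in> E} \<omega> \<partial>sample w)"
      by (intro nn_integral_cong) (auto split: split_indicator)
    also have "\<dots> = emeasure (sample w) {\<omega>\<in>space (sample w). ?B \<omega> \<and> r_c w \<omega> \<in> UNIV \<and> r_cu p w \<omega> \<in> E}"
      by (rule nn_integral_indicator) measurable
    also have "\<dots> = (\<integral>\<^sup>+\<omega>. indicator {\<omega>. ?B \<omega> \<and> r_c w \<omega> \<in> UNIV} \<omega> *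
               (\<integral>\<^sup>+y. indicator E y * ennreal (f (r_c w \<omega>) y) \<partial>lborel) \<partial>sample w)"
      by (rule f_law) auto
    also have "\<dots> = (\<integral>\<^sup>+\<omega>. indicator {?R<..} (r_c w \<omega>) *
               (\<integral>\<^sup>+y. indicator E y * ennreal (f (r_c w \<omega>) y) \<partial>lborel) \<partial>sample w)"
      by (intro nn_integral_cong) (auto split: split_indicator)
    also have "\<dots> = (\<integral>\<^sup>+t. indicator {?R<..} t * (\<integral>\<^sup>+y. indicator E y * ennreal (f t y) \<partial>lborel) * ?dc t \<partial>lborel)"
      by (rule nn_integral_r_c) measurable
    also have "\<dots> = (\<integral>\<^sup>+t. (\<integral>\<^sup>+y. indicator E y * ennreal (f t y) \<partial>lborel) * (ennreal (dens_c p t) * indicator {?R<..} t) \<partial>lborel)"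
      using R_star_pos by (intro nn_integral_cong) (auto simp: mult_ac split: split_indicator)
    also have "\<dots> = (\<integral>\<^sup>+t. (\<integral>\<^sup>+y. indicator E y * ennreal (f t y) * (ennreal (dens_c p t) * indicator {?R<..} t) \<partial>lborel) \<partial>lborel)"
      by (intro nn_integral_cong nn_integral_multc[symmetric]) measurable
    also have "\<dots> = (\<integral>\<^sup>+y. (\<integral>\<^sup>+t. indicator E y * ennreal (f t y) * (ennreal (dens_c p t) * indicator {?R<..} t) \<partial>lborel) \<partial>lborel)"
      by (rule lborel_pair.Fubini') measurable
    also have "\<dots> = (\<integral>\<^sup>+y. ?I y * indicator E y \<partial>lborel)"
      by (intro nn_integral_cong) (simp only: mult.assoc, subst nn_integral_cmult, simp_all add: mult_ac)
    also have "\<dots> = emeasure (with_density lborel ?I) E"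
      by (subst emeasure_density) auto
    finally show "emeasure (distr (with_density (sample w) (indicator {\<omega>. ?B \<omega>})) borel (r_cu p w)) E =
        emeasure (with_density lborel ?I) E" .
  qed simp
  then have "(\<integral>\<^sup>+y. g y \<partial>distr (with_density (sample w) (indicator {\<omega>. ?B \<omega>})) borel (r_cu p w)) =
      (\<integral>\<^sup>+y. g y \<partial>with_density lborel ?I)"
    by simp
  moreover have "(\<integral>\<^sup>+y. g y \<partial>distr (with_density (sample w) (indicator {\<omega>. ?B \<omega>})) borel (r_cu p w)) =
      (\<integral>\<^sup>+\<omega>. indicator {\<omega>. ?B \<omega>} \<omega> * g (r_cu p w \<omega>) \<partial>sample w)"
    by (subst nn_integral_distr, simp, simp, subst nn_integral_density) (auto simp del: node_dist.simps)
  moreover have "(\<integral>\<^sup>+y. g y \<partial>with_density lborel ?I) = (\<integral>\<^sup>+y. ?I y * g y \<partial>lborel)"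
    by (rule nn_integral_density) measurable
  ultimately have B: "(\<integral>\<^sup>+\<omega>. indicator {\<omega>. ?B \<omega>} \<omega> * g (r_cu p w \<omega>) \<partial>sample w) = (\<integral>\<^sup>+y. ?I y * g y \<partial>lborel)"
    by simp
  have "(\<integral>\<^sup>+\<omega>. g (r_cu p w \<omega>) \<partial>sample w) =
      (\<integral>\<^sup>+\<omega>. g (r_cu p w \<omega>) * indicator {\<omega>. ?W \<omega>} \<omega> + indicator {\<omega>. ?B \<omega>} \<omega> * g (r_cu p w \<omega>) \<partial>sample w)"
    by (intro nn_integral_cong) (auto split: split_indicator)
  also have "\<dots> = (\<integral>\<^sup>+\<omega>. g (r_cu p w \<omega>) * indicator {\<omega>. ?W \<omega>} \<omega> \<partial>sample w) +
      (\<integral>\<^sup>+\<omega>. indicator {\<omega>. ?B \<omega>} \<omega> * g (r_cu p w \<omega>) \<partial>sample w)"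
    by (rule nn_integral_add) measurable
  also have "\<dots> = (\<integral>\<^sup>+y. g y * ennreal (dens_cu_within p y) * ennreal within_prob \<partial>lborel) + (\<integral>\<^sup>+y. ?I y * g y \<partial>lborel)"
    unfolding W B by (subst nn_integral_multc) auto
  also have "\<dots> = (\<integral>\<^sup>+y. g y * ennreal (dens_cu_within p y) * ennreal within_prob + ?I y * g y \<partial>lborel)"
    by (rule nn_integral_add[symmetric]) measurable
  also have "\<dots> = (\<integral>\<^sup>+y. g y * (ennreal (dens_cu_within p y) * ennreal within_prob + ?I y) \<partial>lborel)"
    by (simp add: distrib_left mult_ac)
  finally show ?thesis .
qed

text \<open>\<open>A_c\<close> and \<open>K_c\<close> are conditional on the channel type as well as
  on the distance. The type depends on a mark independent of that distance, and integrating out this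
  mark produces the factor \<open>channel_prob\<close>.\<close>

lemma nn_integral_Central:
  fixes i :: channel
  assumes \<gamma>: "\<gamma> > 0" and i: "i \<in> {Lu, Nu}" and A: "is_assoc_prob_central p w A_c"
    and K: "is_interf_law_central p w K_c" and f: "is_dens_cu_beyond p w f"
  defines "f_cu \<equiv> \<lambda>r S. case S of Within \<Rightarrow> dens_cu_within p r | Beyond t \<Rightarrow> f t r"
  defines "LA \<equiv> \<lambda>r. cond_cov p \<gamma> i r (K_c i r) * A_c r i"
  shows "(\<integral>\<^sup>+\<omega>. ennreal (cover_prob p \<gamma> i (r_cu p w \<omega>) (interf_central p w \<omega>)) *
        indicator {\<omega>. serves p w Central \<omega> \<and> node_channel p w Central \<omega> = i} \<omega> \<partial>sample w) =
      (\<integral>\<^sup>+r. ennreal (LA r * channel_prob p i r * expect_strategy p (f_cu r)) * indicator {0..} r \<partial>lborel)" (is "?lhs = ?rhs")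
    and "(\<lambda>r. LA r * channel_prob p i r * expect_strategy p (f_cu r)) \<in> borel_measurable borel"
    and "0 < r \<Longrightarrow> 0 \<le> LA r * channel_prob p i r * expect_strategy p (f_cu r)"
proof -
  let ?L = "\<lambda>r. cond_cov p \<gamma> i r (K_c i r)"
  let ?b = "\<lambda>\<omega>. node_channel p w Central \<omega> = i"
  note [measurable] = measurable_sample_rules
  have A': "is_cond_prob (sample w) ?b borel (r_cu p w) (serves p w Central) (\<lambda>r. A_c r i)"
    using A i by (auto simp: is_assoc_prob_central_def)
  have K': "is_cond_law (sample w) (\<lambda>\<omega>. serves p w Central \<omega> \<and> ?b \<omega>) borel (r_cu p w) borel (interf_central p w) (K_c i)"
    using K i by (auto simp: is_interf_law_central_def)
  have mA[measurable]: "(\<lambda>r. A_c r i) \<in> borel_measurable borel" and A01: "0 \<le> A_c r i" for r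
    using A' by (auto simp: is_cond_prob_def)
  have mK: "K_c i \<in> borel \<rightarrow>\<^sub>M prob_algebra borel"
    using K' by (auto simp: is_cond_law_def)
  have K_prob: "prob_space (K_c i r)" "sets (K_c i r) = sets borel" for r
    using measurable_space[OF mK, of r] by (auto simp: space_prob_algebra)
  note L = nn_integral_cover_prob[OF valid \<gamma> K_prob]
  have [measurable]: "?L \<in> borel_measurable borel"
    by (rule measurable_cond_cov[OF \<gamma> mK]) simp
  have LA_nonneg: "0 \<le> LA r" for r using A01 L(2) by (simp add: LA_def)
  have [measurable]: "LA \<in> borel_measurable borel" unfolding LA_def by measurable
  have f_meas[measurable]: "(\<lambda>(t, y). f t y) \<in> borel_measurable (borel \<Otimes>\<^sub>M borel)" and f_nonneg: "\<And>t y. 0 \<le> f t y"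
    using f by (auto simp: is_dens_cu_beyond_def is_cond_density_def)
  have f_cu_nonneg: "0 \<le> f_cu r S" for r S
    using f_nonneg by (auto simp: f_cu_def dens_cu_within_def split: strategy.split split_indicator)
  have [measurable]: "(\<lambda>r. expect_strategy p (f_cu r)) \<in> borel_measurable borel"
  proof (rule measurable_expect_strategy)
    show "(\<lambda>r. f_cu r Within) \<in> borel_measurable borel"
      unfolding f_cu_def dens_cu_within_def by simp
    show "(\<lambda>(t, r). f_cu r (Beyond t)) \<in> borel_measurable (borel \<Otimes>\<^sub>M borel)"
      unfolding f_cu_def by simp
  qed
  show "(\<lambda>r. LA r * channel_prob p i r * expect_strategy p (f_cu r)) \<in> borel_measurable borel"
    by measurable
  have pos: "0 \<le> LA r * channel_prob p i r * expect_strategy p (f_cu r)" if "0 < r" for r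
    using that LA_nonneg channel_prob_bounds[of r i] f_cu_nonneg
    by (intro mult_nonneg_nonneg expect_strategy_nonneg) auto
  then show "0 < r \<Longrightarrow> 0 \<le> LA r * channel_prob p i r * expect_strategy p (f_cu r)" .
  let ?g = "\<lambda>r. ennreal (LA r) * ennreal (mark_prob p i r) * indicator {0..} r"
  let ?I = "\<lambda>y. \<integral>\<^sup>+t. ennreal (f t y) * (ennreal (dens_c p t) * indicator {R_star p<..} t) \<partial>lborel"
  let ?\<phi> = "\<lambda>y. ennreal (dens_cu_within p y) * ennreal within_prob + ?I y"
  have tier: "tier_of i = UAV" using i by auto
  have "?lhs = (\<integral>\<^sup>+\<omega>. ennreal (?L (r_cu p w \<omega>)) * indicator {\<omega>. serves p w Central \<omega> \<and> ?b \<omega>} \<omega> \<partial>sample w)"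
    using is_cond_law_nn_integral[OF K' prob_space_axioms, of "\<lambda>(r, x). ennreal (cover_prob p \<gamma> i r x)"]
    by (simp add: L(1) measurable_sample_rules del: node_dist.simps)
  also have "\<dots> = (\<integral>\<^sup>+\<omega>. ennreal (?L (r_cu p w \<omega>)) * indicator {\<omega>. ?b \<omega> \<and> serves p w Central \<omega>} \<omega> \<partial>sample w)"
    by (simp add: conj_commute)
  also have "\<dots> = (\<integral>\<^sup>+\<omega>. ennreal (?L (r_cu p w \<omega>)) * ennreal (A_c (r_cu p w \<omega>) i) * indicator {\<omega>. ?b \<omega>} \<omega> \<partial>sample w)"
    by (rule is_cond_prob_nn_integral[OF A' prob_space_axioms]) measurable
  also have "\<dots> = (\<integral>\<^sup>+\<omega>. (\<lambda>d u. if channel_at p (tier_of i) d u = i then ennreal (LA d) else 0) (r_cu p w \<omega>) (los_mark w Central \<omega>) \<partial>sample w)"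
    by (intro nn_integral_cong)
      (auto simp: node_channel_eq tier LA_def ennreal_mult A01 L(2) simp del: node_dist.simps split: split_indicator)
  also have "\<dots> = (\<integral>\<^sup>+\<omega>. (\<integral>\<^sup>+\<omega>'. (\<lambda>d u. if channel_at p (tier_of i) d u = i then ennreal (LA d) else 0)
      (r_cu p w \<omega>) (los_mark w Central \<omega>') \<partial>sample w) \<partial>sample w)"
    by (rule nn_integral_indep[OF _ measurable_r_cu[OF order_refl] measurable_los_mark[of _ "{SMark Central}"]])
      (auto simp: case_prod_beta)
  also have "\<dots> = (\<integral>\<^sup>+\<omega>. ennreal (LA (r_cu p w \<omega>)) * ennreal (mark_prob p i (r_cu p w \<omega>)) \<partial>sample w)"
    by (simp only: nn_integral_los_mark mult_zero_left add_0_right)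
  \<comment> \<open>The indicator in \<open>?g\<close> costs nothing, as \<open>r_cu\<close> is a
    norm.\<close>
  also have "\<dots> = (\<integral>\<^sup>+\<omega>. ?g (r_cu p w \<omega>) \<partial>sample w)"
    by (intro nn_integral_cong) simp
  also have "\<dots> = (\<integral>\<^sup>+y. ?g y * ?\<phi> y \<partial>lborel)"
    by (rule nn_integral_r_cu[OF f]) measurable
  also have "\<dots> = ?rhs"
  proof (rule nn_integral_cong_AE)
    have [measurable]: "(\<lambda>(y, t). f t y) \<in> borel_measurable (borel \<Otimes>\<^sub>M borel)"
      using measurable_pair_swap[OF f_meas] by simp
    \<comment> \<open>The mixture \<open>?\<phi>\<close> may be infinite at some distances, where
      \<open>expect_strategy\<close> would use a default value. As the density of a probability law
      it is finite almost everywhere.\<close>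
    have "(\<integral>\<^sup>+y. 1 * ?\<phi> y \<partial>lborel) = 1"
      using nn_integral_r_cu[OF f, of "\<lambda>_. 1"] by (simp add: emeasure_space_1)
    then have "(\<integral>\<^sup>+y. ?\<phi> y \<partial>lborel) \<noteq> \<infinity>" by (simp only: mult_1_left) simp
    moreover have "?\<phi> \<in> borel_measurable lborel" by measurable
    ultimately have "AE y in lborel. ?\<phi> y \<noteq> \<infinity>" by (intro nn_integral_PInf_AE)
    \<comment> \<open>At distance 0 the equality of \<open>mark_prob\<close> and
      \<open>channel_prob\<close> may fail.\<close>
    moreover have "AE y in lborel. y \<noteq> (0::real)" by (rule AE_lborel_singleton)
    ultimately show "AE y in lborel. ?g y * ?\<phi> y =
        ennreal (LA y * channel_prob p i y * expect_strategy p (f_cu y)) * indicator {0..} y"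
    proof eventually_elim
      case (elim y)
      have "ennreal (expect_strategy p (f_cu y)) = ennreal (f_cu y Within) * ennreal within_prob +
          (\<integral>\<^sup>+t. ennreal (f_cu y (Beyond t)) * (ennreal (dens_c p t) * indicator {R_star p<..} t) \<partial>lborel)"
        using elim(1) f_cu_nonneg by (intro ennreal_expect_strategy) (auto simp: f_cu_def less_top)
      then have E: "ennreal (expect_strategy p (f_cu y)) = ?\<phi> y"
        by (simp add: f_cu_def)
      show ?case
      proof (cases "0 < y")
        case True
        then have "ennreal (LA y * channel_prob p i y * expect_strategy p (f_cu y)) =
            ennreal (LA y) * ennreal (mark_prob p i y) * ennreal (expect_strategy p (f_cu y))"
          using LA_nonneg channel_prob_bounds[of y i] expect_strategy_nonneg[OF f_cu_nonneg[of y]]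
          by (simp add: mark_prob_eq_channel_prob[OF valid] ennreal_mult)
        with True show ?thesis by (simp add: E)
      next
        case False
        with elim(2) show ?thesis by simp
      qed
    qed
  qed
  finally show "?lhs = ?rhs" .
qed

end

theorem proposition2:
  fixes p :: params and w :: "'w network" and \<gamma> :: real
    and A :: "real \<Rightarrow> channel \<Rightarrow> strategy \<Rightarrow> real"
    and A_c :: "real \<Rightarrow> channel \<Rightarrow> real"
    and K :: "channel \<Rightarrow> real \<Rightarrow> strategy \<Rightarrow> ennreal measure"
    and K_c :: "channel \<Rightarrow> real \<Rightarrow> ennreal measure"
    and f_beyond :: "real \<Rightarrow> real \<Rightarrow> real"
  assumes "valid_params p"
    and "network_model p w"
    and "\<gamma> > 0"
    and "is_assoc_prob p w A"
    and "is_assoc_prob_central p w A_c"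
    and "is_interf_law p w K"
    and "is_interf_law_central p w K_c"
    and "is_dens_cu_beyond p w f_beyond"
  defines "L \<equiv> \<lambda>r i S. cond_cov p \<gamma> i r (K i r S)"
    and "L_c \<equiv> \<lambda>r i. cond_cov p \<gamma> i r (K_c i r)"
    and "f_cu \<equiv> \<lambda>r S. case S of Within \<Rightarrow> dens_cu_within p r | Beyond t \<Rightarrow> f_beyond t r"
  shows "coverage p w \<gamma> =
    (LBINT r:{0..}.
       (\<Sum>i\<in>UNIV. expect_strategy p (\<lambda>S. L r i S * A r i S) * dens_R p i r) +
       (\<Sum>i\<in>{Lu, Nu}. L_c r i * A_c r i * channel_prob p i r * expect_strategy p (\<lambda>S. f_cu r S)))"
proof -
  interpret uav_network p w by unfold_locales fact+
  let ?T = "\<lambda>i r. expect_strategy p (\<lambda>S. cond_cov p \<gamma> i r (K i r S) * A r i S) * dens_R p i r"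
  let ?U = "\<lambda>i r. cond_cov p \<gamma> i r (K_c i r) * A_c r i * channel_prob p i r * expect_strategy p (\<lambda>S. case S of Within \<Rightarrow> dens_cu_within p r | Beyond t \<Rightarrow> f_beyond t r)"
  note T = nn_integral_nearest[OF assms(3,4,6)]
  note U = nn_integral_Central[OF assms(3) _ assms(5,7,8)]
  have [measurable]: "?T i \<in> borel_measurable borel" for i
    by (intro borel_measurable_times T(2) measurable_dens_R)
  have [measurable]: "?U i \<in> borel_measurable borel" if "i \<in> {Lu, Nu}" for i
    using U(2)[OF that] by simp
  have T_nonneg: "0 \<le> ?T i r" if "0 < r" for i r
    using T(3) that by (intro mult_nonneg_nonneg dens_R_nonneg) auto
  have T_sum_nonneg: "0 \<le> (\<Sum>i\<in>UNIV. ?T i r)" if "0 < r" for r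
    using that by (intro sum_nonneg T_nonneg)
  have U_sum_nonneg: "0 \<le> (\<Sum>i\<in>{Lu, Nu}. ?U i r)" if "0 < r" for r
    using that by (intro sum_nonneg U(3))
  let ?F = "\<lambda>r. (\<Sum>i\<in>UNIV. ?T i r) + (\<Sum>i\<in>{Lu, Nu}. ?U i r)"
  \<comment> \<open>Nonnegativity of the \<open>channel_prob\<close> terms is known only for
    positive \<open>r\<close>; at 0 the formula follows the convention for division by zero.\<close>
  have nz: "AE r in lborel. r \<noteq> (0::real)" by (rule AE_lborel_singleton)
  have "ennreal (coverage p w \<gamma>) = (\<Sum>i\<in>UNIV. \<integral>\<^sup>+r. ennreal (?T i r) * indicator {0..} r \<partial>lborel) +
      (\<Sum>i\<in>{Lu, Nu}. \<integral>\<^sup>+r. ennreal (?U i r) * indicator {0..} r \<partial>lborel)"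
    unfolding coverage_decomposition[OF assms(3)] emeasure_covered_by_nearest[OF assms(3)]
      covered_by_Central[OF assms(3)] T(1)
    using U(1) by simp
  also have "\<dots> = (\<integral>\<^sup>+r. (\<Sum>i\<in>UNIV. ennreal (?T i r) * indicator {0..} r) \<partial>lborel) +
      (\<integral>\<^sup>+r. (\<Sum>i\<in>{Lu, Nu}. ennreal (?U i r) * indicator {0..} r) \<partial>lborel)"
    by (intro arg_cong2[where f="(+)"] nn_integral_sum[symmetric]) auto
  also have "\<dots> = (\<integral>\<^sup>+r. (\<Sum>i\<in>UNIV. ennreal (?T i r) * indicator {0..} r) +
      (\<Sum>i\<in>{Lu, Nu}. ennreal (?U i r) * indicator {0..} r) \<partial>lborel)"
    by (rule nn_integral_add[symmetric]) auto
  also have "\<dots> = (\<integral>\<^sup>+r. ennreal (indicator {0..} r *\<^sub>R ?F r) \<partial>lborel)"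
  proof (rule nn_integral_cong_AE)
    show "AE r in lborel. (\<Sum>i\<in>UNIV. ennreal (?T i r) * indicator {0..} r) +
      (\<Sum>i\<in>{Lu, Nu}. ennreal (?U i r) * indicator {0..} r) = ennreal (indicator {0..} r *\<^sub>R ?F r)"
      using nz
    proof eventually_elim
      case (elim r)
      show ?case
      proof (cases "0 < r")
        case True
        have "(\<Sum>i\<in>UNIV. ennreal (?T i r)) + (\<Sum>i\<in>{Lu, Nu}. ennreal (?U i r)) =
            ennreal (\<Sum>i\<in>UNIV. ?T i r) + ennreal (\<Sum>i\<in>{Lu, Nu}. ?U i r)"
          using True by (intro arg_cong2[where f="(+)"] sum_ennreal T_nonneg U(3)) auto
        also have "\<dots> = ennreal (?F r)"
          using True by (intro ennreal_plus[symmetric] T_sum_nonneg U_sum_nonneg)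
        finally show ?thesis using True by simp
      next
        case False
        with elim show ?thesis by simp
      qed
    qed
  qed
  finally have "ennreal (coverage p w \<gamma>) = (\<integral>\<^sup>+r. ennreal (indicator {0..} r *\<^sub>R ?F r) \<partial>lborel)" .
  then have "coverage p w \<gamma> = enn2real (\<integral>\<^sup>+r. ennreal (indicator {0..} r *\<^sub>R ?F r) \<partial>lborel)"
    by (rule subst) (simp add: coverage_def)
  also have "\<dots> = (LBINT r:{0..}. ?F r)"
    unfolding set_lebesgue_integral_def
  proof (rule integral_eq_nn_integral[symmetric])
    show "AE r in lborel. 0 \<le> indicator {0..} r *\<^sub>R ?F r"
      using nz
    proof eventually_elim
      case (elim r)
      then show ?case
        using T_sum_nonneg[of r] U_sum_nonneg[of r] by (cases "0 < r") simp_all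
    qed
  qed auto
  finally show ?thesis unfolding L_def L_c_def f_cu_def .
qed

end
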